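(* Let $0<\gamma<1$. Let $f$ belong to $\mathcal C(M,p,\nu_\gamma)$ for some $M>0$ and some $p>2$ ($p=\infty$ allowed), and let $2\le q<p$. Write $S_n(f-\nu_\gamma(f))=\sum_{i=1}^n(f\circ T_\gamma^i-\nu_\gamma(f))$ and let $\|\cdot\|_q$ be the norm of $\mathbb L^q(\nu_\gamma)$. (1) If $\gamma<\dfrac{2(p-q)}{2(p-q)+pq}$, then $\|S_n(f-\nu_\gamma(f))\|_q=O(\sqrt n)$. (2) If $\dfrac{2(p-q)}{2(p-q)+pq}\le\gamma<1$, then, for any $\epsilon>0$, $$\|S_n(f-\nu_\gamma(f))\|_q=O\Big(n^{1+\epsilon-\frac{(1-\gamma)(p-q)}{\gamma pq}}\Big).$$
   Context: For $\gamma\in\,]0,1[$, the map $T_\gamma:[0,1]\to[0,1]$ is $T_\gamma(x)=x(1+2^\gamma x^\gamma)$ if $x\in[0,1/2[$ and $T_\gamma(x)=2x-1$ if $x\in[1/2,1]$. $\nu_\gamma$ is its unique absolutely continuous invariant probability measure on $[0,1]$. For a measure $\mu$ and a function $f$, $\mu(f)=\int f\,d\mu$. For a probability measure $\mu$ on $\mathbb R$, $M>0$ and $p\in\,]1,\infty]$, $\mathrm{Mon}(M,p,\mu)$ is the class of functions $g$ which are monotonic on some open interval of $\mathbb R$ and null elsewhere, and such that $\mu(|g|>t)\le M^pt^{-p}$ for all $t>0$ if $p<\infty$, and $\mu(|g|>M)=0$ if $p=\infty$. $\mathcal C(M,p,\mu)$ is the closure in $\mathbb L^1(\mu)$ of the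 set of functions of the form $\sum_{i=1}^n a_ig_i$ with $\sum_{i=1}^n|a_i|\le1$ and each $g_i\in\mathrm{Mon}(M,p,\mu)$. The measure $\nu_\gamma$ is viewed as a probability measure on $\mathbb R$ supported in $[0,1]$. When $p=\infty$, $q$ is finite and expressions in $p$ are read as their limits as $p\to\infty$: $\frac{2(p-q)}{2(p-q)+pq}=\frac{2}{2+q}$ and $\frac{p-q}{pq}=\frac1q$. *)

theory Defs
  imports "HOL-Probability.Probability" "HOL-Library.Landau_Symbols"
begin

(* The map acts on [0,1]. Its values outside [0,1] are irrelevant junk: all measures
   considered below give no mass to the complement of [0,1], which the map leaves invariant. *)
definition T_map :: "real \<Rightarrow> real \<Rightarrow> real" where
  "T_map \<gamma> x =
     (if 0 \<le> x \<and> x < 1/2 then x * (1 + 2 powr \<gamma> * x powr \<gamma>) else 2 * x - 1)"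

(* Absolutely continuous T_map-invariant probability measures on [0,1], viewed as Borel
   measures on the real line. For 0 < \<gamma> < 1 exactly one such measure exists. *)
definition acip :: "real \<Rightarrow> real measure \<Rightarrow> bool" where
  "acip \<gamma> \<nu> \<longleftrightarrow>
     prob_space \<nu> \<and> sets \<nu> = sets borel \<and> measure \<nu> {0..1} = 1 \<and>
     absolutely_continuous lborel \<nu> \<and> distr \<nu> borel (T_map \<gamma>) = \<nu>"

(* The open interval may be empty, bounded, or unbounded. *)
definition Mon :: "real \<Rightarrow> ereal \<Rightarrow> real measure \<Rightarrow> (real \<Rightarrow> real) set" where
  "Mon M p \<mu> = {g.
     (\<exists>I. open I \<and> is_interval I \<and>
          (mono_on I g \<or> antimono_on I g) \<and> (\<forall>x. x \<notin> I \<longrightarrow> g x = 0)) \<and>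
     (if p = \<infinity> then measure \<mu> {x \<in> space \<mu>. \<bar>g x\<bar> > M} = 0
      else \<forall>t>0. measure \<mu> {x \<in> space \<mu>. \<bar>g x\<bar> > t}
                  \<le> M powr real_of_ereal p * t powr (- real_of_ereal p))}"

definition Mon_combinations :: "real \<Rightarrow> ereal \<Rightarrow> real measure \<Rightarrow> (real \<Rightarrow> real) set" where
  "Mon_combinations M p \<mu> = {h. \<exists>(n::nat) a g.
     (\<Sum>i=1..n. \<bar>a i\<bar>) \<le> 1 \<and> (\<forall>i\<in>{1..n}. g i \<in> Mon M p \<mu>) \<and>
     h = (\<lambda>x. \<Sum>i=1..n. a i * g i x)}"

(* Closure in L^1, expressed on representatives. For p > 1 all functions in
   Mon_combinations M p \<mu> are integrable, so the Bochner integral below is a genuine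
   L^1 distance. *)
definition C_class :: "real \<Rightarrow> ereal \<Rightarrow> real measure \<Rightarrow> (real \<Rightarrow> real) set" where
  "C_class M p \<mu> = {f. integrable \<mu> f \<and>
     (\<forall>\<epsilon>>0. \<exists>h\<in>Mon_combinations M p \<mu>. integrable \<mu> h \<and> (\<integral>x. \<bar>f x - h x\<bar> \<partial>\<mu>) < \<epsilon>)}"

definition in_Lq :: "real measure \<Rightarrow> real \<Rightarrow> (real \<Rightarrow> real) \<Rightarrow> bool" where
  "in_Lq \<mu> q g \<longleftrightarrow> g \<in> borel_measurable \<mu> \<and> integrable \<mu> (\<lambda>x. \<bar>g x\<bar> powr q)"

(* Only meaningful together with in_Lq, since the Bochner integral of a non-integrable
   function is 0. *)
definition Lq_norm :: "real measure \<Rightarrow> real \<Rightarrow> (real \<Rightarrow> real) \<Rightarrow> real" where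
  "Lq_norm \<mu> q g = (\<integral>x. \<bar>g x\<bar> powr q \<partial>\<mu>) powr (1 / q)"

definition centred_sum ::
    "real \<Rightarrow> real measure \<Rightarrow> (real \<Rightarrow> real) \<Rightarrow> nat \<Rightarrow> real \<Rightarrow> real" where
  "centred_sum \<gamma> \<nu> f n x =
     (\<Sum>i=1..n. f ((T_map \<gamma> ^^ i) x) - integral\<^sup>L \<nu> f)"

(* 2(p-q) / (2(p-q) + pq), with its limit for p = \<infinity> *)
definition threshold :: "ereal \<Rightarrow> real \<Rightarrow> real" where
  "threshold p q =
     (if p = \<infinity> then 2 / (2 + q)
      else let r = real_of_ereal p in 2 * (r - q) / (2 * (r - q) + r * q))"

(* (p-q) / (pq), with its limit for p = \<infinity> *)
definition pq_ratio :: "ereal \<Rightarrow> real \<Rightarrow> real" where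
  "pq_ratio p q =
     (if p = \<infinity> then 1 / q else let r = real_of_ereal p in (r - q) / (r * q))"

end

theory Submission
  imports Defs
begin

text \<open>
  Decay of correlations is obtained by a Doeblin argument for the transfer operator L of Lebesgue
  measure. Nonnegative decreasing functions f such that x^(1+gamma) f(x) is increasing and the
  integral of f over (0,x) is at most a x^(1-gamma) times its total integral form an invariant cone,
  and are bounded below by a multiple of their integral. Averaging over the cylinders of the first
  visit to the right half after time N changes such an f by O(N^(1 - 1/gamma)) in L1, and maps every
  nonnegative function into the cone after 2N steps, because the density of a full branch that ends
  in the right half varies by a factor of at most 4. Hence L^2N is, up to this error, a strict
  contraction on functions of mean zero in the cone. Up to an arbitrarily small loss in the exponent,
  this gives the rate n^(1 - 1/gamma) for indicators of intervals, uniformly, and it forces every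
  invariant density to be the limit of L^n 1.

  The moment bound is the dyadic martingale approximation of Peligrad, Utev and Wu: with K the dual
  of composition with T, the sum of 2^R terms is a sum over r of reversed martingales of 2^(R-r)
  terms whose norm is controlled by that of the sum of K^i f over i in [2^r, 2^(r+1)). For an
  indicator centred in mean, the q-th moment of K^i f is at most its L1 norm, i.e. a correlation.
  It is interpolated between the decay rate and the measure of the interval, and the layer cake
  formula with Minkowski's inequality passes from intervals to monotone functions with weak tails.
  The loss in the exponents is harmless since the first case assumes a strict inequality and the
  second allows epsilon.
\<close>

section \<open>The branches and their transfer operators\<close>

text \<open>Write \<delta> = (1 - \<gamma>) / \<gamma> and r = (p - q) / (pq). A fixed block length
  cannot work: near the neutral fixed point the map hardly expands, and cylinders of length N shrink
  only like N^(-1/\<gamma>). The contraction therefore runs on blocks of length N ~ n^\<kappa> with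
  \<kappa> < 1. About n^(1-\<kappa>) blocks give a factor smaller than any power of n, and the block
  error N^(-\<delta>) leaves n^(-\<kappa>\<delta>). The exponents of the theorem come from one
  computation. For a level set of measure a, the correlation at time n is at most a constant times
  a^(1-\<theta>) n^(-\<delta>\<theta>), and its q-th root bounds the norm of the n-th dual iterate.
  For finite p and a ~ t^(-p), the factor a^((1-\<theta>)/q) is integrable in t at infinity exactly
  when \<theta> < qr. So every \<beta> < \<delta>r (capped at 1) is reached, and \<beta> > 1/2 is
  possible exactly when \<gamma> is below the threshold. Nothing but integrability is known
  beforehand about the density of the invariant measure. The correlation bounds are hence proved for
  the densities L^k 1, uniformly in k, and passed to the limit.\<close>

locale lsv =
  fixes \<gamma> :: real
  assumes gamma_pos: "0 < \<gamma>" and gamma_less_1: "\<gamma> < 1"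
begin

text \<open>The left branch, continued as an odd function. It becomes an increasing bijection of the
  reals, so its inverse \<open>y0\<close> is total and the change of variables holds on the whole
  line.\<close>

definition T0 :: "real \<Rightarrow> real" where
  "T0 x = x * (1 + 2 powr \<gamma> * \<bar>x\<bar> powr \<gamma>)"

definition T0' :: "real \<Rightarrow> real" where
  "T0' x = 1 + (1 + \<gamma>) * (2 powr \<gamma> * \<bar>x\<bar> powr \<gamma>)"

lemma T0'_ge_1: "1 \<le> T0' x"
  using gamma_pos by (simp add: T0'_def)

lemma T0'_pos: "0 < T0' x"
  using T0'_ge_1[of x] by linarith

lemma T0_0 [simp]: "T0 0 = 0"
  by (simp add: T0_def)

lemma T0_half [simp]: "T0 (1/2) = 1"
  by (simp add: T0_def powr_mult[symmetric])

lemma continuous_T0': "continuous_on A T0'"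
  unfolding T0'_def using gamma_pos
  by (intro continuous_on_add continuous_on_mult continuous_on_powr' continuous_on_const
        continuous_on_rabs continuous_on_id) auto

lemma continuous_T0: "continuous_on A T0"
  unfolding T0_def using gamma_pos
  by (intro continuous_on_add continuous_on_mult continuous_on_powr' continuous_on_const
        continuous_on_rabs continuous_on_id) auto

lemma T0_measurable [measurable]: "T0 \<in> borel_measurable borel"
  by (rule borel_measurable_continuous_onI[OF continuous_T0])

lemma T0'_measurable [measurable]: "T0' \<in> borel_measurable borel"
  by (rule borel_measurable_continuous_onI[OF continuous_T0'])

text \<open>At 0, where the power of the absolute value is not differentiable, the difference
  quotient of \<open>T0\<close> is 1 + 2^\<gamma> |h|^\<gamma>. Away from 0 the sign of x removes
  the absolute value.\<close>

lemma T0_has_derivative: "(T0 has_real_derivative T0' x) (at x)"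
proof -
  consider "x = 0" | "x > 0" | "x < 0" by linarith
  then show ?thesis
  proof cases
    case 1
    have "((\<lambda>h. 1 + 2 powr \<gamma> * \<bar>h\<bar> powr \<gamma>) \<longlongrightarrow> 1 + 2 powr \<gamma> * \<bar>0\<bar> powr \<gamma>) (at 0)"
      using gamma_pos by (intro tendsto_intros) auto
    then have "((\<lambda>h. 1 + 2 powr \<gamma> * \<bar>h\<bar> powr \<gamma>) \<longlongrightarrow> T0' x) (at (0::real))"
      using 1 by (simp add: T0'_def)
    then have "((\<lambda>h. (T0 (x + h) - T0 x) / h) \<longlongrightarrow> T0' x) (at 0)"
      by (rule Lim_transform_eventually) (auto simp: 1 T0_def eventually_at intro!: exI[of _ 1])
    then show ?thesis by (simp add: DERIV_def)
  next
    case 2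
    have "((\<lambda>x. x * (1 + 2 powr \<gamma> * x powr \<gamma>)) has_real_derivative T0' x) (at x)"
      using 2 by (auto intro!: derivative_eq_intros simp: T0'_def field_simps powr_diff)
    then show ?thesis
      by (rule has_field_derivative_transform_within[where d=x]) (use 2 in \<open>auto simp: T0_def dist_real_def\<close>)
  next
    case 3
    have "((\<lambda>x. x * (1 + 2 powr \<gamma> * (-x) powr \<gamma>)) has_real_derivative T0' x) (at x)"
      using 3 by (auto intro!: derivative_eq_intros simp: T0'_def field_simps powr_diff)
    then show ?thesis
      by (rule has_field_derivative_transform_within[where d="-x"]) (use 3 in \<open>auto simp: T0_def dist_real_def\<close>)
  qed
qed

lemma T0_strict_mono: "strict_mono T0"
  by (rule strict_monoI, rule DERIV_pos_imp_increasing)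
     (auto intro!: exI[of _ "T0' _"] T0_has_derivative T0'_pos)

lemma T0_less_iff: "T0 x < T0 y \<longleftrightarrow> x < y"
  by (rule strict_mono_less[OF T0_strict_mono])

text \<open>\<open>T0 x\<close> has the sign of x and at least its modulus, so the values at -|y|
  and |y| enclose y.\<close>

lemma T0_surj: "surj T0"
proof -
  have "\<exists>x. T0 x = y" for y
  proof -
    have "T0 (-\<bar>y\<bar>) \<le> y" "y \<le> T0 \<bar>y\<bar>"
      unfolding T0_def by (auto simp: abs_if distrib_left mult_le_0_iff algebra_simps)
         (smt (verit) mult_nonneg_nonneg powr_ge_zero mult_nonpos_nonneg)+
    then show ?thesis
      using IVT'[of T0 "-\<bar>y\<bar>" y "\<bar>y\<bar>"] continuous_T0 by force
  qed
  then show ?thesis by (metis surjI)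
qed

definition y0 :: "real \<Rightarrow> real" where "y0 = inv T0"

lemma T0_y0 [simp]: "T0 (y0 x) = x"
  unfolding y0_def by (rule surj_f_inv_f[OF T0_surj])

lemma y0_T0 [simp]: "y0 (T0 x) = x"
  unfolding y0_def by (rule inv_f_f[OF strict_mono_imp_inj_on[OF T0_strict_mono]])

lemma y0_less_iff: "y0 x < z \<longleftrightarrow> x < T0 z" "z < y0 x \<longleftrightarrow> T0 z < x"
  using T0_less_iff[of "y0 x" z] T0_less_iff[of z "y0 x"] by auto

lemma y0_less [simp]: "y0 x < y0 y \<longleftrightarrow> x < y"
  by (simp add: y0_less_iff)

lemma y0_le [simp]: "y0 x \<le> y0 y \<longleftrightarrow> x \<le> y"
  using y0_less[of y x] by linarith

lemma y0_0 [simp]: "y0 0 = 0" using y0_T0[of 0] by simp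

lemma y0_1 [simp]: "y0 1 = 1/2" using y0_T0[of "1/2"] by simp

lemma y0_measurable [measurable]: "y0 \<in> borel_measurable borel"
  by (rule borel_measurable_mono) (auto simp: mono_def)

lemma T_map_measurable [measurable]: "T_map \<gamma> \<in> borel_measurable borel"
  unfolding T_map_def[abs_def] by measurable

lemma T_map_left: "0 \<le> x \<Longrightarrow> x < 1/2 \<Longrightarrow> T_map \<gamma> x = T0 x"
  by (simp add: T_map_def T0_def)

lemma T_map_right: "1/2 \<le> x \<Longrightarrow> T_map \<gamma> x = 2 * x - 1"
  by (simp add: T_map_def)

lemma T_map_pow_measurable [measurable]: "(T_map \<gamma> ^^ n) \<in> borel_measurable borel"
  by (induction n) (auto simp: id_def comp_def)

text \<open>By the fundamental theorem of calculus both measures give the same length to every open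
  interval.\<close>

lemma distr_T0: "distr (density lborel (\<lambda>x. ennreal (T0' x))) borel T0 = lborel"
proof (rule lborel_eqI[symmetric])
  fix l u :: real assume "\<And>b. b \<in> Basis \<Longrightarrow> l \<bullet> b \<le> u \<bullet> b"
  then have lu: "l \<le> u" by simp
  have eq: "T0 -` {l<..<u} = {y0 l<..<y0 u}"
    by (auto simp: y0_less_iff)
  have "emeasure (distr (density lborel (\<lambda>x. ennreal (T0' x))) borel T0) {l<..<u} =
      (\<integral>\<^sup>+x. ennreal (T0' x) * indicator {y0 l<..<y0 u} x \<partial>lborel)"
    by (subst emeasure_distr) (auto simp: eq emeasure_density)
  also have "\<dots> = (\<integral>\<^sup>+x. ennreal (T0' x) * indicator {y0 l..y0 u} x \<partial>lborel)"
    using AE_lborel_singleton[of "y0 l"] AE_lborel_singleton[of "y0 u"]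
    by (intro nn_integral_cong_AE) (auto simp: indicator_def)
  also have "\<dots> = ennreal (T0 (y0 u) - T0 (y0 l))"
    using lu by (intro nn_integral_FTC_Icc)
      (auto intro!: T0'_pos less_imp_le has_field_derivative_at_within T0_has_derivative)
  finally show "emeasure (distr (density lborel (\<lambda>x. ennreal (T0' x))) borel T0) (box l u) =
      ennreal (\<Prod>b\<in>Basis. (u - l) \<bullet> b)"
    by (simp add: box_real)
qed simp

lemma T0_substitution:
  fixes G :: "real \<Rightarrow> real"
  assumes [measurable]: "G \<in> borel_measurable borel"
  shows "integrable lborel (\<lambda>x. G (T0 x) * T0' x) \<longleftrightarrow> integrable lborel G"
    and "(\<integral>x. G (T0 x) * T0' x \<partial>lborel) = (\<integral>x. G x \<partial>lborel)"
proof -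
  have "integrable lborel G \<longleftrightarrow> integrable (density lborel (\<lambda>x. ennreal (T0' x))) (\<lambda>x. G (T0 x))"
    by (subst distr_T0[symmetric], subst integrable_distr_eq) auto
  also have "\<dots> \<longleftrightarrow> integrable lborel (\<lambda>x. G (T0 x) * T0' x)"
    by (subst integrable_density) (auto simp: T0'_pos less_imp_le mult.commute)
  finally show "integrable lborel (\<lambda>x. G (T0 x) * T0' x) \<longleftrightarrow> integrable lborel G" ..
  have "(\<integral>x. G x \<partial>lborel) = (\<integral>x. G (T0 x) \<partial>density lborel (\<lambda>x. ennreal (T0' x)))"
    by (subst distr_T0[symmetric], subst integral_distr) auto
  also have "\<dots> = (\<integral>x. G (T0 x) * T0' x \<partial>lborel)"
    by (subst integral_density) (auto simp: T0'_pos less_imp_le mult.commute)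
  finally show "(\<integral>x. G (T0 x) * T0' x \<partial>lborel) = (\<integral>x. G x \<partial>lborel)" ..
qed

text \<open>\<open>True\<close> stands for the right branch and \<open>False\<close> for the left
  one, here and in all words below.\<close>

definition br :: "bool \<Rightarrow> real \<Rightarrow> real" where
  "br b x = (if b then (1 + x) / 2 else y0 x)"

definition dbr :: "bool \<Rightarrow> real \<Rightarrow> real" where
  "dbr b x = (if b then 1 / 2 else 1 / T0' (y0 x))"

definition Ib :: "bool \<Rightarrow> real set" where
  "Ib b = (if b then {1/2<..<1} else {0<..<1/2})"

text \<open>Transfer operator of one branch with respect to Lebesgue measure. The open unit interval
  is used throughout, so that the neutral fixed point is left out.\<close>
definition Lb :: "bool \<Rightarrow> (real \<Rightarrow> real) \<Rightarrow> real \<Rightarrow> real" where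
  "Lb b f x = indicator {0<..<1} x * (f (br b x) * dbr b x)"

definition L :: "(real \<Rightarrow> real) \<Rightarrow> real \<Rightarrow> real" where
  "L f x = Lb False f x + Lb True f x"

lemma dbr_pos: "0 < dbr b x"
  using T0'_pos by (simp add: dbr_def)

lemma br_measurable: "br b \<in> borel_measurable borel"
  unfolding br_def[abs_def] by measurable

lemma dbr_measurable: "dbr b \<in> borel_measurable borel"
  unfolding dbr_def[abs_def] by measurable

lemma Ib_measurable [measurable]: "Ib b \<in> sets borel"
  by (simp add: Ib_def)

lemma Lb_measurable [measurable]:
  assumes [measurable]: "f \<in> borel_measurable borel"
  shows "Lb b f \<in> borel_measurable borel"
  unfolding Lb_def[abs_def]
  by (intro borel_measurable_times measurable_compose[OF br_measurable] dbr_measurable) measurable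

lemma br_strict_mono: "x < y \<Longrightarrow> br b x < br b y"
  by (auto simp: br_def)

lemma br_mono: "x \<le> y \<Longrightarrow> br b x \<le> br b y"
  by (auto simp: br_def)

lemma br_bounds:
  assumes "0 < x" "x < 1" shows "br b x \<in> Ib b" "0 < br b x" "br b x < 1"
proof -
  have "0 < y0 x" "y0 x < 1/2"
    using assms y0_less[of 0 x] y0_less[of x 1] by auto
  then show "br b x \<in> Ib b" "0 < br b x" "br b x < 1"
    using assms by (auto simp: br_def Ib_def)
qed

lemma T_map_Ib:
  assumes "z \<in> Ib b" shows "0 < T_map \<gamma> z" "T_map \<gamma> z < 1" "br b (T_map \<gamma> z) = z"
proof -
  have "0 < T0 z" "T0 z < 1" if "0 < z" "z < 1/2"
    using that T0_less_iff[of 0 z] T0_less_iff[of z "1/2"] by auto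
  then show "0 < T_map \<gamma> z" "T_map \<gamma> z < 1" "br b (T_map \<gamma> z) = z"
    using assms by (auto simp: Ib_def br_def T_map_left T_map_right split: if_splits)
qed

text \<open>T maps \<open>Ib b\<close> bijectively onto (0,1), and \<open>dbr b\<close> is the
  derivative of the inverse. The left branch is an instance of \<open>T0_substitution\<close>, the
  right one of the affine change of variables.\<close>

lemma br_substitution:
  fixes G :: "real \<Rightarrow> real"
  assumes [measurable]: "G \<in> borel_measurable borel"
  shows "integrable lborel (\<lambda>x. indicator {0<..<1} x * (G x * dbr b x)) \<longleftrightarrow>
      integrable lborel (\<lambda>z. indicator (Ib b) z * G (T_map \<gamma> z))" (is ?A)
    and "(\<integral>x. indicator {0<..<1} x * (G x * dbr b x) \<partial>lborel) =
      (\<integral>z. indicator (Ib b) z * G (T_map \<gamma> z) \<partial>lborel)" (is ?B)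
proof -
  note [measurable] = dbr_measurable[of b]
  have "?A \<and> ?B"
  proof (cases b)
    case False
    have eq: "indicator {0<..<1} (T0 z) * (G (T0 z) * dbr b (T0 z)) * T0' z =
        indicator (Ib b) z * G (T_map \<gamma> z)" for z
    proof -
      have "T0 z \<in> {0<..<1} \<longleftrightarrow> z \<in> {0<..<1/2}"
        using T0_less_iff[of 0 z] T0_less_iff[of z "1/2"] by auto
      then show ?thesis
        using False T0'_pos[of z] by (auto simp: Ib_def dbr_def indicator_def T_map_left)
    qed
    show ?thesis
      using T0_substitution[of "\<lambda>x. indicator {0<..<1} x * (G x * dbr b x)"] unfolding eq by simp
  next
    case True
    let ?H = "\<lambda>x. indicator {0<..<1} x * (G x * dbr b x)"
    have eq: "2 * ?H (-1 + 2 * z) = indicator (Ib b) z * G (T_map \<gamma> z)" for z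
      using True by (auto simp: Ib_def dbr_def indicator_def T_map_right)
    have "integrable lborel ?H \<longleftrightarrow> integrable lborel (\<lambda>z. 2 * ?H (-1 + 2 * z))"
      using lborel_integrable_real_affine_iff[of 2 ?H "-1"] by simp
    moreover have "(\<integral>x. ?H x \<partial>lborel) = (\<integral>z. 2 * ?H (-1 + 2 * z) \<partial>lborel)"
      using lborel_integral_real_affine[of 2 ?H "-1"] by simp
    ultimately show ?thesis unfolding eq by simp
  qed
  then show ?A ?B by auto
qed

lemma Lb_duality:
  fixes \<psi> :: "real \<Rightarrow> real"
  assumes f: "integrable lborel f" and [measurable]: "\<psi> \<in> borel_measurable borel"
    and b: "\<And>x. \<bar>\<psi> x\<bar> \<le> B"
  shows "integrable lborel (\<lambda>x. Lb b f x * \<psi> x)"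
    and "(\<integral>x. Lb b f x * \<psi> x \<partial>lborel) =
      (\<integral>z. indicator (Ib b) z * f z * \<psi> (T_map \<gamma> z) \<partial>lborel)"
proof -
  note [measurable] = br_measurable[of b]
  have [measurable]: "f \<in> borel_measurable borel" using f by simp
  have eq1: "Lb b f x * \<psi> x = indicator {0<..<1} x * ((f (br b x) * \<psi> x) * dbr b x)" for x
    by (simp add: Lb_def)
  have eq2: "indicator (Ib b) z * (f (br b (T_map \<gamma> z)) * \<psi> (T_map \<gamma> z)) =
      indicator (Ib b) z * f z * \<psi> (T_map \<gamma> z)" for z
    using T_map_Ib(3)[of z b] by (auto simp: indicator_def)
  have "integrable lborel (\<lambda>z. indicator (Ib b) z * f z * \<psi> (T_map \<gamma> z))"
  proof (rule Bochner_Integration.integrable_bound)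
    show "integrable lborel (\<lambda>z. B * f z)" using f by simp
    have B: "0 \<le> B" using b[of 0] by linarith
    show "AE z in lborel. norm (indicator (Ib b) z * f z * \<psi> (T_map \<gamma> z)) \<le> norm (B * f z)"
      using B b by (auto simp: indicator_def abs_mult mult.commute[of B] intro!: AE_I2 mult_left_mono)
  qed measurable
  then show "integrable lborel (\<lambda>x. Lb b f x * \<psi> x)"
    unfolding eq1 by (subst br_substitution) (auto simp: eq2)
  show "(\<integral>x. Lb b f x * \<psi> x \<partial>lborel) = (\<integral>z. indicator (Ib b) z * f z * \<psi> (T_map \<gamma> z) \<partial>lborel)"
    unfolding eq1 by (subst br_substitution) (auto simp: eq2)
qed

end

text \<open>A Bernoulli inequality that loses a factor 2 and so holds for exponents below 1 as well:
  ln(1 + t) \<ge> t/(1 + t) \<ge> t/2 on [0,1], then exp y \<ge> 1 + y.\<close>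

lemma one_add_powr_ge:
  fixes \<beta> t :: real
  assumes "0 < \<beta>" "0 \<le> t" "t \<le> 1"
  shows "1 + \<beta> / 2 * t \<le> (1 + t) powr \<beta>"
proof -
  have "ln (1 / (1 + t)) \<le> 1 / (1 + t) - 1"
    using assms by (intro ln_le_minus_one) auto
  moreover have "ln (1 / (1 + t)) = - ln (1 + t)" using assms by (simp add: ln_div)
  moreover have "1 - 1 / (1 + t) = t / (1 + t)" using assms by (simp add: field_simps)
  ultimately have "t / (1 + t) \<le> ln (1 + t)" by linarith
  moreover have "t / 2 \<le> t / (1 + t)" using assms by (intro divide_left_mono) auto
  ultimately have "t / 2 \<le> ln (1 + t)" by linarith
  then have "\<beta> * (t / 2) \<le> \<beta> * ln (1 + t)"
    using assms by (intro mult_left_mono) auto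
  also have "1 + \<beta> * ln (1 + t) \<le> (1 + t) powr \<beta>"
    using assms exp_ge_add_one_self[of "\<beta> * ln (1 + t)"] by (simp add: powr_def)
  finally show ?thesis by simp
qed

section \<open>Positive operators on integrable functions that vanish outside (0,1)\<close>

definition supp01 :: "(real \<Rightarrow> real) \<Rightarrow> bool" where
  "supp01 f \<longleftrightarrow> integrable lborel f \<and> (\<forall>x. x \<notin> {0<..<1} \<longrightarrow> f x = 0)"

lemma supp01_integrable: "supp01 f \<Longrightarrow> integrable lborel f"
  by (simp add: supp01_def)

lemma supp01_outside: "supp01 f \<Longrightarrow> \<not> (0 < x \<and> x < 1) \<Longrightarrow> f x = 0"
  by (auto simp: supp01_def)

lemma supp01_measurable: "supp01 f \<Longrightarrow> f \<in> borel_measurable borel"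
  by (auto simp: supp01_def)

lemma supp01_add: "supp01 f \<Longrightarrow> supp01 g \<Longrightarrow> supp01 (\<lambda>x. f x + g x)"
  by (simp add: supp01_def)

lemma supp01_diff: "supp01 f \<Longrightarrow> supp01 g \<Longrightarrow> supp01 (\<lambda>x. f x - g x)"
  by (simp add: supp01_def)

lemma supp01_scale: "supp01 f \<Longrightarrow> supp01 (\<lambda>x. c * f x)"
  by (simp add: supp01_def)

lemma supp01_abs: "supp01 f \<Longrightarrow> supp01 (\<lambda>x. \<bar>f x\<bar>)"
  by (simp add: supp01_def)

lemma supp01_sum: "(\<And>i. i \<in> A \<Longrightarrow> supp01 (f i)) \<Longrightarrow> supp01 (\<lambda>x. \<Sum>i\<in>A. f i x)"
  by (auto simp: supp01_def intro!: sum.neutral)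

definition unif :: "real \<Rightarrow> real" where "unif = indicator {0<..<1}"

lemma supp01_unif: "supp01 unif"
  by (simp add: supp01_def unif_def)

lemma integral_unif [simp]: "(\<integral>x. unif x \<partial>lborel) = 1"
  by (simp add: unif_def)

lemma supp01_bounded:
  assumes [measurable]: "f \<in> borel_measurable borel"
    and b: "\<And>x. \<bar>f x\<bar> \<le> B" and o: "\<And>x. x \<notin> {0<..<1} \<Longrightarrow> f x = 0"
  shows "supp01 f"
proof -
  have "integrable lborel f"
  proof (rule Bochner_Integration.integrable_bound)
    show "integrable lborel (\<lambda>x. B * unif x)"
      using supp01_unif by (simp add: supp01_def)
    have "norm (f x) \<le> norm (B * unif x)" for x
      using b[of x] o[of x] by (cases "x \<in> {0<..<1}") (auto simp: unif_def)
    then show "AE x in lborel. norm (f x) \<le> norm (B * unif x)" by simp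
  qed simp
  with o show ?thesis by (simp add: supp01_def)
qed

lemma supp01_mult:
  assumes f: "supp01 f" and [measurable]: "\<psi> \<in> borel_measurable borel" and b: "\<And>x. \<bar>\<psi> x\<bar> \<le> B"
  shows "supp01 (\<lambda>x. f x * \<psi> x)"
proof -
  note [measurable] = supp01_measurable[OF f]
  have "integrable lborel (\<lambda>x. f x * \<psi> x)"
  proof (rule Bochner_Integration.integrable_bound)
    show "integrable lborel (\<lambda>x. B * f x)" using f by (simp add: supp01_def)
    have "0 \<le> B" using b[of 0] by linarith
    then show "AE x in lborel. norm (f x * \<psi> x) \<le> norm (B * f x)"
      using b by (auto simp: abs_mult mult.commute[of B] intro!: AE_I2 mult_left_mono)
  qed simp
  with f show ?thesis by (simp add: supp01_def)
qed

text \<open>The properties shared by the branch operators, their compositions and powers. Linearity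
  and monotonicity can be demanded for arbitrary functions because all these operators are sums of
  pointwise weighted compositions. Monotonicity only looks at (0,1).\<close>

definition pos_op :: "((real \<Rightarrow> real) \<Rightarrow> real \<Rightarrow> real) \<Rightarrow> bool" where
  "pos_op A \<longleftrightarrow>
     (\<forall>f g. A (\<lambda>x. f x + g x) = (\<lambda>x. A f x + A g x)) \<and>
     (\<forall>c f. A (\<lambda>x. c * f x) = (\<lambda>x. c * A f x)) \<and>
     (\<forall>f g. (\<forall>x. 0 < x \<and> x < 1 \<longrightarrow> f x \<le> g x) \<longrightarrow>
        (\<forall>x. 0 < x \<and> x < 1 \<longrightarrow> A f x \<le> A g x)) \<and>
     (\<forall>f. supp01 f \<longrightarrow> supp01 (A f)) \<and>
     (\<forall>f. supp01 f \<longrightarrow> (\<forall>x. 0 \<le> f x) \<longrightarrow> (\<integral>x. A f x \<partial>lborel) \<le> (\<integral>x. f x \<partial>lborel))"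

lemma pos_op_add: "pos_op A \<Longrightarrow> A (\<lambda>x. f x + g x) = (\<lambda>x. A f x + A g x)"
  and pos_op_scale: "pos_op A \<Longrightarrow> A (\<lambda>x. c * f x) = (\<lambda>x. c * A f x)"
  and pos_op_mono: "pos_op A \<Longrightarrow> (\<And>x. 0 < x \<Longrightarrow> x < 1 \<Longrightarrow> f x \<le> g x) \<Longrightarrow>
    0 < x \<Longrightarrow> x < 1 \<Longrightarrow> A f x \<le> A g x"
  and pos_op_supp01: "pos_op A \<Longrightarrow> supp01 f \<Longrightarrow> supp01 (A f)"
  and pos_op_mass: "pos_op A \<Longrightarrow> supp01 f \<Longrightarrow> (\<And>x. 0 \<le> f x) \<Longrightarrow>
    (\<integral>x. A f x \<partial>lborel) \<le> (\<integral>x. f x \<partial>lborel)"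
  unfolding pos_op_def by blast+

lemma pos_op_zero: "pos_op A \<Longrightarrow> A (\<lambda>x. 0) = (\<lambda>x. 0)"
  using pos_op_scale[of A 0 "\<lambda>x. 0"] by simp

lemma pos_op_nonneg:
  assumes A: "pos_op A" and f: "supp01 f" "\<And>x. 0 < x \<Longrightarrow> x < 1 \<Longrightarrow> 0 \<le> f x"
  shows "0 \<le> A f x"
  using pos_op_mono[OF A, of "\<lambda>x. 0" f x] f supp01_outside[OF pos_op_supp01[OF A f(1)], of x]
  by (cases "0 < x \<and> x < 1") (auto simp: pos_op_zero[OF A])

lemma pos_op_diff: "pos_op A \<Longrightarrow> A (\<lambda>x. f x - g x) = (\<lambda>x. A f x - A g x)"
  using pos_op_add[of A f "\<lambda>x. (-1) * g x"] pos_op_scale[of A "-1" g] by simp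

lemma pos_op_sum:
  assumes A: "pos_op A"
  shows "A (\<lambda>x. \<Sum>i\<in>I. f i x) = (\<lambda>x. \<Sum>i\<in>I. A (f i) x)"
proof (induction I rule: infinite_finite_induct)
  case (insert i I)
  have "A (\<lambda>x. \<Sum>i\<in>insert i I. f i x) = A (\<lambda>x. f i x + (\<Sum>i\<in>I. f i x))"
    using insert by simp
  also have "\<dots> = (\<lambda>x. A (f i) x + A (\<lambda>x. \<Sum>i\<in>I. f i x) x)"
    by (rule pos_op_add[OF A])
  finally show ?case using insert by simp
qed (simp_all add: pos_op_zero[OF A])

lemma pos_op_comp:
  assumes A: "pos_op A" and B: "pos_op B" shows "pos_op (\<lambda>f. A (B f))"
  unfolding pos_op_def
proof (intro conjI allI impI)
  fix f assume f: "supp01 f" "\<forall>x. 0 \<le> f x"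
  have "(\<integral>x. A (B f) x \<partial>lborel) \<le> (\<integral>x. B f x \<partial>lborel)"
    using f by (intro pos_op_mass[OF A] pos_op_supp01[OF B] pos_op_nonneg[OF B]) auto
  also have "\<dots> \<le> (\<integral>x. f x \<partial>lborel)" using f by (intro pos_op_mass[OF B]) auto
  finally show "(\<integral>x. A (B f) x \<partial>lborel) \<le> (\<integral>x. f x \<partial>lborel)" .
next
  fix f g :: "real \<Rightarrow> real" and c :: real
  show "A (B (\<lambda>x. f x + g x)) = (\<lambda>x. A (B f) x + A (B g) x)"
    by (simp only: pos_op_add[OF A] pos_op_add[OF B])
  show "A (B (\<lambda>x. c * f x)) = (\<lambda>x. c * A (B f) x)"
    by (simp only: pos_op_scale[OF A] pos_op_scale[OF B])
next
  fix f g :: "real \<Rightarrow> real" and x :: real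
  assume "\<forall>x. 0 < x \<and> x < 1 \<longrightarrow> f x \<le> g x" "0 < x \<and> x < 1"
  then show "A (B f) x \<le> A (B g) x"
    by (intro pos_op_mono[OF A] pos_op_mono[OF B]) auto
next
  fix f assume "supp01 f"
  then show "supp01 (A (B f))" by (intro pos_op_supp01[OF A] pos_op_supp01[OF B])
qed

lemma pos_op_pow: "pos_op A \<Longrightarrow> pos_op (A ^^ n)"
proof (induction n)
  case 0 then show ?case by (simp add: pos_op_def)
next
  case (Suc n) then show ?case using pos_op_comp[of A "A ^^ n"] by (simp add: comp_def)
qed

lemma pos_op_abs:
  assumes A: "pos_op A" and f: "supp01 f" shows "\<bar>A f x\<bar> \<le> A (\<lambda>x. \<bar>f x\<bar>) x"
proof (cases "0 < x \<and> x < 1")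
  case True
  have "A f x \<le> A (\<lambda>x. \<bar>f x\<bar>) x" "A (\<lambda>x. (-1) * f x) x \<le> A (\<lambda>x. \<bar>f x\<bar>) x"
    using True by (intro pos_op_mono[OF A]; simp)+
  then show ?thesis using pos_op_scale[OF A, of "-1" f] by simp
next
  case False
  then show ?thesis
    using supp01_outside[OF pos_op_supp01[OF A f], of x]
      supp01_outside[OF pos_op_supp01[OF A supp01_abs[OF f]], of x] by simp
qed

lemma pos_op_L1:
  assumes A: "pos_op A" and f: "supp01 f"
  shows "(\<integral>x. \<bar>A f x\<bar> \<partial>lborel) \<le> (\<integral>x. \<bar>f x\<bar> \<partial>lborel)"
proof -
  have "(\<integral>x. \<bar>A f x\<bar> \<partial>lborel) \<le> (\<integral>x. A (\<lambda>x. \<bar>f x\<bar>) x \<partial>lborel)"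
    by (intro integral_mono pos_op_abs[OF A f] supp01_integrable supp01_abs pos_op_supp01[OF A] f)
  also have "\<dots> \<le> (\<integral>x. \<bar>f x\<bar> \<partial>lborel)"
    by (intro pos_op_mass[OF A] supp01_abs f) auto
  finally show ?thesis .
qed

section \<open>The transfer operator of the full map\<close>

context lsv
begin

lemma supp01_Lb: "supp01 f \<Longrightarrow> supp01 (Lb b f)"
  using Lb_duality(1)[of f "\<lambda>_. 1" 1 b] unfolding supp01_def
  by (auto simp: Lb_def[abs_def])

lemma pos_op_Lb: "pos_op (Lb b)"
  unfolding pos_op_def
proof (intro conjI allI impI)
  fix f g :: "real \<Rightarrow> real" and c :: real
  show "Lb b (\<lambda>x. f x + g x) = (\<lambda>x. Lb b f x + Lb b g x)"
    "Lb b (\<lambda>x. c * f x) = (\<lambda>x. c * Lb b f x)"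
    by (auto simp: Lb_def algebra_simps)
next
  fix f g :: "real \<Rightarrow> real" and x :: real
  assume "\<forall>x. 0 < x \<and> x < 1 \<longrightarrow> f x \<le> g x" "0 < x \<and> x < 1"
  then show "Lb b f x \<le> Lb b g x"
    using br_bounds[of x b] dbr_pos[of b x] by (auto simp: Lb_def indicator_def intro!: mult_right_mono)
next
  fix f assume f: "supp01 f" "\<forall>x. 0 \<le> f x"
  have "(\<integral>x. Lb b f x \<partial>lborel) = (\<integral>z. indicator (Ib b) z * f z \<partial>lborel)"
    using Lb_duality(2)[of f "\<lambda>_. 1" 1 b] f by (simp add: supp01_def)
  also have "\<dots> \<le> (\<integral>z. f z \<partial>lborel)"
    using f integrable_mult_indicator[of "Ib b" lborel f]
    by (intro integral_mono) (auto simp: supp01_def indicator_def)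
  finally show "(\<integral>x. Lb b f x \<partial>lborel) \<le> (\<integral>z. f z \<partial>lborel)" .
next
  fix f assume "supp01 f"
  then show "supp01 (Lb b f)" by (rule supp01_Lb)
qed

text \<open>The two branch domains miss only the point 1/2 of (0,1), which is a null set, so the two
  instances of \<open>Lb_duality\<close> add up to the full integral.\<close>

lemma L_duality:
  fixes \<psi> :: "real \<Rightarrow> real"
  assumes f: "supp01 f" and [measurable]: "\<psi> \<in> borel_measurable borel" and b: "\<And>x. \<bar>\<psi> x\<bar> \<le> B"
  shows "(\<integral>x. L f x * \<psi> x \<partial>lborel) = (\<integral>z. f z * \<psi> (T_map \<gamma> z) \<partial>lborel)"
proof -
  have fi: "integrable lborel f" using f by (simp add: supp01_def)
  then have [measurable]: "f \<in> borel_measurable borel" by simp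
  have i: "integrable lborel (\<lambda>z. indicator (Ib b) z * f z * \<psi> (T_map \<gamma> z))" for b
    by (rule Bochner_Integration.integrable_bound[of _ "\<lambda>z. f z * \<psi> (T_map \<gamma> z)"])
      (auto simp: indicator_def intro!: supp01_integrable supp01_mult[OF f, of _ B] b)
  have "(\<integral>x. L f x * \<psi> x \<partial>lborel) = (\<integral>x. Lb False f x * \<psi> x + Lb True f x * \<psi> x \<partial>lborel)"
    by (simp add: L_def algebra_simps)
  also have "\<dots> = (\<integral>z. indicator (Ib False) z * f z * \<psi> (T_map \<gamma> z) +
      indicator (Ib True) z * f z * \<psi> (T_map \<gamma> z) \<partial>lborel)"
    using Lb_duality[OF fi _ b] i by simp
  also have "\<dots> = (\<integral>z. f z * \<psi> (T_map \<gamma> z) \<partial>lborel)"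
  proof (rule integral_cong_AE)
    show "AE z in lborel. indicator (Ib False) z * f z * \<psi> (T_map \<gamma> z) +
      indicator (Ib True) z * f z * \<psi> (T_map \<gamma> z) = f z * \<psi> (T_map \<gamma> z)"
      using AE_lborel_singleton[of "1/2"]
    proof (eventually_elim)
      case (elim z)
      then show ?case using supp01_outside[OF f, of z]
        by (auto simp: Ib_def indicator_def)
    qed
  qed auto
  finally show ?thesis .
qed

lemma pos_op_L: "pos_op L"
  unfolding pos_op_def
proof (intro conjI allI impI)
  fix f g :: "real \<Rightarrow> real" and c :: real
  show "L (\<lambda>x. f x + g x) = (\<lambda>x. L f x + L g x)" "L (\<lambda>x. c * f x) = (\<lambda>x. c * L f x)"
    unfolding L_def pos_op_add[OF pos_op_Lb] pos_op_scale[OF pos_op_Lb] by (auto simp: algebra_simps)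
next
  fix f assume f: "supp01 f" "\<forall>x. 0 \<le> f x"
  show "(\<integral>x. L f x \<partial>lborel) \<le> (\<integral>z. f z \<partial>lborel)"
    using L_duality[OF f(1), of "\<lambda>_. 1" 1] by simp
next
  fix f g :: "real \<Rightarrow> real" and x :: real
  assume "\<forall>x. 0 < x \<and> x < 1 \<longrightarrow> f x \<le> g x" "0 < x \<and> x < 1"
  then show "L f x \<le> L g x"
    unfolding L_def by (intro add_mono pos_op_mono[OF pos_op_Lb]) auto
next
  fix f assume "supp01 f"
  then show "supp01 (L f)"
    unfolding L_def[abs_def] by (intro supp01_add supp01_Lb)
qed

lemma supp01_L_pow: "supp01 f \<Longrightarrow> supp01 ((L ^^ n) f)"
  by (rule pos_op_supp01[OF pos_op_pow[OF pos_op_L]])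

lemma L_pow_duality:
  fixes \<psi> :: "real \<Rightarrow> real"
  assumes f: "supp01 f" and m: "\<psi> \<in> borel_measurable borel" and b: "\<And>x. \<bar>\<psi> x\<bar> \<le> B"
  shows "(\<integral>x. (L ^^ n) f x * \<psi> x \<partial>lborel) = (\<integral>z. f z * \<psi> ((T_map \<gamma> ^^ n) z) \<partial>lborel)"
  using m b
proof (induction n arbitrary: \<psi>)
  case (Suc n)
  note [measurable] = Suc.prems(1)
  have "(\<integral>x. (L ^^ Suc n) f x * \<psi> x \<partial>lborel) = (\<integral>x. (L ^^ n) f x * \<psi> (T_map \<gamma> x) \<partial>lborel)"
    using L_duality[OF supp01_L_pow[OF f], of \<psi> B n] Suc.prems by simp
  also have "\<dots> = (\<integral>z. f z * \<psi> (T_map \<gamma> ((T_map \<gamma> ^^ n) z)) \<partial>lborel)"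
    using Suc.prems by (intro Suc.IH) auto
  finally show ?case by simp
qed simp

lemma L_pow_mass: "supp01 f \<Longrightarrow> (\<integral>x. (L ^^ n) f x \<partial>lborel) = (\<integral>z. f z \<partial>lborel)"
  using L_pow_duality[of f "\<lambda>_. 1" 1] by simp

section \<open>An invariant cone\<close>

lemma integrable_indicator_Ioo: "integrable lborel (\<lambda>z. c * indicator {a<..<b::real} z :: real)"
  by (cases "a \<le> b") (auto intro!: integrable_mult_right integrable_real_indicator)

definition nonneg :: "(real \<Rightarrow> real) \<Rightarrow> bool" where
  "nonneg f \<longleftrightarrow> (\<forall>x. 0 \<le> f x)"

definition dec :: "(real \<Rightarrow> real) \<Rightarrow> bool" where
  "dec f \<longleftrightarrow> (\<forall>x y. 0 < x \<and> x \<le> y \<and> y < 1 \<longrightarrow> f y \<le> f x)"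

text \<open>Complements \<open>dec\<close>: for x < y the value at x exceeds that at y by a factor
  of at most (y/x)^(1+\<gamma>). The exponent 1 + \<gamma> is the smallest for which the left
  weights in \<open>reg_weight_mono\<close> increase.\<close>

definition reg :: "(real \<Rightarrow> real) \<Rightarrow> bool" where
  "reg f \<longleftrightarrow> (\<forall>x y. 0 < x \<and> x \<le> y \<and> y < 1 \<longrightarrow>
      x powr (1 + \<gamma>) * f x \<le> y powr (1 + \<gamma>) * f y)"

text \<open>The value makes \<open>cone_const\<close> (1 - \<gamma>) / 2 equal to 2, which is what
  \<open>cone_const_step\<close> consumes.\<close>

definition cone_const :: real where "cone_const = 4 / (1 - \<gamma>)"

text \<open>The part of the cone conditions that survives multiplication by the indicator of (0,t),
  unlike \<open>reg\<close>. The parameter s replaces the integral, since truncation lowers the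
  integral while the bound near 0 is inherited only in terms of the old one.\<close>

definition G :: "real \<Rightarrow> (real \<Rightarrow> real) \<Rightarrow> bool" where
  "G s f \<longleftrightarrow> supp01 f \<and> nonneg f \<and> dec f \<and> (\<integral>x. f x \<partial>lborel) \<le> s \<and>
     (\<forall>x. 0 < x \<and> x < 1 \<longrightarrow>
        (\<integral>z. f z * indicator {0<..<x} z \<partial>lborel) \<le> cone_const * x powr (1 - \<gamma>) * s)"

definition cone :: "(real \<Rightarrow> real) \<Rightarrow> bool" where
  "cone f \<longleftrightarrow> G (\<integral>x. f x \<partial>lborel) f \<and> reg f"

lemma nonneg_Lb: "nonneg f \<Longrightarrow> nonneg (Lb b f)"
  using dbr_pos[of b] by (auto simp: nonneg_def Lb_def less_imp_le)

lemma dbr_antimono: "0 < x \<Longrightarrow> x \<le> y \<Longrightarrow> dbr b y \<le> dbr b x"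
proof -
  assume *: "0 < x" "x \<le> y"
  have "0 \<le> y0 x" using * y0_less[of 0 x] by (simp del: y0_less)
  moreover have le: "y0 x \<le> y0 y" using * by simp
  ultimately have "\<bar>y0 x\<bar> \<le> \<bar>y0 y\<bar>" by linarith
  then have "T0' (y0 x) \<le> T0' (y0 y)"
    using gamma_pos unfolding T0'_def by (intro add_left_mono mult_left_mono powr_mono2) auto
  then show ?thesis using T0'_pos by (auto simp: dbr_def intro!: divide_left_mono)
qed

lemma dec_Lb: "nonneg f \<Longrightarrow> dec f \<Longrightarrow> dec (Lb b f)"
  unfolding dec_def nonneg_def
proof (intro allI impI)
  fix x y :: real assume f: "\<forall>x. 0 \<le> f x" "\<forall>x y. 0 < x \<and> x \<le> y \<and> y < 1 \<longrightarrow> f y \<le> f x"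
    and *: "0 < x \<and> x \<le> y \<and> y < 1"
  have "f (br b y) * dbr b y \<le> f (br b x) * dbr b x"
    using f * br_bounds[of x b] br_bounds[of y b] br_mono[of x y b] dbr_antimono[of x y b] dbr_pos[of b y]
    by (intro mult_mono) auto
  then show "Lb b f y \<le> Lb b f x" using * by (simp add: Lb_def)
qed

text \<open>The numerator of the derivative is (1 + \<gamma>) (1 + s)^\<gamma> \<gamma> s. With s =
  (2y)^\<gamma> the quotient is the weight of the left branch in \<open>reg_weight_mono\<close>,
  because T0 y = y (1 + s) and T0' y = 1 + (1 + \<gamma>) s.\<close>

lemma one_add_powr_quotient_mono:
  fixes s t :: real
  assumes "0 \<le> s" "s \<le> t"
  shows "(1 + s) powr (1 + \<gamma>) / (1 + (1 + \<gamma>) * s) \<le> (1 + t) powr (1 + \<gamma>) / (1 + (1 + \<gamma>) * t)"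
proof (rule DERIV_nonneg_imp_nondecreasing[OF assms(2)])
  fix x assume x: "s \<le> x" "x \<le> t"
  then have pos: "0 < 1 + (1 + \<gamma>) * x" using assms gamma_pos by (intro add_pos_nonneg mult_nonneg_nonneg) auto
  let ?D = "((1 + \<gamma>) * (1 + x) powr \<gamma> * (1 + (1 + \<gamma>) * x) - (1 + x) powr (1 + \<gamma>) * (1 + \<gamma>)) /
        ((1 + (1 + \<gamma>) * x) * (1 + (1 + \<gamma>) * x))"
  have "((\<lambda>s. (1 + s) powr (1 + \<gamma>) / (1 + (1 + \<gamma>) * s)) has_real_derivative ?D) (at x)"
    using x assms pos by (auto intro!: derivative_eq_intros)
  moreover have "(1 + \<gamma>) * (1 + x) powr \<gamma> * (1 + (1 + \<gamma>) * x) - (1 + x) powr (1 + \<gamma>) * (1 + \<gamma>) =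
     (1 + \<gamma>) * (1 + x) powr \<gamma> * (\<gamma> * x)"
    using x assms by (simp add: powr_add algebra_simps)
  then have "0 \<le> ?D"
    using x assms gamma_pos pos by simp
  ultimately show "\<exists>y. ((\<lambda>s. (1 + s) powr (1 + \<gamma>) / (1 + (1 + \<gamma>) * s)) has_real_derivative y) (at x) \<and> 0 \<le> y"
    by blast
qed

lemma reg_weight_mono:
  assumes "0 < x" "x \<le> y" "y < 1"
  shows "(x / br b x) powr (1 + \<gamma>) * dbr b x \<le> (y / br b y) powr (1 + \<gamma>) * dbr b y"
proof (cases b)
  case True
  have "x / br b x \<le> y / br b y"
    using True assms by (auto simp: br_def field_simps)
  then show ?thesis
    using True assms gamma_pos by (auto simp: dbr_def br_def intro!: divide_right_mono powr_mono2)
next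
  case False
  have eq: "(x / br b x) powr (1 + \<gamma>) * dbr b x = (1 + s) powr (1 + \<gamma>) / (1 + (1 + \<gamma>) * s)"
    if "0 < x" "s = 2 powr \<gamma> * y0 x powr \<gamma>" for x s
  proof -
    have z: "0 < y0 x" using that y0_less[of 0 x] by (simp del: y0_less)
    have "x / y0 x = T0 (y0 x) / y0 x" by simp
    also have "\<dots> = 1 + s" using z that unfolding T0_def by simp
    finally show ?thesis using False z that by (simp add: br_def dbr_def T0'_def)
  qed
  have z: "0 < y0 x" using assms y0_less[of 0 x] by (simp del: y0_less)
  have "y0 x \<le> y0 y" using assms by simp
  then show ?thesis
    using assms z gamma_pos
    by (subst (1 2) eq) (auto intro!: one_add_powr_quotient_mono mult_left_mono powr_mono2)
qed

text \<open>With y = br b x, the product x^(1+\<gamma>) Lb b f x splits into y^(1+\<gamma>) f y,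
  which increases by \<open>reg f\<close>, and the weight of \<open>reg_weight_mono\<close>; both
  factors are non-negative.\<close>

lemma reg_Lb: "nonneg f \<Longrightarrow> reg f \<Longrightarrow> reg (Lb b f)"
  unfolding reg_def nonneg_def
proof (intro allI impI)
  fix x y :: real assume f: "\<forall>x. 0 \<le> f x"
      "\<forall>x y. 0 < x \<and> x \<le> y \<and> y < 1 \<longrightarrow> x powr (1 + \<gamma>) * f x \<le> y powr (1 + \<gamma>) * f y"
    and *: "0 < x \<and> x \<le> y \<and> y < 1"
  have eq: "x powr (1 + \<gamma>) * Lb b f x =
      (br b x powr (1 + \<gamma>) * f (br b x)) * ((x / br b x) powr (1 + \<gamma>) * dbr b x)"
    if "0 < x" "x < 1" for x
    using that br_bounds[of x b] by (simp add: Lb_def powr_divide)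
  have "0 < br b x" "br b x \<le> br b y" "br b y < 1" "0 < br b y"
    using * br_bounds[of x b] br_bounds[of y b] br_mono[of x y b] by auto
  then have "br b x powr (1 + \<gamma>) * f (br b x) \<le> br b y powr (1 + \<gamma>) * f (br b y)"
    using f(2) by blast
  moreover have "(x / br b x) powr (1 + \<gamma>) * dbr b x \<le> (y / br b y) powr (1 + \<gamma>) * dbr b y"
    using * by (intro reg_weight_mono) auto
  ultimately have "(br b x powr (1 + \<gamma>) * f (br b x)) * ((x / br b x) powr (1 + \<gamma>) * dbr b x) \<le>
    (br b y powr (1 + \<gamma>) * f (br b y)) * ((y / br b y) powr (1 + \<gamma>) * dbr b y)"
    by (rule mult_mono) (use f(1) dbr_pos[of b x] in \<open>auto intro!: mult_nonneg_nonneg simp: less_imp_le\<close>)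
  then show "x powr (1 + \<gamma>) * Lb b f x \<le> y powr (1 + \<gamma>) * Lb b f y"
    using * by (simp add: eq)
qed

lemma nonneg_add: "nonneg f \<Longrightarrow> nonneg g \<Longrightarrow> nonneg (\<lambda>x. f x + g x)"
  and dec_add: "dec f \<Longrightarrow> dec g \<Longrightarrow> dec (\<lambda>x. f x + g x)"
  and reg_add: "reg f \<Longrightarrow> reg g \<Longrightarrow> reg (\<lambda>x. f x + g x)"
  by (auto simp: nonneg_def dec_def reg_def distrib_left intro: add_mono)

lemma nonneg_scale: "0 \<le> c \<Longrightarrow> nonneg f \<Longrightarrow> nonneg (\<lambda>x. c * f x)"
  and dec_scale: "0 \<le> c \<Longrightarrow> dec f \<Longrightarrow> dec (\<lambda>x. c * f x)"
  and reg_scale: "0 \<le> c \<Longrightarrow> reg f \<Longrightarrow> reg (\<lambda>x. c * f x)"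
  by (auto simp: nonneg_def dec_def reg_def mult.left_commute[of _ c] intro: mult_left_mono)

lemma cone_const_ge_4: "4 \<le> cone_const"
  using gamma_pos gamma_less_1 by (simp add: cone_const_def field_simps)

text \<open>With y = y0 x and t = (2y)^\<gamma> one has x = y (1 + t). Raising this to the power 1 -
  \<gamma> gains at least (1 - \<gamma>)/2 times y^(1-\<gamma>) t \<ge> y, and x \<le> 2y. In
  \<open>G_L\<close> the summand x pays for the mass that enters through the right branch.\<close>

lemma cone_const_step:
  assumes "0 < x" "x < 1"
  shows "cone_const * y0 x powr (1 - \<gamma>) + x \<le> cone_const * x powr (1 - \<gamma>)"
proof -
  define y where "y = y0 x"
  have y: "0 < y" "y < 1/2" using assms y0_less[of 0 x] y0_less[of x 1] by (auto simp: y_def)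
  define t where "t = (2 * y) powr \<gamma>"
  have t: "0 \<le> t" "t \<le> 1" using y gamma_pos by (auto simp: t_def intro: powr_le1)
  have x: "x = y * (1 + t)"
  proof -
    have "x = T0 y" by (simp add: y_def)
    then show ?thesis using y by (simp add: T0_def t_def powr_mult)
  qed
  have "cone_const * y powr (1 - \<gamma>) * (1 + (1 - \<gamma>) / 2 * t) \<le> cone_const * y powr (1 - \<gamma>) * (1 + t) powr (1 - \<gamma>)"
    using t cone_const_ge_4 gamma_less_1 by (intro mult_left_mono one_add_powr_ge) auto
  also have "\<dots> = cone_const * x powr (1 - \<gamma>)" using y t by (simp add: x powr_mult)
  finally have 1: "cone_const * y powr (1 - \<gamma>) + cone_const * (1 - \<gamma>) / 2 * (y powr (1 - \<gamma>) * t) \<le> cone_const * x powr (1 - \<gamma>)"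
    by (simp add: algebra_simps)
  have "y powr (1 - \<gamma>) * t = y powr (1 - \<gamma>) * y powr \<gamma> * 2 powr \<gamma>"
    using y by (simp add: t_def powr_mult)
  also have "\<dots> = y * 2 powr \<gamma>" using y by (simp add: powr_add[symmetric])
  finally have "y \<le> y powr (1 - \<gamma>) * t" using y gamma_pos by (simp add: ge_one_powr_ge_zero)
  moreover have "cone_const * (1 - \<gamma>) / 2 = 2" using gamma_less_1 by (simp add: cone_const_def divide_simps) (simp add: algebra_simps)?
  moreover have "x \<le> 2 * y" using x t y mult_left_mono[of t 1 y] by (simp add: algebra_simps)
  ultimately show ?thesis using 1 by (simp add: y_def)
qed

lemma G_L:
  assumes f: "G s f" shows "G s (L f)"
  unfolding G_def
proof (intro conjI allI impI)
  have ok: "supp01 f" and nn: "nonneg f" and dec: "dec f" and le: "(\<integral>x. f x \<partial>lborel) \<le> s"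
    and bd: "\<And>x. 0 < x \<Longrightarrow> x < 1 \<Longrightarrow> (\<integral>z. f z * indicator {0<..<x} z \<partial>lborel) \<le> cone_const * x powr (1 - \<gamma>) * s"
    using f by (auto simp: G_def)
  note [measurable] = supp01_measurable[OF ok]
  show "supp01 (L f)" by (rule pos_op_supp01[OF pos_op_L ok])
  show "nonneg (L f)" unfolding L_def by (intro nonneg_add nonneg_Lb nn)
  show "dec (L f)" unfolding L_def by (intro dec_add dec_Lb nn dec)
  show "(\<integral>x. L f x \<partial>lborel) \<le> s" using le L_duality[OF ok, of "\<lambda>_. 1" 1] by simp
  fix x :: real assume x: "0 < x \<and> x < 1"
  have "0 \<le> (\<integral>x. f x \<partial>lborel)" using nn by (simp add: nonneg_def)
  with le have s: "0 \<le> s" by linarith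
  have sm: "supp01 (\<lambda>z. f z * indicator A z)" if "A \<in> sets borel" for A
    using that by (intro supp01_mult[OF ok, of _ 1]) (auto simp: indicator_def)
  \<comment> \<open>As f decreases, its mass on (0,1/2) is at least f(1/2)/2. Hence f is at most 2s
    on the right half.\<close>
  have "f (1/2) * (1/2) = (\<integral>z. f (1/2) * indicator {0<..<1/2::real} z \<partial>lborel)" by simp
  also have "\<dots> \<le> (\<integral>z. f z \<partial>lborel)"
  proof (intro integral_mono)
    show "f (1 / 2) * indicator {0<..<1 / 2} z \<le> f z" for z
      using dec nn by (auto simp: dec_def nonneg_def indicator_def)
    show "integrable lborel (\<lambda>z. f (1 / 2) * indicator {0<..<1 / 2::real} z)"
      by (rule integrable_indicator_Ioo)
  qed (auto intro: supp01_integrable ok)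
  finally have half: "f (1/2) \<le> 2 * s" using le by simp
  define y where "y = y0 x"
  have y: "0 < y" "y < 1/2" using x y0_less[of 0 x] y0_less[of x 1] by (auto simp: y_def)
  \<comment> \<open>The preimage of (0,x) consists of (0,y) and a right piece of length x/2, on
    which f is at most f(1/2).\<close>
  have pw: "f z * indicator {0<..<x} (T_map \<gamma> z) \<le>
      f z * indicator {0<..<y} z + f (1/2) * indicator {1/2<..<(1+x)/2} z" for z
  proof -
    consider "z \<le> 0 \<or> 1 \<le> z" | "0 < z" "z < 1/2" | "1/2 \<le> z" "z < 1" by linarith
    then show ?thesis
    proof cases
      case 1 then show ?thesis
        using supp01_outside[OF ok, of z] nn by (auto simp: nonneg_def indicator_def)
    next
      case 2 then show ?thesis
        using nn y0_less_iff(2)[of z x] by (auto simp: T_map_left nonneg_def indicator_def y_def)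
    next
      case 3
      have "f z \<le> f (1/2)" using 3 dec by (auto simp: dec_def)
      with 3 show ?thesis
        using nn by (auto simp: T_map_right nonneg_def indicator_def field_simps)
    qed
  qed
  have "(\<integral>z. L f z * indicator {0<..<x} z \<partial>lborel) = (\<integral>z. f z * indicator {0<..<x} (T_map \<gamma> z) \<partial>lborel)"
    by (rule L_duality[OF ok, of _ 1]) (auto simp: indicator_def)
  also have "\<dots> \<le> (\<integral>z. f z * indicator {0<..<y} z + f (1/2) * indicator {1/2<..<(1+x)/2} z \<partial>lborel)"
    by (intro integral_mono pw Bochner_Integration.integrable_add integrable_indicator_Ioo
        supp01_integrable[OF sm] supp01_integrable[OF supp01_mult[OF ok, of _ 1]]) (auto simp: indicator_def)
  also have "\<dots> = (\<integral>z. f z * indicator {0<..<y} z \<partial>lborel) + (\<integral>z. f (1/2) * indicator {1/2<..<(1+x)/2} z \<partial>lborel)"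
    by (intro Bochner_Integration.integral_add integrable_indicator_Ioo supp01_integrable[OF sm]) auto
  also have "\<dots> \<le> cone_const * y powr (1 - \<gamma>) * s + f (1/2) * (x / 2)"
    using x y bd[of y] by (simp add: field_simps)
  also have "\<dots> \<le> cone_const * y powr (1 - \<gamma>) * s + 2 * s * (x / 2)"
    using half x by (intro add_left_mono mult_right_mono) auto
  also have "\<dots> = (cone_const * y powr (1 - \<gamma>) + x) * s" by (simp add: algebra_simps)
  also have "\<dots> \<le> (cone_const * x powr (1 - \<gamma>)) * s"
    unfolding y_def using x s by (intro mult_right_mono cone_const_step) auto
  finally show "(\<integral>z. L f z * indicator {0<..<x} z \<partial>lborel) \<le> cone_const * x powr (1 - \<gamma>) * s" .
qed

lemma G_L_pow: "G s f \<Longrightarrow> G s ((L ^^ n) f)"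
  by (induction n) (auto intro: G_L)

lemma cone_L: "cone f \<Longrightarrow> cone (L f)"
  using G_L[of "\<integral>x. f x \<partial>lborel" f] L_pow_mass[of f 1] reg_Lb[of f] reg_add
  unfolding cone_def L_def[abs_def] by (auto simp: G_def L_def[abs_def])

lemma cone_L_pow: "cone f \<Longrightarrow> cone ((L ^^ n) f)"
  by (induction n) (auto intro: cone_L)

lemma cone_add:
  assumes "cone f" "cone g" shows "cone (\<lambda>x. f x + g x)"
proof -
  have ok: "supp01 f" "supp01 g" using assms by (auto simp: cone_def G_def)
  have I: "(\<integral>x. f x + g x \<partial>lborel) = (\<integral>x. f x \<partial>lborel) + (\<integral>x. g x \<partial>lborel)"
    using ok by (auto simp: supp01_def)
  have J: "(\<integral>z. (f z + g z) * indicator {0<..<x} z \<partial>lborel) =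
    (\<integral>z. f z * indicator {0<..<x} z \<partial>lborel) + (\<integral>z. g z * indicator {0<..<x} z \<partial>lborel)" for x :: real
    unfolding distrib_right using ok
    by (intro Bochner_Integration.integral_add supp01_integrable supp01_mult[of _ _ 1]) (auto simp: indicator_def)
  show ?thesis
    using assms ok unfolding cone_def G_def I J
    by (auto intro!: supp01_add nonneg_add dec_add reg_add add_mono simp: distrib_left)
qed

lemma cone_scale:
  assumes "cone f" "0 \<le> c" shows "cone (\<lambda>x. c * f x)"
  using assms unfolding cone_def G_def
  by (auto intro!: supp01_scale nonneg_scale dec_scale reg_scale simp: mult.assoc mult.left_commute[of _ c]
      intro: mult_left_mono)

text \<open>Averaging the ratio bound over y gives f \<le> 4m for the mass m, so the mass below x is
  at most 4xm, and x \<le> x^(1-\<gamma>) on (0,1). It remains that \<open>cone_const\<close> is at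
  least 4.\<close>

lemma cone_bounded_ratio:
  assumes ok: "supp01 f" and nn: "nonneg f" and d: "dec f" and r: "reg f"
    and rat: "\<And>x y. 0 < x \<Longrightarrow> x < 1 \<Longrightarrow> 0 < y \<Longrightarrow> y < 1 \<Longrightarrow> f x \<le> 4 * f y"
  shows "cone f"
proof -
  define m where "m = (\<integral>x. f x \<partial>lborel)"
  have fle: "f x \<le> 4 * m" if "0 < x" "x < 1" for x
  proof -
    have "f x = (\<integral>z. f x * unif z \<partial>lborel)" by simp
    also have "\<dots> \<le> (\<integral>z. 4 * f z \<partial>lborel)"
    proof (rule integral_mono)
      show "f x * unif z \<le> 4 * f z" for z
        using that rat[of x z] nn by (auto simp: unif_def indicator_def nonneg_def)
    qed (use ok supp01_unif in \<open>auto simp: supp01_def\<close>)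
    finally show ?thesis by (simp add: m_def)
  qed
  have m: "0 \<le> m" using nn by (simp add: m_def nonneg_def)
  have "(\<integral>z. f z * indicator {0<..<x} z \<partial>lborel) \<le> cone_const * x powr (1 - \<gamma>) * m" if x: "0 < x" "x < 1" for x
  proof -
    have "(\<integral>z. f z * indicator {0<..<x} z \<partial>lborel) \<le> (\<integral>z. 4 * m * indicator {0<..<x} z \<partial>lborel)"
    proof (rule integral_mono)
      show "f z * indicator {0<..<x} z \<le> 4 * m * indicator {0<..<x} z" for z
        using fle[of z] x by (auto simp: indicator_def)
      show "integrable lborel (\<lambda>z. f z * indicator {0<..<x} z)"
        by (intro supp01_integrable supp01_mult[OF ok, of _ 1]) (auto simp: indicator_def)
      show "integrable lborel (\<lambda>z. 4 * m * indicator {0<..<x} z)"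
        by (rule integrable_indicator_Ioo)
    qed
    also have "\<dots> = 4 * x * m" using x by simp
    also have "\<dots> \<le> cone_const * x powr (1 - \<gamma>) * m"
    proof (intro mult_right_mono mult_mono m)
      have "x powr 1 \<le> x powr (1 - \<gamma>)" using x gamma_pos by (intro powr_mono') auto
      then show "x \<le> x powr (1 - \<gamma>)" using x by simp
    qed (use cone_const_ge_4 x in auto)
    finally show ?thesis .
  qed
  with assms show ?thesis by (auto simp: cone_def G_def m_def)
qed

lemma cone_unif: "cone unif"
  by (rule cone_bounded_ratio)
    (use gamma_pos supp01_unif in \<open>auto simp: nonneg_def dec_def reg_def unif_def intro!: powr_mono2\<close>)

text \<open>By the choice of x0 at least half of the mass lies in [x0,1). For z there, f z is at
  most f x / x0^2 for every x: by \<open>reg\<close> if z \<le> x, by \<open>dec\<close> if x < z.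
  Integration over z gives the constant x0^2 / 2.\<close>

lemma cone_lower_bound:
  "\<exists>\<sigma>>0. \<sigma> < 1 \<and> (\<forall>f x. cone f \<longrightarrow> 0 < x \<longrightarrow> x < 1 \<longrightarrow> \<sigma> * (\<integral>x. f x \<partial>lborel) \<le> f x)"
proof -
  define x0 where "x0 = (1 / (2 * cone_const)) powr (1 / (1 - \<gamma>))"
  have a: "0 < 1 / (2 * cone_const)" "1 / (2 * cone_const) < 1" using cone_const_ge_4 by auto
  have x0: "0 < x0" "x0 < 1" 
    using a gamma_less_1 powr_less_mono2[of "1 / (1 - \<gamma>)" "1 / (2 * cone_const)" 1] by (auto simp: x0_def)
  have ax: "cone_const * x0 powr (1 - \<gamma>) = 1 / 2"
    using cone_const_ge_4 gamma_less_1 by (simp add: x0_def powr_powr)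
  show ?thesis
  proof (intro exI[of _ "x0 powr 2 / 2"] conjI allI impI)
    show "0 < x0 powr 2 / 2" using x0 by simp
    have "x0 powr 2 < 1" using x0 powr_less_mono2[of 2 x0 1] by simp
    then show "x0 powr 2 / 2 < 1" by simp
    fix f x assume f: "cone f" and x: "0 < x" "x < (1::real)"
    define m where "m = (\<integral>x. f x \<partial>lborel)"
    have ok: "supp01 f" and nn: "nonneg f" and d: "dec f" and r: "reg f"
      and bd: "(\<integral>z. f z * indicator {0<..<x0} z \<partial>lborel) \<le> cone_const * x0 powr (1 - \<gamma>) * m"
      using f x0 by (auto simp: cone_def G_def m_def)
    note [measurable] = supp01_measurable[OF ok]
    have le: "x0 powr 2 * f z \<le> f x" if z: "x0 \<le> z" "z < 1" for z
    proof (cases "z \<le> x")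
      case True
      have "x0 powr 2 * f z \<le> z powr (1 + \<gamma>) * f z"
      proof (rule mult_right_mono)
        have "x0 powr 2 \<le> x0 powr (1 + \<gamma>)" using x0 gamma_less_1 by (intro powr_mono') auto
        also have "\<dots> \<le> z powr (1 + \<gamma>)" using z x0 gamma_pos by (intro powr_mono2) auto
        finally show "x0 powr 2 \<le> z powr (1 + \<gamma>)" .
      qed (use nn in \<open>simp add: nonneg_def\<close>)
      also have "\<dots> \<le> x powr (1 + \<gamma>) * f x" using r True x x0 z by (auto simp: reg_def)
      also have "\<dots> \<le> 1 * f x"
        using x gamma_pos nn by (intro mult_right_mono powr_le1) (auto simp: nonneg_def)
      finally show ?thesis by simp
    next
      case False
      have "x0 powr 2 * f z \<le> 1 * f z"
        using x0 nn by (intro mult_right_mono powr_le1) (auto simp: nonneg_def)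
      also have "f z \<le> f x" using d False x z by (auto simp: dec_def)
      finally show ?thesis by simp
    qed
    have "m - m / 2 \<le> m - (\<integral>z. f z * indicator {0<..<x0} z \<partial>lborel)"
      using bd ax by simp
    also have "\<dots> = (\<integral>z. f z - f z * indicator {0<..<x0} z \<partial>lborel)"
      unfolding m_def using ok
      by (intro Bochner_Integration.integral_diff[symmetric] supp01_integrable supp01_mult[OF ok, of _ 1])
         (auto simp: indicator_def)
    also have "\<dots> \<le> (\<integral>z. f x / x0 powr 2 * unif z \<partial>lborel)"
    proof (rule integral_mono)
      show "integrable lborel (\<lambda>z. f z - f z * indicator {0<..<x0} z)"
        by (intro Bochner_Integration.integrable_diff supp01_integrable supp01_mult[OF ok, of _ 1] ok)
          (auto simp: indicator_def)
      show "integrable lborel (\<lambda>z. f x / x0 powr 2 * unif z)"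
        using supp01_unif by (simp add: supp01_def)
      show "f z - f z * indicator {0<..<x0} z \<le> f x / x0 powr 2 * unif z" for z
        using le[of z] supp01_outside[OF ok, of z] x0 nn
        by (auto simp: indicator_def unif_def field_simps nonneg_def)
    qed
    also have "\<dots> = f x / x0 powr 2" by simp
    finally show "x0 powr 2 / 2 * (\<integral>x. f x \<partial>lborel) \<le> f x"
      using x0 by (simp add: m_def[symmetric] field_simps)
  qed
qed

section \<open>Cylinders\<close>

text \<open>The first letter is the branch taken first. So \<open>Lw w\<close> transports the mass
  on the cylinder of w onto (0,1), and \<open>Yw w\<close> is the inverse of this full
  branch.\<close>

fun Lw :: "bool list \<Rightarrow> (real \<Rightarrow> real) \<Rightarrow> real \<Rightarrow> real" where
  "Lw [] f = f"
| "Lw (b # w) f = Lw w (Lb b f)"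

fun Yw :: "bool list \<Rightarrow> real \<Rightarrow> real" where
  "Yw [] x = x"
| "Yw (b # w) x = br b (Yw w x)"

fun words :: "nat \<Rightarrow> bool list set" where
  "words 0 = {[]}"
| "words (Suc n) = Cons False ` words n \<union> Cons True ` words n"

lemma finite_words: "finite (words n)"
  by (induction n) auto

lemma length_words: "w \<in> words n \<Longrightarrow> length w = n"
  by (induction n arbitrary: w) auto

lemma sum_words_Suc:
  fixes h :: "bool list \<Rightarrow> real"
  shows "(\<Sum>w\<in>words (Suc n). h w) = (\<Sum>w\<in>words n. h (False # w)) + (\<Sum>w\<in>words n. h (True # w))"
proof -
  have "(\<Sum>w\<in>words (Suc n). h w) = (\<Sum>w\<in>Cons False ` words n. h w) + (\<Sum>w\<in>Cons True ` words n. h w)"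
    unfolding words.simps by (rule sum.union_disjoint) (auto simp: finite_words)
  then show ?thesis by (simp add: sum.reindex)
qed

lemma pos_op_Lw: "pos_op (Lw w)"
proof (induction w)
  case Nil then show ?case using pos_op_pow[OF pos_op_L, of 0] by (simp add: id_def)
next
  case (Cons b w) then show ?case using pos_op_comp[OF Cons pos_op_Lb[of b]] by simp
qed

lemma L_pow_words: "(L ^^ n) f x = (\<Sum>w\<in>words n. Lw w f x)"
proof (induction n arbitrary: f)
  case (Suc n)
  have "L f = (\<lambda>x. Lb False f x + Lb True f x)" by (rule ext) (rule L_def)
  then have "(L ^^ Suc n) f x = (L ^^ n) (\<lambda>x. Lb False f x + Lb True f x) x"
    by (simp only: funpow_Suc_right comp_apply)
  also have "\<dots> = (L ^^ n) (Lb False f) x + (L ^^ n) (Lb True f) x"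
    using pos_op_add[OF pos_op_pow[OF pos_op_L], of n "Lb False f" "Lb True f"] by simp
  finally show ?case unfolding sum_words_Suc Suc by simp
qed simp

lemma Yw_bounds: "0 < x \<Longrightarrow> x < 1 \<Longrightarrow> 0 < Yw w x \<and> Yw w x < 1"
  by (induction w) (auto intro: br_bounds)

lemma Yw_mono: "x \<le> y \<Longrightarrow> Yw w x \<le> Yw w y"
  by (induction w) (auto intro: br_mono)

lemma br_endpoints: "0 \<le> x \<Longrightarrow> x \<le> 1 \<Longrightarrow> 0 \<le> br b x \<and> br b x \<le> 1"
  using br_mono[of 0 x b] br_mono[of x 1 b] by (auto simp: br_def split: if_splits)

lemma Yw_endpoints: "0 \<le> Yw w 0" "Yw w 1 \<le> 1"
proof -
  have "0 \<le> Yw w x \<and> Yw w x \<le> 1" if "0 \<le> x" "x \<le> 1" for x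
    using that by (induction w) (auto simp: br_endpoints)
  then show "0 \<le> Yw w 0" "Yw w 1 \<le> 1" by auto
qed

text \<open>\<open>Lw w unif\<close> is the Jacobian of \<open>Yw w\<close>, so f enters only
  through its value at the preimage.\<close>

lemma Lw_factor: "0 < x \<Longrightarrow> x < 1 \<Longrightarrow> Lw w f x = f (Yw w x) * Lw w unif x"
proof (induction w arbitrary: f)
  case Nil then show ?case by (simp add: unif_def)
next
  case (Cons b w)
  have Y: "0 < Yw w x" "Yw w x < 1" using Yw_bounds Cons.prems by auto
  have "Lb b f (Yw w x) = f (br b (Yw w x)) * Lb b unif (Yw w x)"
    using Y br_bounds[of "Yw w x" b] by (simp add: Lb_def unif_def)
  then show ?case using Cons.IH[of "Lb b f"] Cons.IH[of "Lb b unif"] Cons.prems by simp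
qed

text \<open>Induction on the word: the points of \<open>Ib b\<close> that T maps into the cylinder
  of w lie in the cylinder of \<open>b # w\<close>.\<close>

lemma Lw_mass_le:
  "supp01 f \<Longrightarrow> nonneg f \<Longrightarrow>
    (\<integral>x. Lw w f x \<partial>lborel) \<le> (\<integral>x. f x * indicator {Yw w 0<..<Yw w 1} x \<partial>lborel)"
proof (induction w arbitrary: f)
  case Nil
  have "f x * indicator {0<..<1} x = f x" for x
    using supp01_outside[OF Nil(1), of x] by (auto simp: indicator_def)
  then have "(\<lambda>x. f x * indicator {0<..<1} x) = f" by blast
  then show ?case by (simp only: Lw.simps Yw.simps order_refl)
next
  case (Cons b w)
  note ok = Cons.prems(1) and nn = Cons.prems(2)
  note [measurable] = supp01_measurable[OF ok]
  have ii: "integrable lborel (\<lambda>x. f x * indicator A x)" if "A \<in> sets borel" for A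
    using that by (intro supp01_integrable supp01_mult[OF ok, of _ 1]) (auto simp: indicator_def)
  have "(\<integral>x. Lw (b # w) f x \<partial>lborel) \<le> (\<integral>x. Lb b f x * indicator {Yw w 0<..<Yw w 1} x \<partial>lborel)"
    using Cons.IH[of "Lb b f"] ok nn by (simp add: supp01_Lb nonneg_Lb)
  also have "\<dots> = (\<integral>z. indicator (Ib b) z * f z * indicator {Yw w 0<..<Yw w 1} (T_map \<gamma> z) \<partial>lborel)"
    by (rule Lb_duality(2)[of _ _ 1]) (use ok in \<open>auto simp: supp01_def indicator_def\<close>)
  also have "\<dots> \<le> (\<integral>x. f x * indicator {Yw (b # w) 0<..<Yw (b # w) 1} x \<partial>lborel)"
  proof (rule integral_mono)
    show "integrable lborel (\<lambda>z. indicator (Ib b) z * f z * indicator {Yw w 0<..<Yw w 1} (T_map \<gamma> z))"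
      by (rule Bochner_Integration.integrable_bound[OF supp01_integrable[OF ok]])
        (auto simp: indicator_def)
    show "integrable lborel (\<lambda>x. f x * indicator {Yw (b # w) 0<..<Yw (b # w) 1} x)"
      by (rule ii) simp
    show "indicator (Ib b) z * f z * indicator {Yw w 0<..<Yw w 1} (T_map \<gamma> z) \<le>
        f z * indicator {Yw (b # w) 0<..<Yw (b # w) 1} z" for z
    proof (cases "z \<in> Ib b \<and> T_map \<gamma> z \<in> {Yw w 0<..<Yw w 1}")
      case True
      then have "br b (Yw w 0) < z" "z < br b (Yw w 1)"
        using T_map_Ib(3)[of z b] br_strict_mono[of "Yw w 0" "T_map \<gamma> z" b]
          br_strict_mono[of "T_map \<gamma> z" "Yw w 1" b] by auto
      then show ?thesis using True by simp
    next
      case False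
      then show ?thesis using nn by (auto simp: indicator_def nonneg_def)
    qed
  qed
  finally show ?case .
qed

text \<open>The slowest branch word, all of whose letters pick the branch at the neutral fixed point,
  has the longest cylinder.\<close>
definition xn :: "nat \<Rightarrow> real" where "xn n = (y0 ^^ n) 1"

lemma xn_Suc: "xn (Suc n) = y0 (xn n)" by (simp add: xn_def)

lemma xn_0 [simp]: "xn 0 = 1" by (simp add: xn_def)

lemma xn_pos: "0 < xn n"
proof (induction n)
  case (Suc n)
  then have "y0 0 < y0 (xn n)" by (simp del: y0_0)
  then show ?case by (simp add: xn_Suc)
qed simp

lemma y0_le_half: "x \<le> 1 \<Longrightarrow> y0 x \<le> 1/2"
  using y0_le[of x 1] unfolding y0_1 by blast

lemma xn_le_1: "xn n \<le> 1"
proof (induction n)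
  case (Suc n)
  then show ?case using y0_le_half[of "xn n"] by (simp add: xn_Suc)
qed simp

lemma xn_less_1: "0 < n \<Longrightarrow> xn n < 1"
proof -
  assume "0 < n"
  then obtain m where m: "n = Suc m" by (cases n) auto
  then show ?thesis using y0_le_half[OF xn_le_1[of m]] by (simp add: m xn_Suc)
qed

text \<open>Among intervals of given length, the longest inverse image is that of an interval
  starting at 0 under the left branch. For the right branch this is T0(l/2) \<le> l for l \<le> 1;
  for the left one it is superadditivity, T0(v - u) + T0 u \<le> T0 v.\<close>

lemma br_diff_le:
  assumes "0 \<le> x" "x \<le> y" "y \<le> 1"
  shows "br b y - br b x \<le> y0 (y - x)"
proof (cases b)
  case True
  have "T0 ((y - x) / 2) \<le> y - x"
  proof -
    have "2 powr \<gamma> * \<bar>(y - x) / 2\<bar> powr \<gamma> = (y - x) powr \<gamma>"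
      using assms by (simp add: powr_divide)
    moreover have "(y - x) powr \<gamma> \<le> 1" using assms gamma_pos by (intro powr_le1) auto
    moreover have "(y - x) / 2 * (1 + (y - x) powr \<gamma>) \<le> (y - x) / 2 * 2"
      using assms calculation by (intro mult_left_mono) auto
    ultimately show ?thesis by (simp add: T0_def)
  qed
  then have "(y - x) / 2 \<le> y0 (y - x)"
    using y0_less_iff(1)[of "y - x" "(y - x) / 2"] by linarith
  then show ?thesis using True by (simp add: br_def field_simps)
next
  case False
  define u v where "u = y0 x" and "v = y0 y"
  have uv: "0 \<le> u" "u \<le> v"
  proof -
    have "y0 0 \<le> y0 x" "y0 x \<le> y0 y" using assms by (simp_all del: y0_0)
    then show "0 \<le> u" "u \<le> v" by (simp_all add: u_def v_def)
  qed
  have "T0 (v - u) \<le> T0 v - T0 u"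
  proof -
    have p: "(v - u) powr \<gamma> \<le> v powr \<gamma>" "u powr \<gamma> \<le> v powr \<gamma>"
      using uv gamma_pos by (auto intro: powr_mono2)
    have "T0 v - T0 u = (v - u) + 2 powr \<gamma> * (v * v powr \<gamma> - u * u powr \<gamma>)"
      using uv by (simp add: T0_def algebra_simps)
    moreover have "(v - u) * (v - u) powr \<gamma> \<le> v * v powr \<gamma> - u * u powr \<gamma>"
    proof -
      have "(v - u) * (v - u) powr \<gamma> + u * u powr \<gamma> \<le> (v - u) * v powr \<gamma> + u * v powr \<gamma>"
        using uv p by (intro add_mono mult_left_mono) auto
      then show ?thesis by (simp add: algebra_simps)
    qed
    then have "2 powr \<gamma> * ((v - u) * (v - u) powr \<gamma>) \<le> 2 powr \<gamma> * (v * v powr \<gamma> - u * u powr \<gamma>)"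
      by (intro mult_left_mono) auto
    moreover have "T0 (v - u) = (v - u) + 2 powr \<gamma> * ((v - u) * (v - u) powr \<gamma>)"
      using uv by (simp add: T0_def algebra_simps)
    ultimately show ?thesis by linarith
  qed
  then have "v - u \<le> y0 (y - x)"
    using y0_less_iff(1)[of "y - x" "v - u"] by (simp add: u_def v_def)
  then show ?thesis using False by (simp add: br_def u_def v_def)
qed

lemma Yw_length: "Yw w 1 - Yw w 0 \<le> xn (length w)"
proof (induction w)
  case (Cons b w)
  have "Yw (b # w) 1 - Yw (b # w) 0 \<le> y0 (Yw w 1 - Yw w 0)"
    using Yw_endpoints[of w] Yw_mono[of 0 1 w] by (auto intro: br_diff_le)
  also have "\<dots> \<le> y0 (xn (length w))" using Cons by simp
  finally show ?case by (simp add: xn_Suc)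
qed simp

text \<open>Adjacent cylinders share an endpoint because \<open>br False 1\<close> and
  \<open>br True 0\<close> are both 1/2, so the increments of F over the cylinders of length n
  telescope. For monotone F the total oscillation is thus its range, however many cylinders there
  are.\<close>

lemma sum_words_telescope:
  fixes F :: "real \<Rightarrow> real"
  shows "(\<Sum>w\<in>words n. F (Yw w 0) - F (Yw w 1)) = F 0 - F 1"
proof (induction n arbitrary: F)
  case (Suc n)
  show ?case
    unfolding sum_words_Suc using Suc[of "\<lambda>x. F (br False x)"] Suc[of "\<lambda>x. F (br True x)"]
    by (simp add: br_def)
qed simp

text \<open>In the variable x^(-\<gamma>) each inverse step to the left adds at least \<gamma>/2, so
  this variable is at least \<gamma> n / 2 at \<open>xn n\<close>.\<close>

lemma xn_rate: "\<exists>c>0. \<forall>n>0. xn n \<le> c * real n powr (-1 / \<gamma>)"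
proof -
  define k where "k = \<gamma> / 2"
  have k: "0 < k" using gamma_pos by (simp add: k_def)
  have step: "xn n powr (-\<gamma>) + k \<le> xn (Suc n) powr (-\<gamma>)" for n
  proof -
    define y where "y = xn (Suc n)"
    have y: "0 < y" "y \<le> 1/2"
    proof -
      show "y \<le> 1/2" using y0_le_half[OF xn_le_1[of n]] by (simp add: y_def xn_Suc)
    qed (simp add: y_def xn_pos)
    define t where "t = (2 * y) powr \<gamma>"
    have t: "0 \<le> t" "t \<le> 1" using y gamma_pos by (auto simp: t_def intro: powr_le1)
    have x: "xn n = y * (1 + t)"
    proof -
      have "xn n = T0 y" by (simp add: y_def xn_Suc)
      then show ?thesis using y by (simp add: T0_def t_def powr_mult)
    qed
    have "xn n powr (-\<gamma>) * (1 + \<gamma> / 2 * t) \<le> xn n powr (-\<gamma>) * (1 + t) powr \<gamma>"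
      using t gamma_pos by (intro mult_left_mono one_add_powr_ge) auto
    also have "\<dots> = y powr (-\<gamma>) * ((1 + t) powr (-\<gamma>) * (1 + t) powr \<gamma>)"
      unfolding x using y t by (subst powr_mult) auto
    also have "\<dots> = y powr (-\<gamma>)" using t by (simp add: powr_add[symmetric])
    finally have 1: "xn n powr (-\<gamma>) + k * (xn n powr (-\<gamma>) * t) \<le> y powr (-\<gamma>)"
      by (simp add: algebra_simps k_def)
    have "xn n \<le> 2 * y" using t y mult_left_mono[of t 1 y] by (simp add: x algebra_simps)
    then have "1 \<le> 2 * y / xn n" using xn_pos[of n] by (simp add: field_simps)
    then have "1 \<le> (2 * y / xn n) powr \<gamma>" using gamma_pos by (intro ge_one_powr_ge_zero) auto
    also have "\<dots> = xn n powr (-\<gamma>) * t"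
      using y xn_pos[of n] by (simp add: t_def powr_divide powr_minus field_simps)
    finally have "k * 1 \<le> k * (xn n powr (-\<gamma>) * t)" using k by (intro mult_left_mono) auto
    with 1 show ?thesis by (simp add: y_def)
  qed
  have lower: "k * real n \<le> xn n powr (-\<gamma>)" for n
  proof (induction n)
    case (Suc n) then show ?case using step[of n] by (simp add: algebra_simps)
  qed simp
  have "xn n \<le> k powr (-1/\<gamma>) * real n powr (-1/\<gamma>)" if n: "0 < n" for n
  proof -
    have "xn n = (xn n powr (-\<gamma>)) powr (-1/\<gamma>)" using xn_pos[of n] gamma_pos by (simp add: powr_powr)
    also have "\<dots> \<le> (k * real n) powr (-1/\<gamma>)"
      using lower[of n] k n gamma_pos by (intro powr_mono2') auto
    also have "\<dots> = k powr (-1/\<gamma>) * real n powr (-1/\<gamma>)" using k by (simp add: powr_mult)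
    finally show ?thesis .
  qed
  then show ?thesis using k by (intro exI[of _ "k powr (-1/\<gamma>)"]) auto
qed

section \<open>Contraction\<close>

lemma pos_op_nonneg':
  assumes A: "pos_op A" and f: "supp01 f" "nonneg f" shows "nonneg (A f)"
  using pos_op_nonneg[OF A f(1)] f(2) by (simp add: nonneg_def)

text \<open>Words of length n are split by the number j of left letters before the first right one;
  the first summand belongs to the word without right letters.\<close>

lemma L_pow_first_right:
  "(L ^^ n) g x = (Lb False ^^ n) g x + (\<Sum>j<n. (L ^^ (n - 1 - j)) (Lb True ((Lb False ^^ j) g)) x)"
proof (induction n arbitrary: g)
  case (Suc n)
  have "L g = (\<lambda>x. Lb False g x + Lb True g x)" by (rule ext) (rule L_def)
  then have "(L ^^ Suc n) g x = (L ^^ n) (\<lambda>x. Lb False g x + Lb True g x) x"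
    by (simp only: funpow_Suc_right comp_apply)
  also have "\<dots> = (L ^^ n) (Lb False g) x + (L ^^ n) (Lb True g) x"
    using pos_op_add[OF pos_op_pow[OF pos_op_L], of n "Lb False g" "Lb True g"] by simp
  also have "(L ^^ n) (Lb False g) x = (Lb False ^^ Suc n) g x +
      (\<Sum>j<n. (L ^^ (n - 1 - j)) (Lb True ((Lb False ^^ Suc j) g)) x)"
    unfolding Suc by (simp only: funpow_Suc_right comp_apply)
  finally show ?case
    unfolding sum.lessThan_Suc_shift by simp
qed simp

text \<open>Transfer along the word w, then j left letters, then one right letter.\<close>

definition Vw :: "bool list \<Rightarrow> nat \<Rightarrow> (real \<Rightarrow> real) \<Rightarrow> real \<Rightarrow> real" where
  "Vw w j f = Lb True ((Lb False ^^ j) (Lw w f))"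

lemma pos_op_first_right: "pos_op (\<lambda>g. Lb True ((Lb False ^^ j) g))"
  by (rule pos_op_comp[OF pos_op_Lb pos_op_pow[OF pos_op_Lb]])

lemma pos_op_Vw: "pos_op (Vw w j)"
  using pos_op_comp[OF pos_op_first_right[of j] pos_op_Lw[of w]] unfolding Vw_def[abs_def] .

text \<open>The first N letters are free, the first right letter after them comes in step N + j + 1,
  and N - 1 - j of the 2N steps remain. The first term is the mass that stays left during the whole
  second half.\<close>

lemma L_pow_decomp:
  "(L ^^ (2 * N)) f x = (Lb False ^^ N) ((L ^^ N) f) x +
     (\<Sum>j<N. \<Sum>w\<in>words N. (L ^^ (N - 1 - j)) (Vw w j f) x)"
proof -
  have eq: "(L ^^ N) f = (\<lambda>x. \<Sum>w\<in>words N. Lw w f x)"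
    by (rule ext) (rule L_pow_words)
  have "(L ^^ (N - 1 - j)) (Lb True ((Lb False ^^ j) ((L ^^ N) f))) x =
      (\<Sum>w\<in>words N. (L ^^ (N - 1 - j)) (Vw w j f) x)" for j
    unfolding eq Vw_def
    using pos_op_sum[OF pos_op_comp[OF pos_op_pow[OF pos_op_L, of "N - 1 - j"] pos_op_first_right[of j]],
        of "\<lambda>w. Lw w f" "words N"] by simp
  then have "(\<Sum>j<N. (L ^^ (N - 1 - j)) (Lb True ((Lb False ^^ j) ((L ^^ N) f))) x) =
     (\<Sum>j<N. \<Sum>w\<in>words N. (L ^^ (N - 1 - j)) (Vw w j f) x)" by simp
  moreover have "(L ^^ (2 * N)) f x = (L ^^ N) ((L ^^ N) f) x"
    by (simp add: mult_2 funpow_add)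
  ultimately show ?thesis using L_pow_first_right[of N "(L ^^ N) f" x] by simp
qed

text \<open>Conditions that every single branch preserves. The mass bound of the cone is not among
  them; for \<open>Vw w j unif\<close> it is recovered from the ratio bound. Positivity allows
  division by the masses.\<close>

definition ndr :: "(real \<Rightarrow> real) \<Rightarrow> bool" where
  "ndr f \<longleftrightarrow> supp01 f \<and> nonneg f \<and> dec f \<and> reg f \<and> (\<forall>x. 0 < x \<and> x < 1 \<longrightarrow> 0 < f x)"

lemma ndr_unif: "ndr unif"
  using cone_unif by (auto simp: ndr_def cone_def G_def unif_def)

lemma ndr_Lb: "ndr f \<Longrightarrow> ndr (Lb b f)"
  unfolding ndr_def using br_bounds[of _ b] dbr_pos[of b]
  by (auto simp: supp01_Lb nonneg_Lb dec_Lb reg_Lb) (auto simp: Lb_def)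

lemma ndr_Lw: "ndr f \<Longrightarrow> ndr (Lw w f)"
  by (induction w arbitrary: f) (auto intro: ndr_Lb)

lemma ndr_Lb_pow: "ndr f \<Longrightarrow> ndr ((Lb b ^^ n) f)"
  by (induction n) (auto intro: ndr_Lb)

lemma ndr_Vw: "ndr (Vw w j unif)"
  unfolding Vw_def by (intro ndr_Lb ndr_Lb_pow ndr_Lw ndr_unif)

text \<open>The right branch maps the upper half interval, where the weight varies by a factor of at
  most 4, affinely onto the unit interval.\<close>
lemma Lb_True_ratio:
  assumes g: "ndr g" and x: "0 < x" "x < 1" and y: "0 < y" "y < 1"
  shows "Lb True g x \<le> 4 * Lb True g y"
proof -
  define u v where "u = (1 + x) / 2" and "v = (1 + y) / 2"
  have uv: "1/2 < u" "u < 1" "1/2 < v" "v < 1" using x y by (auto simp: u_def v_def)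
  have nn: "0 \<le> g z" for z using g by (simp add: ndr_def nonneg_def)
  have "g u \<le> 4 * g v"
  proof (cases "v \<le> u")
    case True
    then have "g u \<le> g v" using g uv by (auto simp: ndr_def dec_def)
    then show ?thesis using nn[of v] by linarith
  next
    case False
    have "(1/2) powr 2 * g u \<le> u powr (1 + \<gamma>) * g u"
    proof (rule mult_right_mono[OF _ nn])
      have "(1/2) powr 2 \<le> (1/2 :: real) powr (1 + \<gamma>)" using gamma_less_1 by (intro powr_mono') auto
      also have "\<dots> \<le> u powr (1 + \<gamma>)" using uv gamma_pos by (intro powr_mono2) auto
      finally show "(1/2) powr 2 \<le> u powr (1 + \<gamma>)" .
    qed
    also have "\<dots> \<le> v powr (1 + \<gamma>) * g v" using g False uv by (auto simp: ndr_def reg_def)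
    also have "\<dots> \<le> 1 * g v" using uv gamma_pos nn by (intro mult_right_mono powr_le1) auto
    finally show ?thesis by (simp add: power2_eq_square)
  qed
  then show ?thesis using x y by (simp add: Lb_def br_def dbr_def u_def v_def)
qed

lemma Vw_ratio:
  "0 < x \<Longrightarrow> x < 1 \<Longrightarrow> 0 < y \<Longrightarrow> y < 1 \<Longrightarrow> Vw w j unif x \<le> 4 * Vw w j unif y"
  unfolding Vw_def by (rule Lb_True_ratio) (intro ndr_Lb_pow ndr_Lw ndr_unif)

lemma cone_Vw: "cone (Vw w j unif)"
  using ndr_Vw[of w j] Vw_ratio by (intro cone_bounded_ratio) (auto simp: ndr_def)

lemma Vw_mass_pos: "0 < (\<integral>x. Vw w j unif x \<partial>lborel)"
proof -
  have "0 < Vw w j unif (1/2)" using ndr_Vw[of w j] by (auto simp: ndr_def)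
  then have "0 < (\<integral>x. Vw w j unif (1/2) / 4 * unif x \<partial>lborel)" by simp
  also have "\<dots> \<le> (\<integral>x. Vw w j unif x \<partial>lborel)"
  proof (rule integral_mono)
    show "integrable lborel (\<lambda>x. Vw w j unif (1/2) / 4 * unif x)" "integrable lborel (Vw w j unif)"
      using supp01_unif ndr_Vw[of w j] by (auto simp: supp01_def ndr_def)
    show "Vw w j unif (1/2) / 4 * unif x \<le> Vw w j unif x" for x
      using Vw_ratio[of "1/2" x w j] ndr_Vw[of w j]
      by (cases "0 < x \<and> x < 1") (auto simp: unif_def ndr_def nonneg_def)
  qed
  finally show ?thesis .
qed

text \<open>The mean of f over one cylinder of the stopping time: the numerator is the mass of f on
  it, the denominator its length.\<close>

definition cw :: "bool list \<Rightarrow> nat \<Rightarrow> (real \<Rightarrow> real) \<Rightarrow> real" where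
  "cw w j f = (\<integral>x. Vw w j f x \<partial>lborel) / (\<integral>x. Vw w j unif x \<partial>lborel)"

definition left_mass :: "nat \<Rightarrow> (real \<Rightarrow> real) \<Rightarrow> real" where
  "left_mass N f = (\<integral>x. (Lb False ^^ N) ((L ^^ N) f) x \<partial>lborel)"

text \<open>Averages over the cylinders of the stopping time "first visit to the right half after
  time N", iterated 2N times. It is a finite rank operator with values in the cone.\<close>
definition B :: "nat \<Rightarrow> (real \<Rightarrow> real) \<Rightarrow> real \<Rightarrow> real" where
  "B N f x = left_mass N f * unif x +
     (\<Sum>j<N. \<Sum>w\<in>words N. cw w j f * (L ^^ (N - 1 - j)) (Vw w j unif) x)"

lemma supp01_Vw: "supp01 f \<Longrightarrow> supp01 (Vw w j f)"
  by (rule pos_op_supp01[OF pos_op_Vw[of w j]])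

lemma cw_diff: "supp01 f \<Longrightarrow> supp01 g \<Longrightarrow> cw w j (\<lambda>x. f x - g x) = cw w j f - cw w j g"
  using supp01_Vw[of f w j] supp01_Vw[of g w j]
  by (simp add: cw_def pos_op_diff[OF pos_op_Vw[of w j], of f g] supp01_integrable diff_divide_distrib)

lemma pos_op_left: "pos_op (\<lambda>f. (Lb False ^^ N) ((L ^^ N) f))"
  by (rule pos_op_comp[OF pos_op_pow[OF pos_op_Lb] pos_op_pow[OF pos_op_L]])

lemma left_mass_diff:
  assumes "supp01 f" "supp01 g" shows "left_mass N (\<lambda>x. f x - g x) = left_mass N f - left_mass N g"
proof -
  have "supp01 ((Lb False ^^ N) ((L ^^ N) f))" "supp01 ((Lb False ^^ N) ((L ^^ N) g))"
    using pos_op_supp01[OF pos_op_left[of N] assms(1)] pos_op_supp01[OF pos_op_left[of N] assms(2)] by auto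
  then show ?thesis
    unfolding left_mass_def using pos_op_diff[OF pos_op_left[of N], of f g] by (simp add: supp01_integrable)
qed

lemma B_diff:
  assumes "supp01 f" "supp01 g" shows "B N (\<lambda>x. f x - g x) x = B N f x - B N g x"
  unfolding B_def left_mass_diff[OF assms] cw_diff[OF assms]
  by (simp add: left_diff_distrib sum_subtractf)

lemma supp01_B: "supp01 (B N f)"
proof -
  have "supp01 (Vw w j unif)" for w j by (rule supp01_Vw[OF supp01_unif])
  then show ?thesis
    unfolding B_def[abs_def]
    by (intro supp01_add supp01_sum supp01_scale supp01_unif supp01_L_pow)
qed

lemma cone_zero: "cone (\<lambda>x. 0)"
  using cone_scale[OF cone_unif, of 0] by simp

lemma cone_sum:
  "finite A \<Longrightarrow> (\<And>i. i \<in> A \<Longrightarrow> cone (h i)) \<Longrightarrow> cone (\<lambda>x. \<Sum>i\<in>A. h i x)"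
  by (induction A rule: finite_induct) (simp_all add: cone_zero cone_add)

lemma integral_nonneg_supp: "nonneg f \<Longrightarrow> 0 \<le> (\<integral>x. f x \<partial>lborel)"
  by (simp add: nonneg_def)

lemma left_mass_nonneg: "supp01 f \<Longrightarrow> nonneg f \<Longrightarrow> 0 \<le> left_mass N f"
  unfolding left_mass_def using pos_op_nonneg'[OF pos_op_left[of N], of f] by (intro integral_nonneg_supp)

text \<open>Whatever the shape of f, its image is a combination of the cone elements
  \<open>unif\<close> and the iterates of \<open>Vw w j unif\<close>, with non-negative
  coefficients.\<close>

lemma cone_B:
  assumes f: "supp01 f" "nonneg f" shows "cone (B N f)"
proof -
  have "0 \<le> cw w j f" for w j
    unfolding cw_def using pos_op_nonneg'[OF pos_op_Vw[of w j] f] Vw_mass_pos[of w j]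
    by (intro divide_nonneg_pos integral_nonneg_supp)
  then show ?thesis
    unfolding B_def[abs_def] using left_mass_nonneg[OF f]
    by (intro cone_add cone_scale cone_sum cone_unif cone_L_pow cone_Vw finite_words) auto
qed

text \<open>Each coefficient gives its term the mass of the corresponding term of
  \<open>L_pow_decomp\<close>.\<close>

lemma B_mass:
  assumes f: "supp01 f" shows "(\<integral>x. B N f x \<partial>lborel) = (\<integral>x. f x \<partial>lborel)"
proof -
  have V: "supp01 (Vw w j f)" "supp01 (Vw w j unif)" for w j
    using supp01_Vw[OF f] supp01_Vw[OF supp01_unif] by auto
  have i: "integrable lborel ((L ^^ n) (Vw w j f))" "integrable lborel ((L ^^ n) (Vw w j unif))" for n w j
    using V by (auto intro!: supp01_integrable supp01_L_pow)
  have c: "cw w j f * (\<integral>x. Vw w j unif x \<partial>lborel) = (\<integral>x. Vw w j f x \<partial>lborel)" for w j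
    using Vw_mass_pos[of w j] by (simp add: cw_def)
  have "(\<integral>x. B N f x \<partial>lborel) = left_mass N f + (\<Sum>j<N. \<Sum>w\<in>words N. \<integral>x. Vw w j f x \<partial>lborel)"
    unfolding B_def using i supp01_unif
    by (simp add: supp01_integrable L_pow_mass V c)
  also have "\<dots> = (\<integral>x. (L ^^ (2 * N)) f x \<partial>lborel)"
    unfolding L_pow_decomp left_mass_def using i pos_op_supp01[OF pos_op_left[of N] f]
    by (simp add: supp01_integrable L_pow_mass V)
  finally show ?thesis by (simp add: L_pow_mass f)
qed

text \<open>The positive and the negative part of h have equal mass m. Both images lie in the cone
  and are at least \<sigma> m \<open>unif\<close>, and this common part cancels in the
  difference.\<close>

lemma B_contraction:
  assumes \<sigma>: "\<And>f x. cone f \<Longrightarrow> 0 < x \<Longrightarrow> x < 1 \<Longrightarrow> \<sigma> * (\<integral>x. f x \<partial>lborel) \<le> f x"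
    and h: "supp01 h" and h0: "(\<integral>x. h x \<partial>lborel) = 0"
  shows "(\<integral>x. \<bar>B N h x\<bar> \<partial>lborel) \<le> (1 - \<sigma>) * (\<integral>x. \<bar>h x\<bar> \<partial>lborel)"
proof -
  define p where "p = (\<lambda>x. (\<bar>h x\<bar> + h x) / 2)"
  define n where "n = (\<lambda>x. (\<bar>h x\<bar> - h x) / 2)"
  have hp: "supp01 p" "supp01 n" unfolding p_def n_def
    using supp01_scale[OF supp01_add[OF supp01_abs[OF h] h], of "1/2"]
      supp01_scale[OF supp01_diff[OF supp01_abs[OF h] h], of "1/2"] by simp_all
  have nn: "nonneg p" "nonneg n" by (auto simp: nonneg_def p_def n_def)
  define m where "m = (\<integral>x. \<bar>h x\<bar> \<partial>lborel) / 2"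
  have im: "(\<integral>x. p x \<partial>lborel) = m" "(\<integral>x. n x \<partial>lborel) = m"
    using h supp01_abs[OF h] h0 by (auto simp: p_def n_def m_def supp01_integrable)
  have lb: "\<sigma> * m \<le> B N p x" "\<sigma> * m \<le> B N n x" if "0 < x" "x < 1" for x
    using \<sigma>[OF cone_B[OF hp(1) nn(1), of N] that] \<sigma>[OF cone_B[OF hp(2) nn(2), of N] that] B_mass[OF hp(1), of N] B_mass[OF hp(2), of N] im
    by simp_all
  have heq: "h = (\<lambda>x. p x - n x)" by (auto simp: p_def n_def field_simps)
  have "\<bar>B N h x\<bar> \<le> (B N p x - \<sigma> * m * unif x) + (B N n x - \<sigma> * m * unif x)" for x
  proof -
    have "B N h x = B N p x - B N n x" unfolding heq by (rule B_diff[OF hp])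
    then show ?thesis
      using lb[of x] supp01_outside[OF supp01_B[of N p], of x] supp01_outside[OF supp01_B[of N n], of x]
      by (cases "0 < x \<and> x < 1") (auto simp: unif_def)
  qed
  then have "(\<integral>x. \<bar>B N h x\<bar> \<partial>lborel) \<le> (\<integral>x. (B N p x - \<sigma> * m * unif x) + (B N n x - \<sigma> * m * unif x) \<partial>lborel)"
    by (intro integral_mono supp01_integrable supp01_abs supp01_B supp01_add supp01_diff supp01_scale supp01_unif)
  also have "\<dots> = (1 - \<sigma>) * (2 * m)"
    using supp01_B supp01_unif B_mass[OF hp(1), of N] B_mass[OF hp(2), of N] im
    by (simp add: supp01_integrable algebra_simps)
  finally show ?thesis by (simp add: m_def)
qed

lemma Lw_replicate: "Lw (replicate n False) f = (Lb False ^^ n) f"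
  by (induction n arbitrary: f) (simp_all add: funpow_swap1)

lemma Yw_replicate: "Yw (replicate n False) x = (y0 ^^ n) x"
  by (induction n) (auto simp: br_def)

lemma left_pow_mass_le:
  assumes "supp01 f" "nonneg f"
  shows "(\<integral>x. (Lb False ^^ n) f x \<partial>lborel) \<le> (\<integral>x. f x * indicator {0<..<xn n} x \<partial>lborel)"
proof -
  have "(y0 ^^ n) 0 = 0" by (induction n) auto
  then show ?thesis
    using Lw_mass_le[OF assms, of "replicate n False"] by (simp add: Lw_replicate Yw_replicate xn_def)
qed

text \<open>By \<open>L_pow_first_right\<close> the terms are separate portions of the mass of
  \<open>Lw w unif\<close>, which is at most the length of the cylinder of w.\<close>

lemma sum_Vw_mass_le:
  assumes w: "w \<in> words N"
  shows "(\<Sum>j<N. \<integral>x. Vw w j unif x \<partial>lborel) \<le> xn N"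
proof -
  define g where "g = Lw w unif"
  have g: "ndr g" unfolding g_def by (rule ndr_Lw[OF ndr_unif])
  then have ok: "supp01 g" and nn: "nonneg g" by (auto simp: ndr_def)
  have V: "supp01 (Lb True ((Lb False ^^ j) g))" for j
    by (rule pos_op_supp01[OF pos_op_first_right[of j] ok])
  have V0: "supp01 ((Lb False ^^ n) g)" for n
    by (rule pos_op_supp01[OF pos_op_pow[OF pos_op_Lb[of False], of n] ok])
  have "(\<integral>x. g x \<partial>lborel) = (\<integral>x. (L ^^ N) g x \<partial>lborel)" by (simp add: L_pow_mass ok)
  also have "\<dots> = (\<integral>x. (Lb False ^^ N) g x \<partial>lborel) + (\<Sum>j<N. \<integral>x. Vw w j unif x \<partial>lborel)"
    unfolding L_pow_first_right[of N] Vw_def g_def[symmetric]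
    using V V0 by (simp add: supp01_integrable supp01_L_pow L_pow_mass)
  finally have "(\<Sum>j<N. \<integral>x. Vw w j unif x \<partial>lborel) \<le> (\<integral>x. g x \<partial>lborel)"
    using integral_nonneg_supp[OF pos_op_nonneg'[OF pos_op_pow[OF pos_op_Lb[of False], of N] ok nn]] by linarith
  also have "\<dots> \<le> (\<integral>x. unif x * indicator {Yw w 0<..<Yw w 1} x \<partial>lborel)"
    unfolding g_def using ndr_unif by (intro Lw_mass_le) (auto simp: ndr_def)
  also have "\<dots> \<le> (\<integral>x. 1 * indicator {Yw w 0<..<Yw w 1} x \<partial>lborel)"
    by (intro integral_mono integrable_indicator_Ioo supp01_integrable supp01_mult[OF supp01_unif, of _ 1])
      (auto simp: indicator_def unif_def)
  also have "\<dots> = Yw w 1 - Yw w 0" using Yw_mono[of 0 1 w] by simp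
  also have "\<dots> \<le> xn N" using Yw_length[of w] length_words[OF w] by simp
  finally show ?thesis .
qed

section \<open>The L1 distance between L^(2N) and the averaging operator\<close>

lemma G_mono:
  assumes "G s f" "s \<le> t" shows "G t f"
proof -
  have "cone_const * x powr (1 - \<gamma>) * s \<le> cone_const * x powr (1 - \<gamma>) * t" for x
    using assms cone_const_ge_4 by (intro mult_left_mono) auto
  then show ?thesis using assms unfolding G_def by (meson order_trans)
qed

lemma L_pow_B_error_split:
  assumes f: "supp01 f" "supp01 g"
  shows "(\<integral>x. \<bar>(L ^^ n) (\<lambda>x. f x + g x) x - B N (\<lambda>x. f x + g x) x\<bar> \<partial>lborel) \<le>
    (\<integral>x. \<bar>(L ^^ n) f x - B N f x\<bar> \<partial>lborel) + (\<integral>x. \<bar>(L ^^ n) g x - B N g x\<bar> \<partial>lborel)"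
proof -
  have 1: "(L ^^ n) (\<lambda>x. f x + g x) x = (L ^^ n) f x + (L ^^ n) g x" for x
    using pos_op_add[OF pos_op_pow[OF pos_op_L, of n], of f g] by simp
  have fe: "f = (\<lambda>x. (f x + g x) - g x)" by auto
  have "B N f x = B N (\<lambda>x. f x + g x) x - B N g x" for x
    by (subst fe, rule B_diff[OF supp01_add[OF f] f(2)])
  then have 2: "B N (\<lambda>x. f x + g x) x = B N f x + B N g x" for x by simp
  have s: "supp01 (\<lambda>x. (L ^^ n) h x - B N h x)" if "supp01 h" for h
    using that by (intro supp01_diff supp01_L_pow supp01_B)
  have "(\<integral>x. \<bar>(L ^^ n) (\<lambda>x. f x + g x) x - B N (\<lambda>x. f x + g x) x\<bar> \<partial>lborel) \<le>
     (\<integral>x. \<bar>(L ^^ n) f x - B N f x\<bar> + \<bar>(L ^^ n) g x - B N g x\<bar> \<partial>lborel)"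
    unfolding 1 2
  proof (rule integral_mono)
    show "integrable lborel (\<lambda>x. \<bar>(L ^^ n) f x + (L ^^ n) g x - (B N f x + B N g x)\<bar>)"
      using f by (intro supp01_integrable supp01_abs supp01_diff supp01_add supp01_L_pow supp01_B)
    show "integrable lborel (\<lambda>x. \<bar>(L ^^ n) f x - B N f x\<bar> + \<bar>(L ^^ n) g x - B N g x\<bar>)"
      using f by (intro supp01_integrable supp01_abs supp01_add s)
  qed linarith
  also have "\<dots> = (\<integral>x. \<bar>(L ^^ n) f x - B N f x\<bar> \<partial>lborel) + (\<integral>x. \<bar>(L ^^ n) g x - B N g x\<bar> \<partial>lborel)"
    using f by (intro Bochner_Integration.integral_add supp01_integrable supp01_abs s)
  finally show ?thesis .
qed

lemma L_pow_B_error_trivial: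
  assumes f: "supp01 f" "nonneg f"
  shows "(\<integral>x. \<bar>(L ^^ n) f x - B N f x\<bar> \<partial>lborel) \<le> 2 * (\<integral>x. f x \<partial>lborel)"
proof -
  have nn: "nonneg ((L ^^ n) f)" "nonneg (B N f)"
    using pos_op_nonneg'[OF pos_op_pow[OF pos_op_L, of n] f] cone_B[OF f] by (auto simp: cone_def G_def)
  have "(\<integral>x. \<bar>(L ^^ n) f x - B N f x\<bar> \<partial>lborel) \<le> (\<integral>x. (L ^^ n) f x + B N f x \<partial>lborel)"
  proof (rule integral_mono)
    show "\<bar>(L ^^ n) f x - B N f x\<bar> \<le> (L ^^ n) f x + B N f x" for x
      using nn by (auto simp: nonneg_def abs_le_iff)
  qed (intro supp01_integrable supp01_abs supp01_diff supp01_add supp01_L_pow supp01_B f)+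
  also have "\<dots> = 2 * (\<integral>x. f x \<partial>lborel)"
    using f by (simp add: supp01_integrable supp01_L_pow supp01_B L_pow_mass B_mass)
  finally show ?thesis .
qed

text \<open>On each cylinder f differs from its mean by at most its oscillation over the cylinder of
  w. For fixed w the masses sum to at most \<open>xn N\<close>, and over w the oscillations
  telescope to K. The mass that stays left is compared trivially, which costs twice
  \<open>left_mass N f\<close>.\<close>

lemma L_pow_B_error_bounded:
  assumes f: "supp01 f" and nn: "nonneg f" and d: "dec f" and K: "\<And>x. f x \<le> K"
  shows "(\<integral>x. \<bar>(L ^^ (2 * N)) f x - B N f x\<bar> \<partial>lborel) \<le> K * xn N + 2 * left_mass N f"
proof -
  \<comment> \<open>Continuing f by its upper bound to the left and by 0 to the right makes F
    decreasing on the whole line, so cylinders ending at 0 or 1 are no exception.\<close>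
  define F where "F x = (if x \<le> 0 then K else if 1 \<le> x then 0 else f x)" for x
  have Fmono: "F y \<le> F x" if "x \<le> y" for x y
    using that K[of x] K[of y] nn d by (auto simp: F_def nonneg_def dec_def intro: order_trans[of 0 "f x" K])
  define D where "D w j x = Vw w j f x - cw w j f * Vw w j unif x" for w j x
  have V: "supp01 (Vw w j f)" "supp01 (Vw w j unif)" for w j
    using supp01_Vw[OF f] supp01_Vw[OF supp01_unif] by auto
  have sD: "supp01 (D w j)" for w j unfolding D_def using V by (intro supp01_diff supp01_scale)
  have lo: "F (Yw w 1) * Vw w j unif x \<le> Vw w j f x" and hi: "Vw w j f x \<le> F (Yw w 0) * Vw w j unif x" for w j x
  proof -
    have pw: "F (Yw w 1) * Lw w unif x \<le> Lw w f x" "Lw w f x \<le> F (Yw w 0) * Lw w unif x" if x: "0 < x" "x < 1" for x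
    proof -
      have "f (Yw w x) = F (Yw w x)" using Yw_bounds[of x w] x by (simp add: F_def)
      moreover have "F (Yw w 1) \<le> F (Yw w x)" "F (Yw w x) \<le> F (Yw w 0)"
        using x by (auto intro!: Fmono Yw_mono)
      moreover have "0 \<le> Lw w unif x" using ndr_Lw[OF ndr_unif, of w] by (simp add: ndr_def nonneg_def)
      ultimately show "F (Yw w 1) * Lw w unif x \<le> Lw w f x" "Lw w f x \<le> F (Yw w 0) * Lw w unif x"
        using Lw_factor[OF x, of w f] by (auto intro: mult_right_mono)
    qed
    have sc: "Lb True ((Lb False ^^ j) (\<lambda>x. c * Lw w unif x)) = (\<lambda>x. c * Vw w j unif x)" for c
      unfolding Vw_def using pos_op_scale[OF pos_op_first_right[of j], of c "Lw w unif"] .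
    show "F (Yw w 1) * Vw w j unif x \<le> Vw w j f x" "Vw w j f x \<le> F (Yw w 0) * Vw w j unif x"
      using pos_op_mono[OF pos_op_first_right[of j], of "\<lambda>x. F (Yw w 1) * Lw w unif x" "Lw w f" x]
        pos_op_mono[OF pos_op_first_right[of j], of "Lw w f" "\<lambda>x. F (Yw w 0) * Lw w unif x" x]
        pw supp01_outside[OF V(1)[of w j], of x] supp01_outside[OF V(2)[of w j], of x]
      unfolding sc Vw_def[of w j f] by (cases "0 < x \<and> x < 1"; auto)+
  qed
  have Dle: "(\<integral>x. \<bar>D w j x\<bar> \<partial>lborel) \<le> (F (Yw w 0) - F (Yw w 1)) * (\<integral>x. Vw w j unif x \<partial>lborel)" for w j
  proof -
    have "F (Yw w 1) * (\<integral>x. Vw w j unif x \<partial>lborel) = (\<integral>x. F (Yw w 1) * Vw w j unif x \<partial>lborel)" by simp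
    also have "\<dots> \<le> (\<integral>x. Vw w j f x \<partial>lborel)"
      using V by (intro integral_mono lo supp01_integrable supp01_scale)
    finally have c1: "F (Yw w 1) \<le> cw w j f"
      unfolding cw_def using Vw_mass_pos[of w j] by (simp add: pos_le_divide_eq)
    have "(\<integral>x. Vw w j f x \<partial>lborel) \<le> (\<integral>x. F (Yw w 0) * Vw w j unif x \<partial>lborel)"
      using V by (intro integral_mono hi supp01_integrable supp01_scale)
    then have c2: "cw w j f \<le> F (Yw w 0)"
      unfolding cw_def using Vw_mass_pos[of w j] by (simp add: pos_divide_le_eq)
    have "\<bar>D w j x\<bar> \<le> (F (Yw w 0) - F (Yw w 1)) * Vw w j unif x" for x
    proof -
      have "0 \<le> Vw w j unif x" using ndr_Vw[of w j] by (simp add: ndr_def nonneg_def)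
      then have "F (Yw w 1) * Vw w j unif x \<le> cw w j f * Vw w j unif x" "cw w j f * Vw w j unif x \<le> F (Yw w 0) * Vw w j unif x"
        using c1 c2 by (auto intro: mult_right_mono)
      then show ?thesis using lo[of w j x] hi[of w j x] by (auto simp: D_def abs_le_iff left_diff_distrib)
    qed
    then have "(\<integral>x. \<bar>D w j x\<bar> \<partial>lborel) \<le> (\<integral>x. (F (Yw w 0) - F (Yw w 1)) * Vw w j unif x \<partial>lborel)"
      using V sD by (intro integral_mono supp01_integrable supp01_scale supp01_abs)
    then show ?thesis by simp
  qed
  define R where "R x = (Lb False ^^ N) ((L ^^ N) f) x - left_mass N f * unif x" for x
  define Z where "Z = (Lb False ^^ N) ((L ^^ N) f)"
  have Z: "supp01 Z" "nonneg Z"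
    unfolding Z_def using pos_op_supp01[OF pos_op_left[of N] f] pos_op_nonneg'[OF pos_op_left[of N] f nn] by auto
  have sR: "supp01 R" unfolding R_def Z_def[symmetric] by (intro supp01_diff supp01_scale Z supp01_unif)
  have RL: "(\<integral>x. \<bar>R x\<bar> \<partial>lborel) \<le> 2 * left_mass N f"
  proof -
    have "(\<integral>x. \<bar>R x\<bar> \<partial>lborel) \<le> (\<integral>x. Z x + left_mass N f * unif x \<partial>lborel)"
    proof (rule integral_mono)
      have "0 \<le> left_mass N f * unif x" for x using left_mass_nonneg[OF f nn, of N] by (simp add: unif_def)
      then show "\<bar>R x\<bar> \<le> Z x + left_mass N f * unif x" for x
        using Z(2) unfolding R_def Z_def[symmetric] by (auto simp: nonneg_def abs_le_iff)
    qed (intro supp01_integrable supp01_abs supp01_add supp01_scale sR Z supp01_unif)+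
    also have "\<dots> = 2 * left_mass N f"
      using Z supp01_unif by (simp add: supp01_integrable left_mass_def Z_def[symmetric])
    finally show ?thesis .
  qed
  have LD: "(L ^^ n) (D w j) x = (L ^^ n) (Vw w j f) x - cw w j f * (L ^^ n) (Vw w j unif) x" for n w j x
    unfolding D_def
    using pos_op_diff[OF pos_op_pow[OF pos_op_L, of n], of "Vw w j f" "\<lambda>x. cw w j f * Vw w j unif x"]
      pos_op_scale[OF pos_op_pow[OF pos_op_L, of n], of "cw w j f" "Vw w j unif"] by simp
  have eq: "(L ^^ (2 * N)) f x - B N f x = R x + (\<Sum>j<N. \<Sum>w\<in>words N. (L ^^ (N - 1 - j)) (D w j) x)" for x
    unfolding L_pow_decomp B_def R_def LD by (simp add: sum_subtractf)
  have sL: "supp01 ((L ^^ n) (D w j))" for n w j by (rule supp01_L_pow[OF sD])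
  have "(\<integral>x. \<bar>(L ^^ (2 * N)) f x - B N f x\<bar> \<partial>lborel) \<le>
      (\<integral>x. \<bar>R x\<bar> + (\<Sum>j<N. \<Sum>w\<in>words N. \<bar>(L ^^ (N - 1 - j)) (D w j) x\<bar>) \<partial>lborel)"
    unfolding eq
  proof (rule integral_mono)
    show "\<bar>R x + (\<Sum>j<N. \<Sum>w\<in>words N. (L ^^ (N - 1 - j)) (D w j) x)\<bar> \<le>
       \<bar>R x\<bar> + (\<Sum>j<N. \<Sum>w\<in>words N. \<bar>(L ^^ (N - 1 - j)) (D w j) x\<bar>)" for x
      by (rule order_trans[OF abs_triangle_ineq add_left_mono[OF order_trans[OF sum_abs sum_mono[OF sum_abs]]]])
  qed (intro supp01_integrable supp01_abs supp01_add supp01_sum sR sL)+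
  also have "\<dots> = (\<integral>x. \<bar>R x\<bar> \<partial>lborel) + (\<Sum>j<N. \<Sum>w\<in>words N. \<integral>x. \<bar>(L ^^ (N - 1 - j)) (D w j) x\<bar> \<partial>lborel)"
    using sR sL by (simp add: supp01_integrable)
  also have "\<dots> \<le> 2 * left_mass N f + (\<Sum>j<N. \<Sum>w\<in>words N. (F (Yw w 0) - F (Yw w 1)) * (\<integral>x. Vw w j unif x \<partial>lborel))"
    by (intro add_mono RL sum_mono order_trans[OF pos_op_L1[OF pos_op_pow[OF pos_op_L] sD] Dle])
  \<comment> \<open>The sum over j must come inside, since only the total mass over j is small for a
    given w.\<close>
  also have "(\<Sum>j<N. \<Sum>w\<in>words N. (F (Yw w 0) - F (Yw w 1)) * (\<integral>x. Vw w j unif x \<partial>lborel)) =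
     (\<Sum>w\<in>words N. (F (Yw w 0) - F (Yw w 1)) * (\<Sum>j<N. \<integral>x. Vw w j unif x \<partial>lborel))"
    by (subst sum.swap) (simp add: sum_distrib_left)
  also have "\<dots> \<le> (\<Sum>w\<in>words N. (F (Yw w 0) - F (Yw w 1)) * xn N)"
    by (intro sum_mono mult_left_mono sum_Vw_mass_le) (auto intro!: Fmono Yw_mono)
  also have "\<dots> = (F 0 - F 1) * xn N"
    by (simp add: sum_words_telescope sum_distrib_right[symmetric])
  also have "\<dots> = K * xn N" by (simp add: F_def)
  finally show ?thesis by simp
qed

text \<open>f may be unbounded near 0 and is cut at K = f e with e = \<open>xn N\<close>. The mass
  of the excess and K e are both at most the mass of f on (0,e), hence at most E; so is
  \<open>left_mass N f1\<close>, because \<open>G\<close> is invariant under L. The factor 5 is 1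
  for K e and 2 for each of the other two.\<close>

lemma L_pow_B_error:
  assumes G: "G 1 f" and N: "0 < N"
  shows "(\<integral>x. \<bar>(L ^^ (2 * N)) f x - B N f x\<bar> \<partial>lborel) \<le> 5 * cone_const * xn N powr (1 - \<gamma>)"
proof -
  define e where "e = xn N"
  have e: "0 < e" "e < 1" using xn_pos xn_less_1[OF N] by (auto simp: e_def)
  define E where "E = cone_const * e powr (1 - \<gamma>)"
  have ok: "supp01 f" and nn: "nonneg f" and d: "dec f" 
    and bd: "(\<integral>z. f z * indicator {0<..<e} z \<partial>lborel) \<le> E"
    using G e by (auto simp: G_def E_def)
  note [measurable] = supp01_measurable[OF ok]
  define K where "K = f e"
  have K: "0 \<le> K" using nn by (simp add: K_def nonneg_def)
  define f1 where "f1 x = min (f x) K" for x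
  define f2 where "f2 x = f x - f1 x" for x
  have f1: "supp01 f1"
  proof (rule supp01_bounded[of _ K])
    show "\<bar>f1 x\<bar> \<le> K" for x using nn K by (auto simp: f1_def nonneg_def)
    show "f1 x = 0" if "x \<notin> {0<..<1}" for x
      using supp01_outside[OF ok, of x] that K by (auto simp: f1_def)
  qed (simp add: f1_def[abs_def])
  have f2: "supp01 f2" unfolding f2_def[abs_def] by (rule supp01_diff[OF ok f1])
  have nn12: "nonneg f1" "nonneg f2" using nn K by (auto simp: nonneg_def f1_def f2_def)
  have d1: "dec f1" using d by (auto simp: dec_def f1_def min_le_iff_disj)
  have sm: "supp01 (\<lambda>z. f z * indicator {0<..<e} z)"
    by (rule supp01_mult[OF ok, of _ 1]) (auto simp: indicator_def)
  have m2: "(\<integral>x. f2 x \<partial>lborel) \<le> E"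
  proof (rule order_trans[OF _ bd], rule integral_mono)
    show "f2 x \<le> f x * indicator {0<..<e} x" for x
      using d e nn K supp01_outside[OF ok, of x]
      by (cases "0 < x \<and> x < 1") (auto simp: f2_def f1_def indicator_def dec_def K_def nonneg_def)
  qed (intro supp01_integrable f2 sm)+
  have Ke: "K * e \<le> E"
  proof -
    have "K * e = (\<integral>x. K * indicator {0<..<e} x \<partial>lborel)" using e by simp
    also have "\<dots> \<le> (\<integral>z. f z * indicator {0<..<e} z \<partial>lborel)"
    proof (rule integral_mono)
      show "K * indicator {0<..<e} x \<le> f x * indicator {0<..<e} x" for x
        using d e by (auto simp: indicator_def dec_def K_def)
    qed (intro supp01_integrable sm integrable_indicator_Ioo)+
    finally show ?thesis using bd by simp
  qed
  have lm: "left_mass N f1 \<le> E"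
  proof -
    have "left_mass N f1 \<le> left_mass N f"
      unfolding left_mass_def
    proof (rule integral_mono)
      show "(Lb False ^^ N) ((L ^^ N) f1) x \<le> (Lb False ^^ N) ((L ^^ N) f) x" for x
        using pos_op_mono[OF pos_op_left[of N], of f1 f x]
          supp01_outside[OF pos_op_supp01[OF pos_op_left[of N] ok], of x]
          supp01_outside[OF pos_op_supp01[OF pos_op_left[of N] f1], of x]
        by (cases "0 < x \<and> x < 1") (auto simp: f1_def)
    qed (use ok f1 pos_op_supp01[OF pos_op_left[of N]] in \<open>auto intro: supp01_integrable\<close>)
    also have "\<dots> \<le> (\<integral>x. (L ^^ N) f x * indicator {0<..<xn N} x \<partial>lborel)"
      unfolding left_mass_def
      using supp01_L_pow[OF ok] pos_op_nonneg'[OF pos_op_pow[OF pos_op_L, of N] ok nn]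
      by (intro left_pow_mass_le)
    also have "\<dots> \<le> E" using G_L_pow[OF G, of N] e by (simp add: G_def E_def e_def)
    finally show ?thesis .
  qed
  have "f = (\<lambda>x. f1 x + f2 x)" by (auto simp: f2_def)
  then have "(\<integral>x. \<bar>(L ^^ (2 * N)) f x - B N f x\<bar> \<partial>lborel) \<le>
     (\<integral>x. \<bar>(L ^^ (2 * N)) f1 x - B N f1 x\<bar> \<partial>lborel) + (\<integral>x. \<bar>(L ^^ (2 * N)) f2 x - B N f2 x\<bar> \<partial>lborel)"
    using L_pow_B_error_split[OF f1 f2, of "2 * N" N] by simp
  also have "\<dots> \<le> (K * xn N + 2 * left_mass N f1) + 2 * (\<integral>x. f2 x \<partial>lborel)"
    by (intro add_mono L_pow_B_error_bounded L_pow_B_error_trivial f1 f2 nn12 d1) (simp add: f1_def)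
  also have "\<dots> \<le> 5 * E" using lm m2 Ke by (simp add: e_def)
  finally show ?thesis by (simp add: E_def e_def)
qed

text \<open>The distance after k blocks satisfies a(k+1) \<le> (1 - \<sigma>) a(k) + 2e, a recursion
  with fixed point 2e/\<sigma>.\<close>

lemma cone_pair_decay:
  assumes \<sigma>: "0 < \<sigma>" "\<sigma> < 1" "\<And>f x. cone f \<Longrightarrow> 0 < x \<Longrightarrow> x < 1 \<Longrightarrow> \<sigma> * (\<integral>x. f x \<partial>lborel) \<le> f x"
    and u: "cone u" "cone v" "(\<integral>x. u x \<partial>lborel) = m" "(\<integral>x. v x \<partial>lborel) = m" "m \<le> 1" and N: "0 < N"
    and e: "5 * cone_const * xn N powr (1 - \<gamma>) = e"
  shows "(\<integral>x. \<bar>(L ^^ (2 * N * k)) (\<lambda>x. u x - v x) x\<bar> \<partial>lborel) \<le> 2 * (1 - \<sigma>) ^ k + 2 * e / \<sigma>"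
proof -
  have e0: "0 \<le> e" using cone_const_ge_4 by (simp flip: e)
  have uv: "supp01 u" "supp01 v" "nonneg u" "nonneg v" using u by (auto simp: cone_def G_def)
  show ?thesis
  proof (induction k)
    case 0
    have "(\<integral>x. \<bar>u x - v x\<bar> \<partial>lborel) \<le> (\<integral>x. u x + v x \<partial>lborel)"
    proof (rule integral_mono)
      show "\<bar>u x - v x\<bar> \<le> u x + v x" for x using uv by (auto simp: nonneg_def abs_le_iff)
    qed (intro supp01_integrable supp01_abs supp01_diff supp01_add uv)+
    also have "\<dots> = 2 * m" using uv u by (simp add: supp01_integrable)
    also have "\<dots> \<le> 2 * 1 + 2 * e / \<sigma>" using u \<sigma> e0 by (intro add_increasing2) auto
    finally show ?case by simp
  next
    case (Suc k)
    define a where "a = (L ^^ (2 * N * k)) u"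
    define b where "b = (L ^^ (2 * N * k)) v"
    have ab: "cone a" "cone b" "supp01 a" "supp01 b" "(\<integral>x. a x \<partial>lborel) = m" "(\<integral>x. b x \<partial>lborel) = m"
      unfolding a_def b_def using u uv by (auto intro: cone_L_pow supp01_L_pow simp: L_pow_mass)
    have Gab: "G 1 a" "G 1 b" using ab u by (auto simp: cone_def intro: G_mono)
    have k: "(L ^^ (2 * N * k)) (\<lambda>x. u x - v x) = (\<lambda>x. a x - b x)"
      unfolding a_def b_def by (rule pos_op_diff[OF pos_op_pow[OF pos_op_L]])
    have "2 * N * Suc k = 2 * N + 2 * N * k" by simp
    then have "(L ^^ (2 * N * Suc k)) (\<lambda>x. u x - v x) = (L ^^ (2 * N)) ((L ^^ (2 * N * k)) (\<lambda>x. u x - v x))"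
      by (simp only: funpow_add comp_apply)
    also have "\<dots> = (\<lambda>x. (L ^^ (2 * N)) a x - (L ^^ (2 * N)) b x)"
      unfolding k by (rule pos_op_diff[OF pos_op_pow[OF pos_op_L]])
    finally have k1: "(L ^^ (2 * N * Suc k)) (\<lambda>x. u x - v x) x =
        B N (\<lambda>x. a x - b x) x + ((L ^^ (2 * N)) a x - B N a x) - ((L ^^ (2 * N)) b x - B N b x)" for x
      using B_diff[OF ab(3,4), of N x] by simp
    have s: "supp01 (\<lambda>x. (L ^^ (2 * N)) a x - B N a x)" "supp01 (\<lambda>x. (L ^^ (2 * N)) b x - B N b x)"
      using ab by (auto intro!: supp01_diff supp01_L_pow supp01_B)
    have "(\<integral>x. \<bar>(L ^^ (2 * N * Suc k)) (\<lambda>x. u x - v x) x\<bar> \<partial>lborel) \<le>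
      (\<integral>x. \<bar>B N (\<lambda>x. a x - b x) x\<bar> + \<bar>(L ^^ (2 * N)) a x - B N a x\<bar> + \<bar>(L ^^ (2 * N)) b x - B N b x\<bar> \<partial>lborel)"
      unfolding k1
    proof (rule integral_mono)
      fix x
      show "\<bar>B N (\<lambda>x. a x - b x) x + ((L ^^ (2 * N)) a x - B N a x) - ((L ^^ (2 * N)) b x - B N b x)\<bar> \<le>
        \<bar>B N (\<lambda>x. a x - b x) x\<bar> + \<bar>(L ^^ (2 * N)) a x - B N a x\<bar> + \<bar>(L ^^ (2 * N)) b x - B N b x\<bar>"
        by linarith
    qed (intro supp01_integrable supp01_abs supp01_diff[OF supp01_add] supp01_add supp01_B s)+
    also have "\<dots> = (\<integral>x. \<bar>B N (\<lambda>x. a x - b x) x\<bar> \<partial>lborel) +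
      (\<integral>x. \<bar>(L ^^ (2 * N)) a x - B N a x\<bar> \<partial>lborel) + (\<integral>x. \<bar>(L ^^ (2 * N)) b x - B N b x\<bar> \<partial>lborel)"
      using s by (simp add: supp01_integrable[OF supp01_abs] supp01_B)
    also have "\<dots> \<le> (1 - \<sigma>) * (\<integral>x. \<bar>a x - b x\<bar> \<partial>lborel) + e + e"
      unfolding e[symmetric] using ab
      by (intro add_mono B_contraction[OF \<sigma>(3)] L_pow_B_error Gab N supp01_diff)
        (auto simp: supp01_integrable)
    also have "\<dots> \<le> (1 - \<sigma>) * (2 * (1 - \<sigma>) ^ k + 2 * e / \<sigma>) + e + e"
      using Suc.IH \<sigma> unfolding k by (intro add_right_mono mult_left_mono) auto
    also have "\<dots> = 2 * (1 - \<sigma>) ^ Suc k + 2 * e / \<sigma>" using \<sigma> by (simp add: field_simps)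
    finally show ?case .
  qed
qed

text \<open>For f of mass 1, integrating this against a function gives the covariance, with respect
  to the density f, of that function and the indicator of (0,t).\<close>

definition corr :: "(real \<Rightarrow> real) \<Rightarrow> real \<Rightarrow> real \<Rightarrow> real" where
  "corr f t x = f x * indicator {0<..<t} x - (\<integral>z. f z * indicator {0<..<t} z \<partial>lborel) * f x"

lemma supp01_trunc: "supp01 f \<Longrightarrow> supp01 (\<lambda>x. f x * indicator {0<..<t} x)"
  by (rule supp01_mult[of _ _ 1]) (auto simp: indicator_def)

lemma supp01_corr: "supp01 f \<Longrightarrow> supp01 (corr f t)"
  unfolding corr_def[abs_def] by (intro supp01_diff supp01_scale supp01_trunc)

lemma G_trunc:
  assumes G: "G 1 f" shows "G 1 (\<lambda>x. f x * indicator {0<..<t} x)"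
proof -
  have ok: "supp01 f" and nn: "nonneg f" using G by (auto simp: G_def)
  have "(\<integral>z. f z * indicator {0<..<t} z * indicator {0<..<x} z \<partial>lborel) \<le> cone_const * x powr (1 - \<gamma>)"
    if x: "0 < x \<and> x < 1" for x
  proof (rule order_trans)
    show "(\<integral>z. f z * indicator {0<..<x} z \<partial>lborel) \<le> cone_const * x powr (1 - \<gamma>)"
      using G x by (simp add: G_def)
    show "(\<integral>z. f z * indicator {0<..<t} z * indicator {0<..<x} z \<partial>lborel) \<le> (\<integral>z. f z * indicator {0<..<x} z \<partial>lborel)"
    using nn by (intro integral_mono supp01_integrable supp01_trunc ok) (auto simp: indicator_def nonneg_def)
  qed
  moreover have "(\<integral>z. f z * indicator {0<..<t} z \<partial>lborel) \<le> (\<integral>z. f z \<partial>lborel)"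
    using nn by (intro integral_mono supp01_integrable supp01_trunc ok) (auto simp: indicator_def nonneg_def)
  moreover have "dec (\<lambda>x. f x * indicator {0<..<t} x)"
    using G by (auto simp: G_def dec_def nonneg_def indicator_def)
  ultimately show ?thesis
    using G supp01_trunc[OF ok] unfolding G_def
    by (auto simp: nonneg_def intro: order_trans)
qed

lemma corr_L1:
  assumes f: "cone f" "(\<integral>x. f x \<partial>lborel) = 1"
  shows "(\<integral>x. \<bar>corr f t x\<bar> \<partial>lborel) \<le> 2"
proof -
  have G1: "G 1 f" and ok: "supp01 f" and nn: "nonneg f" using f by (auto simp: cone_def G_def)
  define m where "m = (\<integral>z. f z * indicator {0<..<t} z \<partial>lborel)"
  have m: "0 \<le> m" "m \<le> 1"
    using G_trunc[OF G1, of t] integral_nonneg_supp[of "\<lambda>x. f x * indicator {0<..<t} x"] by (auto simp: G_def m_def)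
  have "(\<integral>x. \<bar>corr f t x\<bar> \<partial>lborel) \<le> (\<integral>x. f x * indicator {0<..<t} x + m * f x \<partial>lborel)"
    unfolding corr_def m_def[symmetric]
  proof (rule integral_mono)
    fix x
    have "0 \<le> f x * indicator {0<..<t} x" "0 \<le> m * f x" using nn m by (auto simp: nonneg_def)
    then show "\<bar>f x * indicator {0<..<t} x - m * f x\<bar> \<le> f x * indicator {0<..<t} x + m * f x" by linarith
  qed (intro supp01_integrable supp01_abs supp01_diff supp01_add supp01_scale supp01_trunc ok)+
  also have "\<dots> = m + m"
    using ok supp01_trunc[OF ok, of t] f by (simp add: supp01_integrable m_def)
  finally show ?thesis using m by simp
qed

text \<open>The truncated density g lies in \<open>G 1\<close> but in general not in the cone. After
  2N steps it is within e of \<open>B N g\<close>, which is in the cone and has the same mass as v;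
  \<open>cone_pair_decay\<close> handles this pair, and the remainder r does not grow in L1.\<close>

lemma corr_decay_block:
  assumes \<sigma>: "0 < \<sigma>" "\<sigma> < 1" "\<And>f x. cone f \<Longrightarrow> 0 < x \<Longrightarrow> x < 1 \<Longrightarrow> \<sigma> * (\<integral>x. f x \<partial>lborel) \<le> f x"
    and f: "cone f" "(\<integral>x. f x \<partial>lborel) = 1" and N: "0 < N" and e: "5 * cone_const * xn N powr (1 - \<gamma>) = e"
  shows "(\<integral>x. \<bar>(L ^^ (2 * N * k + 2 * N)) (corr f t) x\<bar> \<partial>lborel) \<le> 2 * (1 - \<sigma>) ^ k + (1 + 2 / \<sigma>) * e"
proof -
  have G1: "G 1 f" and ok: "supp01 f" and nn: "nonneg f" using f by (auto simp: cone_def G_def)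
  define g where "g = (\<lambda>x. f x * indicator {0<..<t} x)"
  define m where "m = (\<integral>z. g z \<partial>lborel)"
  have g: "G 1 g" unfolding g_def by (rule G_trunc[OF G1])
  then have gs: "supp01 g" "nonneg g" by (auto simp: G_def)
  have m: "0 \<le> m" "m \<le> 1" using g integral_nonneg_supp[of g] by (auto simp: G_def m_def)
  define v where "v = (\<lambda>x. m * (L ^^ (2 * N)) f x)"
  have v: "cone v" "(\<integral>x. v x \<partial>lborel) = m"
    unfolding v_def using f m ok by (auto intro!: cone_scale cone_L_pow simp: L_pow_mass)
  have sv: "supp01 v" unfolding v_def by (intro supp01_scale supp01_L_pow ok)
  have u: "cone (B N g)" "(\<integral>x. B N g x \<partial>lborel) = m"
    using cone_B[OF gs] B_mass[OF gs(1)] by (auto simp: m_def)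
  define r where "r = (\<lambda>x. (L ^^ (2 * N)) g x - B N g x)"
  have r: "supp01 r" unfolding r_def by (intro supp01_diff supp01_L_pow supp01_B gs)
  have c: "corr f t = (\<lambda>x. g x - m * f x)" by (auto simp: corr_def g_def m_def)
  have "(L ^^ (2 * N)) (corr f t) = (\<lambda>x. (L ^^ (2 * N)) g x - v x)"
    unfolding c v_def
    using pos_op_diff[OF pos_op_pow[OF pos_op_L, of "2 * N"], of g "\<lambda>x. m * f x"]
      pos_op_scale[OF pos_op_pow[OF pos_op_L, of "2 * N"], of m f] by simp
  also have "\<dots> = (\<lambda>x. r x + (B N g x - v x))" by (simp add: r_def)
  finally have "(L ^^ (2 * N * k + 2 * N)) (corr f t) = (L ^^ (2 * N * k)) (\<lambda>x. r x + (B N g x - v x))"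
    by (simp only: funpow_add comp_apply)
  also have "\<dots> = (\<lambda>x. (L ^^ (2 * N * k)) r x + (L ^^ (2 * N * k)) (\<lambda>x. B N g x - v x) x)"
    by (rule pos_op_add[OF pos_op_pow[OF pos_op_L]])
  finally have k: "(L ^^ (2 * N * k + 2 * N)) (corr f t) x =
     (L ^^ (2 * N * k)) r x + (L ^^ (2 * N * k)) (\<lambda>x. B N g x - v x) x" for x by simp
  have s: "supp01 ((L ^^ (2 * N * k)) r)" "supp01 ((L ^^ (2 * N * k)) (\<lambda>x. B N g x - v x))"
    by (intro supp01_L_pow r supp01_diff supp01_B sv)+
  have "(\<integral>x. \<bar>(L ^^ (2 * N * k + 2 * N)) (corr f t) x\<bar> \<partial>lborel) \<le>
     (\<integral>x. \<bar>(L ^^ (2 * N * k)) r x\<bar> + \<bar>(L ^^ (2 * N * k)) (\<lambda>x. B N g x - v x) x\<bar> \<partial>lborel)"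
    unfolding k by (intro integral_mono supp01_integrable supp01_abs supp01_add s abs_triangle_ineq)
  also have "\<dots> = (\<integral>x. \<bar>(L ^^ (2 * N * k)) r x\<bar> \<partial>lborel) + (\<integral>x. \<bar>(L ^^ (2 * N * k)) (\<lambda>x. B N g x - v x) x\<bar> \<partial>lborel)"
    by (intro Bochner_Integration.integral_add supp01_integrable supp01_abs s)
  also have "\<dots> \<le> e + (2 * (1 - \<sigma>) ^ k + 2 * e / \<sigma>)"
  proof (rule add_mono)
    have "(\<integral>x. \<bar>(L ^^ (2 * N * k)) r x\<bar> \<partial>lborel) \<le> (\<integral>x. \<bar>r x\<bar> \<partial>lborel)"
      by (rule pos_op_L1[OF pos_op_pow[OF pos_op_L] r])
    also have "\<dots> \<le> e" unfolding r_def e[symmetric] by (rule L_pow_B_error[OF g N])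
    finally show "(\<integral>x. \<bar>(L ^^ (2 * N * k)) r x\<bar> \<partial>lborel) \<le> e" .
    show "(\<integral>x. \<bar>(L ^^ (2 * N * k)) (\<lambda>x. B N g x - v x) x\<bar> \<partial>lborel) \<le> 2 * (1 - \<sigma>) ^ k + 2 * e / \<sigma>"
      by (rule cone_pair_decay[OF \<sigma> u(1) v(1) u(2) v(2) m(2) N e])
  qed
  finally show ?thesis by (simp add: algebra_simps)
qed

end

section \<open>Decay of correlations\<close>

lemma exp_neg_le_powr:
  fixes s y :: real
  assumes "0 < s" "0 < y" shows "exp (- y) \<le> (s / y) powr s"
proof -
  have "y / s \<le> exp (y / s)" using exp_ge_add_one_self[of "y / s"] by linarith
  then have "(y / s) powr s \<le> exp (y / s) powr s" using assms by (intro powr_mono2) auto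
  also have "\<dots> = exp y" using assms by (simp add: powr_def)
  finally have "exp (- y) \<le> inverse ((y / s) powr s)"
    using assms by (simp add: exp_minus le_imp_inverse_le)
  also have "\<dots> = (s / y) powr s"
    using assms by (simp add: powr_divide)
  finally show ?thesis .
qed

context lsv
begin

lemma L_pow_L1_antimono:
  assumes f: "supp01 f" and "m \<le> n"
  shows "(\<integral>x. \<bar>(L ^^ n) f x\<bar> \<partial>lborel) \<le> (\<integral>x. \<bar>(L ^^ m) f x\<bar> \<partial>lborel)"
proof -
  have "(L ^^ n) f = (L ^^ (n - m)) ((L ^^ m) f)"
    using assms(2) funpow_add[of "n - m" m L] by simp
  then show ?thesis
    using pos_op_L1[OF pos_op_pow[OF pos_op_L, of "n - m"] supp01_L_pow[OF f, of m]] by simp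
qed

lemma corr_decay:
  assumes \<kappa>: "0 < \<kappa>" "\<kappa> < 1"
  shows "\<exists>C>0. \<forall>f t n. cone f \<longrightarrow> (\<integral>x. f x \<partial>lborel) = 1 \<longrightarrow> 0 < n \<longrightarrow>
    (\<integral>x. \<bar>(L ^^ n) (corr f t) x\<bar> \<partial>lborel) \<le> C * real n powr (- (\<kappa> * ((1 - \<gamma>) / \<gamma>)))"
proof -
  obtain \<sigma> where \<sigma>: "0 < \<sigma>" "\<sigma> < 1"
    "\<And>f x. cone f \<Longrightarrow> 0 < x \<Longrightarrow> x < 1 \<Longrightarrow> \<sigma> * (\<integral>x. f x \<partial>lborel) \<le> f x"
    using cone_lower_bound by blast
  obtain c where c: "0 < c" "\<And>n. 0 < n \<Longrightarrow> xn n \<le> c * real n powr (-1 / \<gamma>)"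
    using xn_rate by blast
  define \<delta> where "\<delta> = (1 - \<gamma>) / \<gamma>"
  have \<delta>: "0 < \<delta>" using gamma_pos gamma_less_1 by (simp add: \<delta>_def)
  \<comment> \<open>Chosen so that q^(-s) = n^(-\<kappa>\<delta>) for q = n^(1-\<kappa>), which is
    the number of blocks up to a constant.\<close>
  define s where "s = \<kappa> * \<delta> / (1 - \<kappa>)"
  have s: "0 < s" using \<kappa> \<delta> by (simp add: s_def)
  define a where "a = - ln (1 - \<sigma>)"
  have a: "0 < a" using \<sigma> by (simp add: a_def)
  define C1 where "C1 = 5 * cone_const * c powr (1 - \<gamma>)"
  have C1: "0 < C1" using c cone_const_ge_4 by (simp add: C1_def)
  define C where "C = 2 * exp (2 * a) * (4 * s / a) powr s + (1 + 2 / \<sigma>) * C1"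
  have C: "0 < C" unfolding C_def using C1 \<sigma> a s by (intro add_pos_pos mult_pos_pos) auto
  have main: "(\<integral>x. \<bar>(L ^^ n) (corr f t) x\<bar> \<partial>lborel) \<le> C * real n powr (- (\<kappa> * \<delta>))"
    if f: "cone f" "(\<integral>x. f x \<partial>lborel) = 1" and n: "0 < n" for f t n
  proof -
    have ok: "supp01 (corr f t)" using f by (auto simp: cone_def G_def intro: supp01_corr)
    define r where "r = real n powr \<kappa>"
    have r: "1 \<le> r" using n \<kappa> by (simp add: r_def ge_one_powr_ge_zero)
    define N where "N = nat \<lceil>r\<rceil>"
    have N: "0 < N" "r \<le> real N" "real N \<le> 2 * r"
    proof -
      show "r \<le> real N" unfolding N_def by linarith
      then show "0 < N" using r by (cases N) auto
      have "real N = of_int \<lceil>r\<rceil>" using r unfolding N_def by simp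
      then show "real N \<le> 2 * r" using r by linarith
    qed
    define e where "e = 5 * cone_const * xn N powr (1 - \<gamma>)"
    have e: "e \<le> C1 * real n powr (- (\<kappa> * \<delta>))"
    proof -
      have "xn N powr (1 - \<gamma>) \<le> (c * real N powr (-1 / \<gamma>)) powr (1 - \<gamma>)"
        using c(2)[OF N(1)] xn_pos[of N] gamma_less_1 by (intro powr_mono2) auto
      also have "\<dots> = c powr (1 - \<gamma>) * real N powr (- \<delta>)"
        using c N by (simp add: powr_mult powr_powr \<delta>_def)
      also have "\<dots> \<le> c powr (1 - \<gamma>) * r powr (- \<delta>)"
        using N r \<delta> by (intro mult_left_mono powr_mono2') auto
      also have "r powr (- \<delta>) = real n powr (- (\<kappa> * \<delta>))" by (simp add: r_def powr_powr)
      finally show ?thesis unfolding e_def C1_def using cone_const_ge_4 by simp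
    qed
    define q where "q = real n powr (1 - \<kappa>)"
    have q: "0 < q" "r * q = real n" using n by (simp_all add: q_def r_def powr_add[symmetric])
    define K where "K = n div (2 * N)"
    \<comment> \<open>Since N \<le> 2r, more than q/4 - 2 blocks follow the first one. The factor
      exp(2a) absorbs this 2 and makes the bound at least 2, hence trivial, when n < 2N.\<close>
    have "(\<integral>x. \<bar>(L ^^ n) (corr f t) x\<bar> \<partial>lborel) \<le> 2 * exp (2 * a - a * q / 4) + (1 + 2 / \<sigma>) * e"
    proof (cases K)
      case 0
      then have "n < 2 * N" using N by (simp add: K_def div_eq_0_iff)
      then have "r * q < r * 4" using N q by simp
      then have "q < 4" using r by simp
      then have "a * q / 4 \<le> 2 * a" using a by simp
      then have "1 \<le> exp (2 * a - a * q / 4)" by simp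
      moreover have "0 \<le> (1 + 2 / \<sigma>) * e" using \<sigma> cone_const_ge_4 by (simp add: e_def)
      moreover have "(\<integral>x. \<bar>(L ^^ n) (corr f t) x\<bar> \<partial>lborel) \<le> 2"
        using pos_op_L1[OF pos_op_pow[OF pos_op_L, of n] ok] corr_L1[OF f, of t] by linarith
      ultimately show ?thesis by linarith
    next
      case (Suc k)
      have "2 * N * k + 2 * N = 2 * N * K" by (simp add: Suc)
      also have "\<dots> \<le> n" by (simp add: K_def)
      finally have le: "2 * N * k + 2 * N \<le> n" .
      have "n < 2 * N * K + 2 * N" using N unfolding K_def
        by (metis add.commute dividend_less_times_div mult_pos_pos pos2)
      then have "real n < real (2 * N * K + 2 * N)" by (simp only: of_nat_less_iff)
      then have "real n < 2 * real N * (real K + 1)" by (simp add: algebra_simps)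
      also have "\<dots> \<le> 2 * (2 * r) * (real K + 1)" using N by (intro mult_right_mono) auto
      finally have "r * q < r * (4 * (real K + 1))" using q by (simp add: algebra_simps)
      then have k: "q / 4 - 2 < real k" using r Suc by (simp add: mult_less_cancel_left)
      have "(1 - \<sigma>) ^ k = exp (- (a * real k))"
        using \<sigma> by (simp add: a_def exp_of_nat_mult mult.commute[of _ "real k"])
      also have "\<dots> \<le> exp (2 * a - a * q / 4)"
        using mult_strict_left_mono[OF k a] by (simp add: algebra_simps)
      finally have p: "(1 - \<sigma>) ^ k \<le> exp (2 * a - a * q / 4)" .
      have "(\<integral>x. \<bar>(L ^^ n) (corr f t) x\<bar> \<partial>lborel) \<le> (\<integral>x. \<bar>(L ^^ (2 * N * k + 2 * N)) (corr f t) x\<bar> \<partial>lborel)"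
        by (rule L_pow_L1_antimono[OF ok le])
      also have "\<dots> \<le> 2 * (1 - \<sigma>) ^ k + (1 + 2 / \<sigma>) * e"
        by (rule corr_decay_block[OF \<sigma> f N(1) e_def[symmetric]])
      finally show ?thesis using p by linarith
    qed
    moreover have "exp (2 * a - a * q / 4) \<le> exp (2 * a) * ((4 * s / a) powr s * real n powr (- (\<kappa> * \<delta>)))"
    proof -
      have "exp (- (a * q / 4)) \<le> (s / (a * q / 4)) powr s"
        using a q s by (intro exp_neg_le_powr) auto
      also have "s / (a * q / 4) = (4 * s / a) * (1 / q)" by simp
      also have "((4 * s / a) * (1 / q)) powr s = (4 * s / a) powr s * (1 / q) powr s"
        using a q s by (intro powr_mult)
      also have "(1 / q) powr s = q powr (- s)"
        using q by (simp add: powr_minus_divide powr_divide)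
      also have "q powr (- s) = real n powr (- (\<kappa> * \<delta>))"
        using \<kappa> by (simp add: q_def powr_powr s_def)
      finally show ?thesis
        using mult_left_mono[of "exp (- (a * q / 4))" _ "exp (2 * a)"] exp_add[of "2 * a" "- (a * q / 4)"]
        by simp
    qed
    moreover have "(1 + 2 / \<sigma>) * e \<le> (1 + 2 / \<sigma>) * (C1 * real n powr (- (\<kappa> * \<delta>)))"
      using e \<sigma> by (intro mult_left_mono) auto
    ultimately have "(\<integral>x. \<bar>(L ^^ n) (corr f t) x\<bar> \<partial>lborel) \<le>
      2 * (exp (2 * a) * ((4 * s / a) powr s * real n powr (- (\<kappa> * \<delta>)))) +
      (1 + 2 / \<sigma>) * (C1 * real n powr (- (\<kappa> * \<delta>)))" by linarith
    also have "\<dots> = C * real n powr (- (\<kappa> * \<delta>))"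
      unfolding C_def distrib_right mult.assoc ..
    finally show ?thesis .
  qed
  then show ?thesis using C unfolding \<delta>_def by blast
qed

section \<open>Loss of memory for arbitrary integrable initial densities\<close>

definition equidist :: "(real \<Rightarrow> real) \<Rightarrow> bool" where
  "equidist u \<longleftrightarrow> (\<forall>\<Phi>\<in>borel_measurable borel. (\<forall>x. \<bar>\<Phi> x\<bar> \<le> 1) \<longrightarrow>
     (\<lambda>k. (\<integral>x. u x * \<Phi> ((T_map \<gamma> ^^ k) x) \<partial>lborel) -
           (\<integral>x. u x \<partial>lborel) * (\<integral>x. unif x * \<Phi> ((T_map \<gamma> ^^ k) x) \<partial>lborel)) \<longlonglongrightarrow> 0)"

lemma supp01_mult_pow:
  assumes "supp01 u" "\<Phi> \<in> borel_measurable borel" "\<And>x. \<bar>\<Phi> x\<bar> \<le> 1"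
  shows "supp01 (\<lambda>x. u x * \<Phi> ((T_map \<gamma> ^^ k) x))"
  using assms by (intro supp01_mult[of _ _ 1] measurable_compose[OF T_map_pow_measurable]) auto

lemma integral_abs_mult_le:
  fixes \<psi> :: "real \<Rightarrow> real"
  assumes u: "supp01 u" and [measurable]: "\<psi> \<in> borel_measurable borel" and b: "\<And>x. \<bar>\<psi> x\<bar> \<le> 1"
  shows "\<bar>\<integral>x. u x * \<psi> x \<partial>lborel\<bar> \<le> (\<integral>x. \<bar>u x\<bar> \<partial>lborel)"
proof -
  have "\<bar>\<integral>x. u x * \<psi> x \<partial>lborel\<bar> \<le> (\<integral>x. \<bar>u x * \<psi> x\<bar> \<partial>lborel)"
    by (rule integral_abs_bound)
  also have "\<dots> \<le> (\<integral>x. \<bar>u x\<bar> \<partial>lborel)"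
  proof (rule integral_mono)
    show "\<bar>u x * \<psi> x\<bar> \<le> \<bar>u x\<bar>" for x
      using b[of x] mult_left_mono[of "\<bar>\<psi> x\<bar>" 1 "\<bar>u x\<bar>"] by (simp add: abs_mult)
  qed (intro supp01_integrable supp01_abs supp01_mult[OF u _ b] u; simp)+
  finally show ?thesis .
qed

lemma equidist_add:
  assumes u: "supp01 u" "supp01 v" "equidist u" "equidist v"
  shows "equidist (\<lambda>x. u x + v x)"
  unfolding equidist_def
proof (intro ballI impI)
  fix \<Phi> :: "real \<Rightarrow> real" assume \<Phi>: "\<Phi> \<in> borel_measurable borel" "\<forall>x. \<bar>\<Phi> x\<bar> \<le> 1"
  have i: "integrable lborel (\<lambda>x. w x * \<Phi> ((T_map \<gamma> ^^ k) x))" if "supp01 w" for k w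
    using \<Phi> that by (intro supp01_integrable supp01_mult_pow) auto
  have "(\<lambda>k. ((\<integral>x. u x * \<Phi> ((T_map \<gamma> ^^ k) x) \<partial>lborel) -
           (\<integral>x. u x \<partial>lborel) * (\<integral>x. unif x * \<Phi> ((T_map \<gamma> ^^ k) x) \<partial>lborel)) +
      ((\<integral>x. v x * \<Phi> ((T_map \<gamma> ^^ k) x) \<partial>lborel) -
           (\<integral>x. v x \<partial>lborel) * (\<integral>x. unif x * \<Phi> ((T_map \<gamma> ^^ k) x) \<partial>lborel))) \<longlonglongrightarrow> 0 + 0"
    using u \<Phi> unfolding equidist_def by (intro tendsto_add) auto
  then show "(\<lambda>k. (\<integral>x. (u x + v x) * \<Phi> ((T_map \<gamma> ^^ k) x) \<partial>lborel) -
           (\<integral>x. u x + v x \<partial>lborel) * (\<integral>x. unif x * \<Phi> ((T_map \<gamma> ^^ k) x) \<partial>lborel)) \<longlonglongrightarrow> 0"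
    using u by (simp add: i supp01_integrable algebra_simps)
qed

lemma equidist_scale:
  assumes u: "equidist u" shows "equidist (\<lambda>x. c * u x)"
  unfolding equidist_def
proof (intro ballI impI)
  fix \<Phi> :: "real \<Rightarrow> real" assume \<Phi>: "\<Phi> \<in> borel_measurable borel" "\<forall>x. \<bar>\<Phi> x\<bar> \<le> 1"
  have "(\<lambda>k. c * ((\<integral>x. u x * \<Phi> ((T_map \<gamma> ^^ k) x) \<partial>lborel) -
           (\<integral>x. u x \<partial>lborel) * (\<integral>x. unif x * \<Phi> ((T_map \<gamma> ^^ k) x) \<partial>lborel))) \<longlonglongrightarrow> c * 0"
    using u \<Phi> unfolding equidist_def by (intro tendsto_mult) auto
  then show "(\<lambda>k. (\<integral>x. c * u x * \<Phi> ((T_map \<gamma> ^^ k) x) \<partial>lborel) -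
           (\<integral>x. c * u x \<partial>lborel) * (\<integral>x. unif x * \<Phi> ((T_map \<gamma> ^^ k) x) \<partial>lborel)) \<longlonglongrightarrow> 0"
    by (simp add: algebra_simps)
qed

text \<open>Uniformly in k, both integrals change by at most the L1 distance of the densities, so an
  approximation may be fixed before k grows.\<close>

lemma equidist_limit:
  assumes u: "supp01 u" and v: "\<And>i. supp01 (v i)" "\<And>i::nat. equidist (v i)"
    and lim: "(\<lambda>i. \<integral>x. \<bar>u x - v i x\<bar> \<partial>lborel) \<longlonglongrightarrow> 0"
  shows "equidist u"
  unfolding equidist_def
proof (intro ballI impI)
  fix \<Phi> :: "real \<Rightarrow> real" assume \<Phi>: "\<Phi> \<in> borel_measurable borel" "\<forall>x. \<bar>\<Phi> x\<bar> \<le> 1"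
  define I where "I w k = (\<integral>x. w x * \<Phi> ((T_map \<gamma> ^^ k) x) \<partial>lborel)" for w k
  have [measurable]: "(\<lambda>x. \<Phi> ((T_map \<gamma> ^^ k) x)) \<in> borel_measurable borel" for k
    by (rule measurable_compose[OF T_map_pow_measurable \<Phi>(1)])
  have I1: "\<bar>I w k\<bar> \<le> (\<integral>x. \<bar>w x\<bar> \<partial>lborel)" if "supp01 w" for w k
    unfolding I_def using \<Phi> by (intro integral_abs_mult_le that) auto
  have Id: "I w k = I z k + I (\<lambda>x. w x - z x) k" if "supp01 w" "supp01 z" for w z k
    unfolding I_def using supp01_integrable[OF supp01_mult_pow[OF that(1) \<Phi>(1), of k]] supp01_integrable[OF supp01_mult_pow[OF that(2) \<Phi>(1), of k]] \<Phi>
    by (simp add: left_diff_distrib)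
  show "(\<lambda>k. (\<integral>x. u x * \<Phi> ((T_map \<gamma> ^^ k) x) \<partial>lborel) -
           (\<integral>x. u x \<partial>lborel) * (\<integral>x. unif x * \<Phi> ((T_map \<gamma> ^^ k) x) \<partial>lborel)) \<longlonglongrightarrow> 0"
    unfolding I_def[symmetric]
  proof (rule LIMSEQ_I)
    fix r :: real assume "0 < r"
    then obtain i where i: "(\<integral>x. \<bar>u x - v i x\<bar> \<partial>lborel) < r / 4"
      using LIMSEQ_D[OF lim, of "r / 4"] by (auto simp: abs_less_iff)
    have "(\<lambda>k. I (v i) k - (\<integral>x. v i x \<partial>lborel) * I unif k) \<longlonglongrightarrow> 0"
      using v(2)[of i] \<Phi> unfolding equidist_def I_def by blast
    from LIMSEQ_D[OF this, of "r / 4"] obtain k0 where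
      k0: "\<And>k. k0 \<le> k \<Longrightarrow> \<bar>I (v i) k - (\<integral>x. v i x \<partial>lborel) * I unif k\<bar> < r / 4"
      using \<open>0 < r\<close> by auto
    have s: "supp01 (\<lambda>x. u x - v i x)" by (intro supp01_diff u v)
    have "\<bar>I u k - (\<integral>x. u x \<partial>lborel) * I unif k\<bar> < r" if k: "k0 \<le> k" for k
    proof -
      have 1: "\<bar>I (\<lambda>x. u x - v i x) k\<bar> < r / 4" using I1[OF s, of k] i by linarith
      have "\<bar>(\<integral>x. u x \<partial>lborel) - (\<integral>x. v i x \<partial>lborel)\<bar> = \<bar>\<integral>x. u x - v i x \<partial>lborel\<bar>"
        using u v(1)[of i] by (simp add: supp01_integrable)
      also have "\<dots> \<le> (\<integral>x. \<bar>u x - v i x\<bar> \<partial>lborel)" by (rule integral_abs_bound)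
      finally have 2: "\<bar>(\<integral>x. u x \<partial>lborel) - (\<integral>x. v i x \<partial>lborel)\<bar> < r / 4" using i by linarith
      have "(\<integral>x. \<bar>unif x\<bar> \<partial>lborel) = 1" using integral_unif by (simp add: unif_def)
      then have "\<bar>I unif k\<bar> \<le> 1" using I1[OF supp01_unif, of k] by simp
      then have 3: "\<bar>((\<integral>x. u x \<partial>lborel) - (\<integral>x. v i x \<partial>lborel)) * I unif k\<bar> < r / 4"
        using 2 mult_left_mono[of "\<bar>I unif k\<bar>" 1 "\<bar>(\<integral>x. u x \<partial>lborel) - (\<integral>x. v i x \<partial>lborel)\<bar>"]
        by (simp add: abs_mult)
      have "I u k - (\<integral>x. u x \<partial>lborel) * I unif k = I (\<lambda>x. u x - v i x) k +
         (I (v i) k - (\<integral>x. v i x \<partial>lborel) * I unif k) -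
         ((\<integral>x. u x \<partial>lborel) - (\<integral>x. v i x \<partial>lborel)) * I unif k"
        using Id[OF u v(1)[of i], of k] by (simp add: algebra_simps)
      then show ?thesis using 1 3 k0[OF k] \<open>0 < r\<close> by linarith
    qed
    then show "\<exists>no. \<forall>k\<ge>no. norm (I u k - (\<integral>x. u x \<partial>lborel) * I unif k - 0) < r" by auto
  qed
qed

lemma supp01_unif_mult: "integrable lborel u \<Longrightarrow> supp01 (\<lambda>x. unif x * u x)"
proof -
  assume u: "integrable lborel u"
  have "integrable lborel (\<lambda>x. unif x * u x)"
    using u borel_measurable_integrable[OF u]
    by (intro Bochner_Integration.integrable_bound[OF u]) (auto simp: unif_def indicator_def)
  then show ?thesis by (simp add: supp01_def unif_def)
qed

lemma equidist_dominated:
  assumes u: "integrable lborel u" and v: "\<And>i. integrable lborel (v i)" "\<And>i::nat. equidist (\<lambda>x. unif x * v i x)"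
    and lim: "\<And>x. (\<lambda>i. v i x) \<longlonglongrightarrow> u x" and b: "\<And>i x. 0 < x \<Longrightarrow> x < 1 \<Longrightarrow> \<bar>v i x\<bar> \<le> w x" and w: "integrable lborel w"
  shows "equidist (\<lambda>x. unif x * u x)"
proof (rule equidist_limit)
  have "(\<lambda>i. \<integral>x. \<bar>unif x * u x - unif x * v i x\<bar> \<partial>lborel) \<longlonglongrightarrow> (\<integral>x. 0 \<partial>(lborel::real measure))"
  proof (rule integral_dominated_convergence)
    show "integrable lborel (\<lambda>x. \<bar>u x\<bar> + \<bar>w x\<bar>)" using u w by auto
    have "(\<lambda>i. \<bar>unif x * u x - unif x * v i x\<bar>) \<longlonglongrightarrow> \<bar>unif x * u x - unif x * u x\<bar>" for x
      by (intro tendsto_intros lim)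
    then show "AE x in lborel. (\<lambda>i. \<bar>unif x * u x - unif x * v i x\<bar>) \<longlonglongrightarrow> 0" by simp
    show "AE x in lborel. norm \<bar>unif x * u x - unif x * v i x\<bar> \<le> \<bar>u x\<bar> + \<bar>w x\<bar>" for i
    proof (rule AE_I2)
      fix x show "norm \<bar>unif x * u x - unif x * v i x\<bar> \<le> \<bar>u x\<bar> + \<bar>w x\<bar>"
        using b[of x i] by (auto simp: unif_def indicator_def)
    qed
  qed (use u v in \<open>auto simp: unif_def dest: borel_measurable_integrable\<close>)
  then show "(\<lambda>i. \<integral>x. \<bar>unif x * u x - unif x * v i x\<bar> \<partial>lborel) \<longlonglongrightarrow> 0" by simp
qed (use u v in \<open>auto intro: supp01_unif_mult\<close>)

text \<open>\<open>unif\<close> is in the cone, so \<open>corr_decay\<close> applies to its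
  truncation; any \<kappa> serves here, and 1/2 is taken.\<close>

lemma equidist_lessThan: "equidist (\<lambda>x. unif x * indicator {..<t} x)"
  unfolding equidist_def
proof (intro ballI impI)
  fix \<Phi> :: "real \<Rightarrow> real" assume \<Phi>: "\<Phi> \<in> borel_measurable borel" "\<forall>x. \<bar>\<Phi> x\<bar> \<le> 1"
  obtain C where C: "0 < C" "\<And>f t n. cone f \<Longrightarrow> (\<integral>x. f x \<partial>lborel) = 1 \<Longrightarrow> 0 < n \<Longrightarrow>
    (\<integral>x. \<bar>(L ^^ n) (corr f t) x\<bar> \<partial>lborel) \<le> C * real n powr (- ((1/2) * ((1 - \<gamma>) / \<gamma>)))"
    using corr_decay[of "1/2"] by auto
  have Ueq: "unif x * indicator {..<t} x = unif x * indicator {0<..<t} x" for x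
    by (auto simp: unif_def indicator_def)
  define J where "J k = (\<integral>x. unif x * indicator {0<..<t} x * \<Phi> ((T_map \<gamma> ^^ k) x) \<partial>lborel) -
           (\<integral>x. unif x * indicator {0<..<t} x \<partial>lborel) * (\<integral>x. unif x * \<Phi> ((T_map \<gamma> ^^ k) x) \<partial>lborel)" for k
  have J: "J k = (\<integral>x. (L ^^ k) (corr unif t) x * \<Phi> x \<partial>lborel)" for k
  proof -
    have "(\<integral>x. (L ^^ k) (corr unif t) x * \<Phi> x \<partial>lborel) = (\<integral>x. corr unif t x * \<Phi> ((T_map \<gamma> ^^ k) x) \<partial>lborel)"
      using \<Phi> by (intro L_pow_duality[of _ _ 1] supp01_corr supp01_unif) auto
    also have "\<dots> = J k"
      unfolding J_def corr_def left_diff_distrib mult.assoc[of _ "unif _"]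
      using \<Phi> supp01_mult_pow[OF supp01_trunc[OF supp01_unif, of t], of \<Phi> k] supp01_mult_pow[OF supp01_unif, of \<Phi> k]
      by (subst Bochner_Integration.integral_diff) (auto simp: supp01_integrable)
    finally show ?thesis ..
  qed
  have bd: "\<bar>J k\<bar> \<le> C * real k powr (- ((1/2) * ((1 - \<gamma>) / \<gamma>)))" if "0 < k" for k
  proof -
    have "\<bar>J k\<bar> \<le> (\<integral>x. \<bar>(L ^^ k) (corr unif t) x\<bar> \<partial>lborel)"
      unfolding J using \<Phi> by (intro integral_abs_mult_le supp01_L_pow supp01_corr supp01_unif) auto
    then show ?thesis using C(2)[OF cone_unif _ that, of t] by simp
  qed
  have "(\<lambda>k. C * real k powr (- ((1/2) * ((1 - \<gamma>) / \<gamma>)))) \<longlonglongrightarrow> C * 0"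
    using gamma_pos gamma_less_1
    by (intro tendsto_mult tendsto_const tendsto_neg_powr filterlim_real_sequentially) (auto simp: field_simps)
  moreover have "\<forall>\<^sub>F k in sequentially. norm (J k) \<le> C * real k powr (- ((1/2) * ((1 - \<gamma>) / \<gamma>)))"
    using eventually_gt_at_top[of 0] by eventually_elim (simp only: real_norm_def bd)
  ultimately have "J \<longlonglongrightarrow> 0"
    using Lim_null_comparison[of J] by simp
  then show "(\<lambda>k. (\<integral>x. unif x * indicator {..<t} x * \<Phi> ((T_map \<gamma> ^^ k) x) \<partial>lborel) -
           (\<integral>x. unif x * indicator {..<t} x \<partial>lborel) * (\<integral>x. unif x * \<Phi> ((T_map \<gamma> ^^ k) x) \<partial>lborel)) \<longlonglongrightarrow> 0"
    unfolding Ueq J_def[abs_def] .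
qed

text \<open>Half-lines form an intersection-stable generator of the Borel sets. Complements follow
  by linearity, countable disjoint unions by dominated convergence.\<close>

lemma equidist_indicator:
  assumes "A \<in> sets borel"
  shows "equidist (\<lambda>x. unif x * indicator A x)"
proof -
  have int: "integrable lborel (\<lambda>x. unif x * indicator A x)" if "A \<in> sets borel" for A
    using that by (intro supp01_integrable supp01_mult[OF supp01_unif, of _ 1]) (auto simp: indicator_def)
  have sp: "supp01 (\<lambda>x. unif x * indicator A x)" if "A \<in> sets borel" for A
    using that by (intro supp01_mult[OF supp01_unif, of _ 1]) (auto simp: indicator_def)
  have UU: "(\<lambda>x. unif x * (unif x * h x)) = (\<lambda>x. unif x * h x)" for h :: "real \<Rightarrow> real"
    by (auto simp: unif_def indicator_def fun_eq_iff)
  have eU: "equidist unif"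
  proof -
    have "(\<lambda>x. unif x * indicator {..<1} x) = unif" by (auto simp: unif_def indicator_def)
    then show ?thesis using equidist_lessThan[of 1] by simp
  qed
  have e0: "equidist (\<lambda>x. 0)" using equidist_scale[OF eU, of 0] by simp
  have ediff: "equidist (\<lambda>x. unif x - u x)" if "supp01 u" "equidist u" for u
    using equidist_add[OF supp01_unif supp01_scale[OF that(1), of "-1"] eU equidist_scale[OF that(2), of "-1"]] by simp
  have A: "A \<in> sigma_sets UNIV (range lessThan)"
    using assms unfolding borel_Iio by (subst (asm) sets_measure_of) auto
  have st: "Int_stable (range (lessThan :: real \<Rightarrow> real set))"
  proof -
    have "{..<a} \<inter> {..<b} = {..<min a b}" for a b :: real by auto
    then show ?thesis by (auto simp: Int_stable_def)
  qed
  have cl: "range (lessThan :: real \<Rightarrow> real set) \<subseteq> Pow UNIV" by simp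
  from st cl A show ?thesis
  proof (induct rule: sigma_sets_induct_disjoint)
    case (basic A) then show ?case using equidist_lessThan by auto
  next
    case empty then show ?case using e0 by simp
  next
    case (compl A)
    have "A \<in> sets borel" using compl(1) unfolding borel_Iio by (subst sets_measure_of) auto
    from ediff[OF sp[OF this] compl(2)] show ?case
      by (rule back_subst[of equidist]) (auto simp: indicator_def fun_eq_iff)
  next
    case (union A)
    have Ab: "A i \<in> sets borel" for i
      using union(2) unfolding borel_Iio by (subst sets_measure_of) auto
    define v where "v n x = (\<Sum>i<n. unif x * indicator (A i) x)" for n x
    have veq: "v n x = unif x * indicator (\<Union>i<n. A i) x" for n x
      unfolding v_def using union(1)
      by (subst indicator_UN_disjoint) (auto simp: sum_distrib_left disjoint_family_on_def)
    have vs: "supp01 (v n)" for n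
      unfolding v_def[abs_def] by (intro supp01_sum sp Ab)
    have ve: "equidist (v n)" for n
    proof (induction n)
      case 0 then show ?case using e0 by (simp add: v_def[abs_def])
    next
      case (Suc n)
      have "equidist (\<lambda>x. v n x + unif x * indicator (A n) x)"
        by (rule equidist_add[OF vs sp[OF Ab] Suc union(3)])
      moreover have "(\<lambda>x. v n x + unif x * indicator (A n) x) = v (Suc n)"
        by (rule ext) (simp only: v_def sum.lessThan_Suc)
      ultimately show ?case by simp
    qed
    have "equidist (\<lambda>x. unif x * (unif x * indicator (\<Union>i. A i) x))"
    proof (rule equidist_dominated[where v=v and w=unif])
      show "equidist (\<lambda>x. unif x * v i x)" for i
        using ve[of i] unfolding veq[abs_def] UU .
      show "(\<lambda>i. v i x) \<longlonglongrightarrow> unif x * indicator (\<Union>i. A i) x" for x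
        unfolding veq by (intro tendsto_mult tendsto_const LIMSEQ_indicator_UN)
      show "\<bar>v i x\<bar> \<le> unif x" for i x
        unfolding veq by (auto simp: unif_def indicator_def)
      show "integrable lborel (\<lambda>x. unif x * indicator (\<Union>i. A i) x)"
        using Ab by (intro int) auto
    qed (auto intro: supp01_integrable vs supp01_unif)
    then show ?case unfolding UU .
  qed
qed

text \<open>The extension from indicators to all integrable functions is what makes the property
  applicable to the density of the invariant measure.\<close>

lemma equidist_integrable:
  assumes "integrable lborel u" shows "equidist (\<lambda>x. unif x * u x)"
  using assms
proof (induction u rule: integrable_induct)
  case (base A c)
  then have "equidist (\<lambda>x. c * (unif x * indicator A x))"
    by (intro equidist_scale equidist_indicator) simp
  then show ?case by (simp add: mult_ac)
next
  case (add f g)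
  then show ?case
    using equidist_add[OF supp01_unif_mult supp01_unif_mult, of f g] by (simp add: distrib_left)
next
  case (lim f s)
  show ?case
  proof (rule equidist_dominated)
    show "(\<lambda>i. s i x) \<longlonglongrightarrow> f x" for x using lim(2) by simp
    show "\<bar>s i x\<bar> \<le> 2 * \<bar>f x\<bar>" for i x using lim(3)[of x i] by simp
  qed (use lim in auto)
qed

section \<open>The invariant measure as the limit of iterated Lebesgue measure\<close>

context
  fixes \<nu> :: "real measure"
  assumes acip: "acip \<gamma> \<nu>"
begin

interpretation \<nu>: prob_space \<nu>
  using acip by (simp add: acip_def)

lemma sets_nu [measurable_cong]: "sets \<nu> = sets borel"
  using acip by (simp add: acip_def)

lemma space_nu: "space \<nu> = UNIV"
  using sets_eq_imp_space_eq[OF sets_nu] by simp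

lemma nu_null: 
  assumes "AE x in lborel. P x" shows "AE x in \<nu>. P x"
proof -
  have "absolutely_continuous lborel \<nu>" using acip by (simp add: acip_def)
  then show ?thesis
    using assms by (intro absolutely_continuous_AE[of \<nu> lborel]) (auto simp: sets_nu)
qed

lemma nu_distr: "distr \<nu> borel (T_map \<gamma>) = \<nu>"
  using acip by (simp add: acip_def)

lemma nu_AE_01: "AE x in \<nu>. 0 < x \<and> x < 1"
proof -
  have "AE x in \<nu>. x \<in> {0..1}"
    using acip by (intro \<nu>.prob_eq_1[THEN iffD1]) (auto simp: acip_def sets_nu)
  moreover have "AE x in \<nu>. x \<noteq> 0" "AE x in \<nu>. x \<noteq> 1"
    by (auto intro!: nu_null AE_lborel_singleton)
  ultimately show ?thesis by eventually_elim auto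
qed

lemma nu_integral_pow:
  fixes \<Phi> :: "real \<Rightarrow> real"
  assumes [measurable]: "\<Phi> \<in> borel_measurable borel"
  shows "(\<integral>x. \<Phi> ((T_map \<gamma> ^^ k) x) \<partial>\<nu>) = (\<integral>x. \<Phi> x \<partial>\<nu>)"
proof (induction k)
  case (Suc k)
  have "(\<integral>x. \<Phi> x \<partial>\<nu>) = (\<integral>x. \<Phi> ((T_map \<gamma> ^^ k) x) \<partial>distr \<nu> borel (T_map \<gamma>))"
    using Suc by (simp add: nu_distr)
  also have "\<dots> = (\<integral>x. \<Phi> ((T_map \<gamma> ^^ k) (T_map \<gamma> x)) \<partial>\<nu>)"
    by (rule Bochner_Integration.integral_distr) auto
  finally show ?case by (simp only: funpow_Suc_right comp_apply)
qed simp

text \<open>Radon-Nikodym; the representative is multiplied by \<open>unif\<close> so that it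
  vanishes everywhere outside (0,1), as \<open>supp01\<close> demands.\<close>

lemma nu_density: "\<exists>g. supp01 g \<and> (\<forall>\<Phi>\<in>borel_measurable borel. (\<integral>x. \<Phi> x \<partial>\<nu>) = (\<integral>x. g x * \<Phi> x \<partial>lborel))"
proof -
  have ac: "absolutely_continuous lborel \<nu>" using acip by (simp add: acip_def)
  define h where "h = RN_deriv lborel \<nu>"
  have [measurable]: "h \<in> borel_measurable borel" unfolding h_def by simp
  have dh: "density lborel h = \<nu>"
    unfolding h_def by (rule sigma_finite_measure.density_RN_deriv[OF sigma_finite_lborel ac]) (simp add: sets_nu)
  have fin: "AE x in lborel. h x \<noteq> \<infinity>"
    unfolding h_def by (rule sigma_finite_measure.RN_deriv_finite[OF sigma_finite_lborel _ ac]) (auto simp: sets_nu \<nu>.sigma_finite_measure)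
  define g where "g x = unif x * enn2real (h x)" for x
  have [measurable]: "g \<in> borel_measurable borel" unfolding g_def[abs_def] unif_def by measurable
  have "density lborel (\<lambda>x. ennreal (g x)) = \<nu>"
  proof -
    have a: "AE x in lborel. 0 < h x \<longrightarrow> (0 < x \<and> x < 1)"
      using nu_AE_01 unfolding dh[symmetric] by (subst (asm) AE_density) auto
    have "AE x in lborel. ennreal (g x) = h x"
      using a fin
    proof eventually_elim
      case (elim x)
      then show ?case
        by (cases "h x = 0"; cases "0 < x \<and> x < 1") (auto simp: g_def unif_def less_top zero_less_iff_neq_zero)
    qed
    then have "density lborel (\<lambda>x. ennreal (g x)) = density lborel h"
      by (intro density_cong) auto
    then show ?thesis by (simp add: dh)
  qed
  note dg = this
  have g0: "0 \<le> g x" for x by (simp add: g_def unif_def)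
  have "(\<integral>x. \<Phi> x \<partial>\<nu>) = (\<integral>x. g x * \<Phi> x \<partial>lborel)" if [measurable]: "\<Phi> \<in> borel_measurable borel" for \<Phi> :: "real \<Rightarrow> real"
    unfolding dg[symmetric] by (subst integral_density) (auto simp: g0)
  moreover have "integrable lborel g"
  proof -
    have "integrable \<nu> (\<lambda>x. 1::real)" by simp
    then show ?thesis unfolding dg[symmetric] by (subst (asm) integrable_density) (auto simp: g0)
  qed
  ultimately show ?thesis by (intro exI[of _ g]) (auto simp: supp01_def g_def unif_def)
qed

text \<open>For the density g of \<nu> the first integral in \<open>equidist g\<close> does not
  depend on k, by invariance, and equals \<nu>(\<Phi>). So the integrals for Lebesgue measure must
  converge to it.\<close>

lemma lebesgue_to_nu:
  assumes \<Phi>: "\<Phi> \<in> borel_measurable borel" "\<And>x. \<bar>\<Phi> x\<bar> \<le> 1"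
  shows "(\<lambda>k. \<integral>x. unif x * \<Phi> ((T_map \<gamma> ^^ k) x) \<partial>lborel) \<longlonglongrightarrow> (\<integral>x. \<Phi> x \<partial>\<nu>)"
proof -
  note [measurable] = \<Phi>(1)
  obtain g where g: "supp01 g" "\<And>\<Phi>. \<Phi> \<in> borel_measurable borel \<Longrightarrow> (\<integral>x. \<Phi> x \<partial>\<nu>) = (\<integral>x. g x * \<Phi> x \<partial>lborel)"
    using nu_density by blast
  have "(\<lambda>x. unif x * g x) = g" using supp01_outside[OF g(1)] by (auto simp: unif_def indicator_def fun_eq_iff)
  then have "equidist g" using equidist_integrable[OF supp01_integrable[OF g(1)]] by simp
  then have lim: "(\<lambda>k. (\<integral>x. g x * \<Phi> ((T_map \<gamma> ^^ k) x) \<partial>lborel) -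
           (\<integral>x. g x \<partial>lborel) * (\<integral>x. unif x * \<Phi> ((T_map \<gamma> ^^ k) x) \<partial>lborel)) \<longlonglongrightarrow> 0"
    using \<Phi> unfolding equidist_def by blast
  have "(\<integral>x. g x \<partial>lborel) = 1" using g(2)[of "\<lambda>_. 1"] by (simp add: \<nu>.prob_space)
  moreover have "(\<integral>x. g x * \<Phi> ((T_map \<gamma> ^^ k) x) \<partial>lborel) = (\<integral>x. \<Phi> x \<partial>\<nu>)" for k
    using g(2)[of "\<lambda>x. \<Phi> ((T_map \<gamma> ^^ k) x)"] nu_integral_pow[OF \<Phi>(1), of k] by simp
  ultimately have "(\<lambda>k. (\<integral>x. \<Phi> x \<partial>\<nu>) - (\<integral>x. unif x * \<Phi> ((T_map \<gamma> ^^ k) x) \<partial>lborel)) \<longlonglongrightarrow> 0"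
    using lim by simp
  from tendsto_diff[OF tendsto_const[of "\<integral>x. \<Phi> x \<partial>\<nu>"] this] show ?thesis by simp
qed

text \<open>Reduces intervals to the initial segments (0,t) treated by \<open>corr\<close>. The
  endpoints s and t are the infimum and supremum of the part of J in (0,1), and they are null for
  \<nu>.\<close>

lemma nu_interval_AE:
  assumes J: "is_interval (J :: real set)"
  shows "\<exists>s t. AE x in \<nu>. indicator J x = (indicator {0<..<t} x - indicator {0<..<s} x :: real)"
proof (cases "J \<inter> {0<..<1} = {}")
  case True
  have "AE x in \<nu>. indicator J x = (indicator {0<..<0} x - indicator {0<..<0} x :: real)"
    using nu_AE_01 by eventually_elim (use True in \<open>auto simp: indicator_def\<close>)
  then show ?thesis by blast
next
  case False
  define K where "K = J \<inter> {0<..<1}"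
  define s t where "s = Inf K" and "t = Sup K"
  have K: "K \<noteq> {}" "bdd_below K" "bdd_above K" using False by (auto simp: K_def)
  have "AE x in \<nu>. x \<noteq> s" "AE x in \<nu>. x \<noteq> t" by (auto intro!: nu_null AE_lborel_singleton)
  then have "AE x in \<nu>. indicator J x = (indicator {0<..<t} x - indicator {0<..<s} x :: real)"
    using nu_AE_01
  proof eventually_elim
    case (elim x)
    have st: "s \<le> t" using K cInf_le_cSup[OF K(1,3,2)] by (simp add: s_def t_def)
    have "x \<in> J \<longleftrightarrow> s < x \<and> x < t"
    proof
      assume "x \<in> J"
      then have "x \<in> K" using elim by (simp add: K_def)
      then show "s < x \<and> x < t"
        using cInf_lower[of x K] cSup_upper[of x K] K elim by (auto simp: s_def t_def)
    next
      assume "s < x \<and> x < t"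
      then obtain a b where "a \<in> K" "a < x" "b \<in> K" "x < b"
        using cInf_lessD[of K x] less_cSupD[of K x] K by (auto simp: s_def t_def)
      then show "x \<in> J" using J by (auto simp: K_def is_interval_1)
    qed
    then show ?case using elim st by (auto simp: indicator_def)
  qed
  then show ?thesis by blast
qed

text \<open>\<open>corr_decay\<close> holds for all densities L^k 1 with one constant. By
  \<open>lebesgue_to_nu\<close> each integral in the covariance converges as k grows, so the bound
  passes to \<nu>. The final constant is 2C because an interval is a difference of two initial
  segments.\<close>

lemma nu_correlation_decay:
  assumes \<kappa>: "0 < \<kappa>" "\<kappa> < 1"
  shows "\<exists>C>0. \<forall>J n \<Psi>. is_interval J \<longrightarrow> 0 < n \<longrightarrow> \<Psi> \<in> borel_measurable borel \<longrightarrow> (\<forall>x. \<bar>\<Psi> x\<bar> \<le> 1) \<longrightarrow>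
    \<bar>\<integral>x. (indicator J x - measure \<nu> J) * \<Psi> ((T_map \<gamma> ^^ n) x) \<partial>\<nu>\<bar> \<le>
      C * real n powr (- (\<kappa> * ((1 - \<gamma>) / \<gamma>)))"
proof -
  obtain C where C: "0 < C" "\<And>f t n. cone f \<Longrightarrow> (\<integral>x. f x \<partial>lborel) = 1 \<Longrightarrow> 0 < n \<Longrightarrow>
    (\<integral>x. \<bar>(L ^^ n) (corr f t) x\<bar> \<partial>lborel) \<le> C * real n powr (- (\<kappa> * ((1 - \<gamma>) / \<gamma>)))"
    using corr_decay[OF \<kappa>] by auto
  have basic: "\<bar>(\<integral>x. indicator {0<..<t} x * \<Psi> ((T_map \<gamma> ^^ n) x) \<partial>\<nu>) -
        (\<integral>x. indicator {0<..<t} x \<partial>\<nu>) * (\<integral>x. \<Psi> ((T_map \<gamma> ^^ n) x) \<partial>\<nu>)\<bar> \<le>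
      C * real n powr (- (\<kappa> * ((1 - \<gamma>) / \<gamma>)))"
    if n: "0 < n" and \<Psi>: "\<Psi> \<in> borel_measurable borel" "\<And>x. \<bar>\<Psi> x\<bar> \<le> 1" for n \<Psi> t
  proof -
    note [measurable] = \<Psi>(1)
    define \<Psi>' where "\<Psi>' x = \<Psi> ((T_map \<gamma> ^^ n) x)" for x
    have [measurable]: "\<Psi>' \<in> borel_measurable borel" unfolding \<Psi>'_def[abs_def] by simp
    have \<Psi>'1: "\<bar>\<Psi>' x\<bar> \<le> 1" for x using \<Psi> by (simp add: \<Psi>'_def)
    define f where "f k = (L ^^ k) unif" for k
    have f: "cone (f k)" "(\<integral>x. f k x \<partial>lborel) = 1" for k
      unfolding f_def by (auto intro!: cone_L_pow cone_unif simp: L_pow_mass supp01_unif)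
    have fs: "supp01 (f k)" for k using f[of k] by (auto simp: cone_def G_def)
    have fU: "(\<integral>x. f k x * \<Phi> x \<partial>lborel) = (\<integral>x. unif x * \<Phi> ((T_map \<gamma> ^^ k) x) \<partial>lborel)"
      if "\<Phi> \<in> borel_measurable borel" "\<And>x. \<bar>\<Phi> x\<bar> \<le> 1" for \<Phi> k
      unfolding f_def using that by (intro L_pow_duality[OF supp01_unif, of _ 1]) auto
    have lim: "(\<lambda>k. \<integral>x. f k x * \<Phi> x \<partial>lborel) \<longlonglongrightarrow> (\<integral>x. \<Phi> x \<partial>\<nu>)"
      if "\<Phi> \<in> borel_measurable borel" "\<And>x. \<bar>\<Phi> x\<bar> \<le> 1" for \<Phi>
      unfolding fU[OF that] by (rule lebesgue_to_nu[OF that])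
    have "\<bar>(\<integral>x. f k x * (indicator {0<..<t} x * \<Psi>' x) \<partial>lborel) -
       (\<integral>x. f k x * indicator {0<..<t} x \<partial>lborel) * (\<integral>x. f k x * \<Psi>' x \<partial>lborel)\<bar> \<le>
      C * real n powr (- (\<kappa> * ((1 - \<gamma>) / \<gamma>)))" (is "\<bar>?J k\<bar> \<le> _") for k
    proof -
      have s: "supp01 (\<lambda>x. f k x * indicator {0<..<t} x * \<Psi>' x)" "supp01 (\<lambda>x. f k x * \<Psi>' x)"
        by (intro supp01_mult[of _ _ 1] supp01_trunc fs \<Psi>'1; simp)+
      have "?J k = (\<integral>x. corr (f k) t x * \<Psi>' x \<partial>lborel)"
        unfolding corr_def left_diff_distrib mult.assoc[of _ "f k _"]
        using s by (subst Bochner_Integration.integral_diff) (auto simp: supp01_integrable mult.assoc)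
      also have "\<dots> = (\<integral>x. (L ^^ n) (corr (f k) t) x * \<Psi> x \<partial>lborel)"
        unfolding \<Psi>'_def using \<Psi> by (intro L_pow_duality[symmetric, of _ _ 1] supp01_corr fs) auto
      finally have "\<bar>?J k\<bar> \<le> (\<integral>x. \<bar>(L ^^ n) (corr (f k) t) x\<bar> \<partial>lborel)"
        using \<Psi> by (simp only:) (intro integral_abs_mult_le supp01_L_pow supp01_corr fs, auto)
      also have "\<dots> \<le> C * real n powr (- (\<kappa> * ((1 - \<gamma>) / \<gamma>)))"
        by (rule C(2)[OF f n])
      finally show ?thesis .
    qed
    moreover have "(\<lambda>k. \<bar>?J k\<bar>) \<longlonglongrightarrow> \<bar>(\<integral>x. indicator {0<..<t} x * \<Psi>' x \<partial>\<nu>) -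
        (\<integral>x. indicator {0<..<t} x \<partial>\<nu>) * (\<integral>x. \<Psi>' x \<partial>\<nu>)\<bar>"
      by (intro tendsto_rabs tendsto_diff tendsto_mult lim) (auto simp: \<Psi>'1 indicator_def)
    ultimately show ?thesis unfolding \<Psi>'_def[symmetric]
      using LIMSEQ_le_const2 by blast
  qed
  have "\<bar>\<integral>x. (indicator J x - measure \<nu> J) * \<Psi> ((T_map \<gamma> ^^ n) x) \<partial>\<nu>\<bar> \<le>
      2 * C * real n powr (- (\<kappa> * ((1 - \<gamma>) / \<gamma>)))"
    if J: "is_interval J" and n: "0 < n" and \<Psi>: "\<Psi> \<in> borel_measurable borel" "\<And>x. \<bar>\<Psi> x\<bar> \<le> 1" for n \<Psi> J
  proof -
    note [measurable] = \<Psi>(1)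
    define \<Psi>' where "\<Psi>' x = \<Psi> ((T_map \<gamma> ^^ n) x)" for x
    have [measurable]: "\<Psi>' \<in> borel_measurable borel" unfolding \<Psi>'_def[abs_def] by simp
    have \<Psi>'1: "\<bar>\<Psi>' x\<bar> \<le> 1" for x using \<Psi> by (simp add: \<Psi>'_def)
    have [measurable]: "J \<in> sets borel" using J by (rule real_interval_borel_measurable)
    obtain s t where st: "AE x in \<nu>. indicator J x = (indicator {0<..<t} x - indicator {0<..<s} x :: real)"
      using nu_interval_AE[OF J] by blast
    have ib: "integrable \<nu> (\<lambda>x. h x)" if "h \<in> borel_measurable borel" "\<And>x. \<bar>h x\<bar> \<le> 1" for h :: "real \<Rightarrow> real"
      using that by (intro \<nu>.integrable_const_bound[of _ 1]) (auto simp: measurable_cong_sets[OF sets_nu refl])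
    have i: "integrable \<nu> \<Psi>'" "integrable \<nu> (\<lambda>x. indicator {0<..<r} x :: real)"
      "integrable \<nu> (\<lambda>x. indicator {0<..<r} x * \<Psi>' x)" "integrable \<nu> (\<lambda>x. indicator J x * \<Psi>' x)" for r
      by (intro ib; auto simp: \<Psi>'1 indicator_def)+
    have "measure \<nu> J = (\<integral>x. indicator J x \<partial>\<nu>)" by (simp add: sets_nu space_nu)
    also have "\<dots> = (\<integral>x. indicator {0<..<t} x - indicator {0<..<s} x \<partial>\<nu>)"
      using st by (intro integral_cong_AE) auto
    finally have mJ: "measure \<nu> J = (\<integral>x. indicator {0<..<t} x \<partial>\<nu>) - (\<integral>x. indicator {0<..<s} x \<partial>\<nu>)"
      using i by (subst (asm) Bochner_Integration.integral_diff) auto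
    have "(\<integral>x. indicator J x * \<Psi>' x \<partial>\<nu>) = (\<integral>x. indicator {0<..<t} x * \<Psi>' x - indicator {0<..<s} x * \<Psi>' x \<partial>\<nu>)"
      by (rule integral_cong_AE) (use st in \<open>auto simp: left_diff_distrib[symmetric]\<close>)
    also have "\<dots> = (\<integral>x. indicator {0<..<t} x * \<Psi>' x \<partial>\<nu>) - (\<integral>x. indicator {0<..<s} x * \<Psi>' x \<partial>\<nu>)"
      using i by (intro Bochner_Integration.integral_diff)
    finally have 1: "(\<integral>x. indicator J x * \<Psi>' x \<partial>\<nu>) = \<dots>" .
    have "(\<integral>x. (indicator J x - measure \<nu> J) * \<Psi>' x \<partial>\<nu>) =
       (\<integral>x. indicator J x * \<Psi>' x \<partial>\<nu>) - measure \<nu> J * (\<integral>x. \<Psi>' x \<partial>\<nu>)"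
      using i by (simp add: left_diff_distrib)
    then show ?thesis
      using basic[OF n \<Psi>, of t] basic[OF n \<Psi>, of s] unfolding \<Psi>'_def[symmetric] 1 mJ
      by (simp add: left_diff_distrib)
  qed
  then show ?thesis using C(1) by (intro exI[of _ "2 * C"]) auto
qed

end
end

section \<open>Moment bounds for measure preserving maps\<close>

lemma powr_convex_combination:
  fixes a b s q :: real
  assumes q: "1 \<le> q" and ab: "0 \<le> a" "0 \<le> b" and s: "0 \<le> s" "s \<le> 1"
  shows "(s * a + (1 - s) * b) powr q \<le> s * a powr q + (1 - s) * b powr q"
proof -
  have *: "(c * x) powr q \<le> c * x powr q" if "0 \<le> c" "c \<le> 1" "0 \<le> x" for c x :: real
  proof -
    have "c powr q \<le> c powr 1" using that q by (intro powr_mono') auto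
    then have "c powr q * x powr q \<le> c * x powr q" using that by (intro mult_right_mono) auto
    then show ?thesis using that by (simp add: powr_mult)
  qed
  consider "a = 0" | "b = 0" | "0 < a" "0 < b" using ab by linarith
  then show ?thesis
  proof cases
    case 1 then show ?thesis using *[of "1 - s" b] ab s by simp
  next
    case 2 then show ?thesis using *[of s a] ab s by simp
  next
    case 3
    then show ?thesis
      using convex_onD[OF powr_convex[OF q], of "1 - s" a b] s by simp
  qed
qed

lemma powr_diff_le:
  fixes a b r :: real
  assumes "1 \<le> r" "0 < a" "0 < b" "a \<le> c" "b \<le> c"
  shows "\<bar>a powr r - b powr r\<bar> \<le> r * c powr (r - 1) * \<bar>a - b\<bar>"
proof -
  have *: "\<bar>y powr r - x powr r\<bar> \<le> r * c powr (r - 1) * \<bar>y - x\<bar>" if xy: "0 < x" "x < y" "y \<le> c" for x y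
  proof -
    have "\<exists>z>x. z < y \<and> y powr r - x powr r = (y - x) * (r * z powr (r - 1))"
      using xy by (intro MVT2) (auto intro!: derivative_eq_intros)
    then obtain z where z: "x < z" "z < y" "y powr r - x powr r = (y - x) * (r * z powr (r - 1))" by blast
    have "z powr (r - 1) \<le> c powr (r - 1)" using z xy assms by (intro powr_mono2) auto
    then have "(y - x) * (r * z powr (r - 1)) \<le> (y - x) * (r * c powr (r - 1))"
      using xy assms by (intro mult_left_mono) auto
    moreover have "0 \<le> (y - x) * (r * z powr (r - 1))" using xy assms by simp
    ultimately show ?thesis using xy z by (simp add: mult_ac)
  qed
  show ?thesis
    using *[of a b] *[of b a] assms by (cases a b rule: linorder_cases) (auto simp: abs_minus_commute)
qed

text \<open>For |d| \<le> x/2 this is a second-order Taylor bound, with all intermediate points at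
  most 2x. For larger |d| every term is at most a multiple of |d|^q, since x < 2|d|. Negative x
  follows by symmetry.\<close>

lemma powr_two_smooth:
  fixes q :: real
  assumes q: "2 \<le> q"
  shows "\<exists>C\<ge>1. \<forall>x d. \<bar>x + d\<bar> powr q \<le>
    \<bar>x\<bar> powr q + q * (sgn x * \<bar>x\<bar> powr (q - 1)) * d + C * (\<bar>x\<bar> powr (q - 2) * d\<^sup>2 + \<bar>d\<bar> powr q)"
proof -
  \<comment> \<open>3^q and q 2^(q-1) come from the case of large |d|, the last summand from the
    Taylor remainder, and 1 from x = 0.\<close>
  define C where "C = 1 + 3 powr q + q * 2 powr (q - 1) + q * (q - 1) * 2 powr (q - 2)"
  have Cp: "0 \<le> 3 powr q" "0 \<le> q * 2 powr (q - 1)" "0 \<le> q * (q - 1) * 2 powr (q - 2)" using q by auto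
  have pos: "\<bar>x + d\<bar> powr q \<le> \<bar>x\<bar> powr q + q * (sgn x * \<bar>x\<bar> powr (q - 1)) * d + C * (\<bar>x\<bar> powr (q - 2) * d\<^sup>2 + \<bar>d\<bar> powr q)"
    if x: "0 < x" for x d
  proof (cases "\<bar>d\<bar> \<le> x / 2")
    case True
    have xd: "0 < x + d" "x + d \<le> 2 * x" using x True by auto
    have key: "\<bar>(x + d) powr q - x powr q - q * x powr (q - 1) * d\<bar> \<le> q * (q - 1) * (2 * x) powr (q - 2) * d\<^sup>2"
    proof (cases "d = 0")
      case False
      obtain z where z: "0 < z" "z \<le> 2 * x" "\<bar>z - x\<bar> \<le> \<bar>d\<bar>" "(x + d) powr q - x powr q = d * (q * z powr (q - 1))"
      proof (cases "0 < d")
        case True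
        have "\<exists>z>x. z < x + d \<and> (x + d) powr q - x powr q = (x + d - x) * (q * z powr (q - 1))"
          using True x by (intro MVT2) (auto intro!: derivative_eq_intros)
        then obtain z where "x < z" "z < x + d" "(x + d) powr q - x powr q = (x + d - x) * (q * z powr (q - 1))"
          by blast
        then show ?thesis using xd True x by (intro that[of z]) auto
      next
        case dneg: False
        have "\<exists>z>x + d. z < x \<and> x powr q - (x + d) powr q = (x - (x + d)) * (q * z powr (q - 1))"
          using False dneg x xd by (intro MVT2) (auto intro!: derivative_eq_intros)
        then obtain z where "x + d < z" "z < x" "x powr q - (x + d) powr q = (x - (x + d)) * (q * z powr (q - 1))"
          by blast
        then show ?thesis using xd dneg x by (intro that[of z]) (auto simp: algebra_simps)
      qed
      have "\<bar>z powr (q - 1) - x powr (q - 1)\<bar> \<le> (q - 1) * (2 * x) powr (q - 1 - 1) * \<bar>z - x\<bar>"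
        using z x q by (intro powr_diff_le) auto
      also have "\<dots> \<le> (q - 1) * (2 * x) powr (q - 1 - 1) * \<bar>d\<bar>"
        using z q by (intro mult_left_mono) auto
      finally have 1: "\<bar>z powr (q - 1) - x powr (q - 1)\<bar> \<le> (q - 1) * (2 * x) powr (q - 2) * \<bar>d\<bar>" by simp
      have "(x + d) powr q - x powr q - q * x powr (q - 1) * d = q * d * (z powr (q - 1) - x powr (q - 1))"
        unfolding z(4) by (simp add: algebra_simps)
      then have "\<bar>(x + d) powr q - x powr q - q * x powr (q - 1) * d\<bar> = q * \<bar>d\<bar> * \<bar>z powr (q - 1) - x powr (q - 1)\<bar>"
        using q by (simp add: abs_mult)
      also have "\<dots> \<le> q * \<bar>d\<bar> * ((q - 1) * (2 * x) powr (q - 2) * \<bar>d\<bar>)"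
        using 1 q by (intro mult_left_mono) auto
      also have "\<dots> = q * (q - 1) * (2 * x) powr (q - 2) * (\<bar>d\<bar> * \<bar>d\<bar>)" by (simp only: mult_ac)
      also have "\<dots> = q * (q - 1) * (2 * x) powr (q - 2) * d\<^sup>2" by (simp add: power2_eq_square)
      finally show ?thesis .
    qed simp
    have "q * (q - 1) * (2 * x) powr (q - 2) * d\<^sup>2 = q * (q - 1) * 2 powr (q - 2) * (x powr (q - 2) * d\<^sup>2)"
      using x by (simp add: powr_mult)
    also have "\<dots> \<le> C * (x powr (q - 2) * d\<^sup>2 + \<bar>d\<bar> powr q)"
      using Cp by (intro mult_mono) (auto simp: C_def)
    finally show ?thesis using key x xd by (simp add: abs_le_iff)
  next
    case False
    have d0: "0 < \<bar>d\<bar>" using False x by linarith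
    have "\<bar>x + d\<bar> powr q \<le> (3 * \<bar>d\<bar>) powr q" using False x q by (intro powr_mono2) auto
    also have "\<dots> = 3 powr q * \<bar>d\<bar> powr q" by (simp add: powr_mult)
    finally have 1: "\<bar>x + d\<bar> powr q \<le> 3 powr q * \<bar>d\<bar> powr q" .
    have "- (q * x powr (q - 1) * d) \<le> q * x powr (q - 1) * \<bar>d\<bar>"
      using q mult_left_mono[of "-d" "\<bar>d\<bar>" "q * x powr (q - 1)"] by simp
    also have "\<dots> \<le> q * (2 * \<bar>d\<bar>) powr (q - 1) * \<bar>d\<bar>"
      using False x q by (intro mult_right_mono mult_left_mono powr_mono2) auto
    also have "\<dots> = q * 2 powr (q - 1) * (\<bar>d\<bar> * \<bar>d\<bar> powr (q - 1))" by (simp add: powr_mult)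
    also have "\<dots> = q * 2 powr (q - 1) * \<bar>d\<bar> powr q" using d0 by (simp add: powr_mult_base)
    finally have 2: "- (q * x powr (q - 1) * d) \<le> q * 2 powr (q - 1) * \<bar>d\<bar> powr q" .
    have "(3 powr q + q * 2 powr (q - 1)) * \<bar>d\<bar> powr q \<le> C * (x powr (q - 2) * d\<^sup>2 + \<bar>d\<bar> powr q)"
      using Cp by (intro mult_mono) (auto simp: C_def)
    then have "3 powr q * \<bar>d\<bar> powr q + q * 2 powr (q - 1) * \<bar>d\<bar> powr q \<le> C * (x powr (q - 2) * d\<^sup>2 + \<bar>d\<bar> powr q)"
      by (simp only: distrib_right)
    moreover have "q * (sgn x * \<bar>x\<bar> powr (q - 1)) * d = q * x powr (q - 1) * d" "\<bar>x\<bar> = x" "0 \<le> x powr q"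
      using x by auto
    ultimately show ?thesis using 1 2 by (simp only:)
  qed
  have "\<bar>x + d\<bar> powr q \<le> \<bar>x\<bar> powr q + q * (sgn x * \<bar>x\<bar> powr (q - 1)) * d + C * (\<bar>x\<bar> powr (q - 2) * d\<^sup>2 + \<bar>d\<bar> powr q)" for x d
  proof (cases x "0::real" rule: linorder_cases)
    case less
    then show ?thesis using pos[of "-x" "-d"] by (simp add: abs_minus_commute add.commute)
  next
    case equal
    have "1 * \<bar>d\<bar> powr q \<le> C * \<bar>d\<bar> powr q" using Cp by (intro mult_right_mono) (auto simp: C_def)
    then show ?thesis using equal by simp
  qed (rule pos)
  moreover have "1 \<le> C" using Cp by (simp add: C_def)
  ultimately show ?thesis by blast
qed

section \<open>L^q bounds for a measure preserving map\<close>

locale mpt = prob_space M for M :: "'a measure" +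
  fixes T :: "'a \<Rightarrow> 'a" and q :: real
  assumes T_measurable [measurable]: "T \<in> measurable M M"
    and T_distr: "distr M M T = M"
    and q2: "2 \<le> q"
begin

text \<open>A bound A on the L^q norm. Integrability is included since a Bochner integral may be 0
  by default; stating the bound as an argument turns Minkowski's inequality into addition.\<close>

definition Lqb :: "('a \<Rightarrow> real) \<Rightarrow> real \<Rightarrow> bool" where
  "Lqb f A \<longleftrightarrow> f \<in> borel_measurable M \<and> integrable M (\<lambda>x. \<bar>f x\<bar> powr q) \<and>
     (\<integral>x. \<bar>f x\<bar> powr q \<partial>M) \<le> A powr q"

definition bdd :: "('a \<Rightarrow> real) \<Rightarrow> bool" where
  "bdd f \<longleftrightarrow> f \<in> borel_measurable M \<and> (\<exists>B. \<forall>x. \<bar>f x\<bar> \<le> B)"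

lemma bdd_measurable: "bdd f \<Longrightarrow> f \<in> borel_measurable M"
  by (simp add: bdd_def)

lemma bddI: "f \<in> borel_measurable M \<Longrightarrow> (\<And>x. \<bar>f x\<bar> \<le> B) \<Longrightarrow> bdd f"
  by (auto simp: bdd_def)

lemma bdd_integrable: "bdd f \<Longrightarrow> integrable M f"
  unfolding bdd_def by (metis AE_I2 integrable_const_bound real_norm_def)

lemma bdd_const: "bdd (\<lambda>x. c)"
  by (rule bddI[of _ "\<bar>c\<bar>"]) auto

lemma bdd_add: assumes "bdd f" "bdd g" shows "bdd (\<lambda>x. f x + g x)"
proof -
  obtain a b where "\<forall>x. \<bar>f x\<bar> \<le> a" "\<forall>x. \<bar>g x\<bar> \<le> b" using assms by (auto simp: bdd_def)
  then have "\<bar>f x + g x\<bar> \<le> a + b" for x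
    using abs_triangle_ineq[of "f x" "g x"] by (meson add_mono order_trans)
  then show ?thesis using assms by (intro bddI[of _ "a + b"]) (auto simp: bdd_def)
qed

lemma bdd_mult: assumes "bdd f" "bdd g" shows "bdd (\<lambda>x. f x * g x)"
proof -
  obtain a b where ab: "\<forall>x. \<bar>f x\<bar> \<le> a" "\<forall>x. \<bar>g x\<bar> \<le> b" using assms by (auto simp: bdd_def)
  have "\<bar>f x * g x\<bar> \<le> \<bar>a\<bar> * \<bar>b\<bar>" for x
    unfolding abs_mult using ab[rule_format, of x] by (intro mult_mono) auto
  then show ?thesis using assms by (intro bddI[of _ "\<bar>a\<bar> * \<bar>b\<bar>"]) (auto simp: bdd_def)
qed

lemma bdd_diff: "bdd f \<Longrightarrow> bdd g \<Longrightarrow> bdd (\<lambda>x. f x - g x)"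
  using bdd_add[of f "\<lambda>x. (-1) * g x"] bdd_mult[OF bdd_const[of "-1"], of g] by simp

lemma bdd_sum: "(\<And>i. i \<in> I \<Longrightarrow> bdd (f i)) \<Longrightarrow> bdd (\<lambda>x. \<Sum>i\<in>I. f i x)"
  by (induction I rule: infinite_finite_induct) (auto intro: bdd_add bdd_const)

lemma bdd_powr: assumes "bdd f" "0 \<le> r" shows "bdd (\<lambda>x. \<bar>f x\<bar> powr r)"
proof -
  obtain a where a: "\<forall>x. \<bar>f x\<bar> \<le> a" using assms by (auto simp: bdd_def)
  have "\<bar>\<bar>f x\<bar> powr r\<bar> \<le> a powr r" for x
    using a assms by (auto intro!: powr_mono2)
  then show ?thesis using assms by (intro bddI[of _ "a powr r"]) (auto simp: bdd_def)
qed

lemma bdd_sgn: "bdd f \<Longrightarrow> bdd (\<lambda>x. sgn (f x))"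
  by (rule bddI[of _ 1]) (auto simp: bdd_def abs_sgn_eq)

lemma bdd_comp: "\<tau> \<in> measurable M M \<Longrightarrow> bdd f \<Longrightarrow> bdd (\<lambda>x. f (\<tau> x))"
  unfolding bdd_def by (auto intro: measurable_compose)

lemma Lqb_bdd: "bdd f \<Longrightarrow> (\<integral>x. \<bar>f x\<bar> powr q \<partial>M) \<le> A powr q \<Longrightarrow> Lqb f A"
  using bdd_integrable[OF bdd_powr[of f q]] q2 by (auto simp: Lqb_def bdd_def)

lemma Lqb_mono: "Lqb f A \<Longrightarrow> 0 \<le> A \<Longrightarrow> A \<le> B \<Longrightarrow> Lqb f B"
  using powr_mono2[of q A B] q2 by (auto simp: Lqb_def)

text \<open>Minkowski's inequality, by convexity of the q-th power with weights A/(A + B) and B/(A +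
  B) at the points |f|/A and |g|/B.\<close>

lemma Lqb_add:
  assumes f: "Lqb f A" "0 < A" and g: "Lqb g B" "0 < B"
  shows "Lqb (\<lambda>x. f x + g x) (A + B)"
proof -
  have [measurable]: "f \<in> borel_measurable M" "g \<in> borel_measurable M" using f g by (auto simp: Lqb_def)
  define s where "s = A / (A + B)"
  have s: "0 \<le> s" "s \<le> 1" "1 - s = B / (A + B)" using f g by (auto simp: s_def field_simps)
  define c1 c2 where "c1 = (A + B) powr q * s / A powr q" and "c2 = (A + B) powr q * (1 - s) / B powr q"
  have pw: "\<bar>f x + g x\<bar> powr q \<le> c1 * \<bar>f x\<bar> powr q + c2 * \<bar>g x\<bar> powr q" for x
  proof -
    have "\<bar>f x + g x\<bar> powr q \<le> (\<bar>f x\<bar> + \<bar>g x\<bar>) powr q" using q2 by (intro powr_mono2) auto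
    also have "\<dots> = ((A + B) * (s * (\<bar>f x\<bar> / A) + (1 - s) * (\<bar>g x\<bar> / B))) powr q"
    proof -
      have "(A + B) * s = A" "(A + B) * (1 - s) = B" using f g unfolding s(3) by (auto simp: s_def)
      then have "(A + B) * (s * (\<bar>f x\<bar> / A) + (1 - s) * (\<bar>g x\<bar> / B)) = A * (\<bar>f x\<bar> / A) + B * (\<bar>g x\<bar> / B)"
        by (simp only: distrib_left mult.assoc[symmetric])
      then show ?thesis using f g by simp
    qed
    also have "\<dots> = (A + B) powr q * (s * (\<bar>f x\<bar> / A) + (1 - s) * (\<bar>g x\<bar> / B)) powr q"
      using f g s by (intro powr_mult)
    also have "\<dots> \<le> (A + B) powr q * (s * (\<bar>f x\<bar> / A) powr q + (1 - s) * (\<bar>g x\<bar> / B) powr q)"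
      using f g s q2 by (intro mult_left_mono powr_convex_combination) auto
    also have "\<dots> = c1 * \<bar>f x\<bar> powr q + c2 * \<bar>g x\<bar> powr q"
      using f g by (simp add: c1_def c2_def powr_divide field_simps)
    finally show ?thesis .
  qed
  have i: "integrable M (\<lambda>x. c1 * \<bar>f x\<bar> powr q + c2 * \<bar>g x\<bar> powr q)"
    using f g by (auto simp: Lqb_def)
  have c: "0 \<le> c1" "0 \<le> c2" using s f g by (auto simp: c1_def c2_def)
  have i2: "integrable M (\<lambda>x. \<bar>f x + g x\<bar> powr q)"
    by (rule Bochner_Integration.integrable_bound[OF i])
      (use pw c in \<open>auto intro!: AE_I2 simp: abs_of_nonneg\<close>)
  have "(\<integral>x. \<bar>f x + g x\<bar> powr q \<partial>M) \<le> (\<integral>x. c1 * \<bar>f x\<bar> powr q + c2 * \<bar>g x\<bar> powr q \<partial>M)"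
    by (rule integral_mono[OF i2 i pw])
  also have "\<dots> = c1 * (\<integral>x. \<bar>f x\<bar> powr q \<partial>M) + c2 * (\<integral>x. \<bar>g x\<bar> powr q \<partial>M)"
    using f g by (simp add: Lqb_def)
  also have "\<dots> \<le> c1 * A powr q + c2 * B powr q"
    using f g c by (intro add_mono mult_left_mono) (auto simp: Lqb_def)
  also have "\<dots> = (A + B) powr q * s + (A + B) powr q * (1 - s)"
    using f g by (simp add: c1_def c2_def)
  also have "\<dots> = (A + B) powr q" by (simp add: distrib_left[symmetric])
  finally show ?thesis using i2 by (simp add: Lqb_def)
qed

lemma Lqb_scale:
  assumes "Lqb f A" "0 < A" "\<bar>c\<bar> \<le> d"
  shows "Lqb (\<lambda>x. c * f x) (d * A)"
proof -
  have "(\<integral>x. \<bar>c * f x\<bar> powr q \<partial>M) = \<bar>c\<bar> powr q * (\<integral>x. \<bar>f x\<bar> powr q \<partial>M)"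
    by (simp add: abs_mult powr_mult)
  also have "\<dots> \<le> d powr q * A powr q"
    using assms q2 by (intro mult_mono powr_mono2) (auto simp: Lqb_def)
  also have "\<dots> = (d * A) powr q" using assms by (simp add: powr_mult)
  finally show ?thesis using assms by (auto simp: Lqb_def abs_mult powr_mult)
qed

lemma Lqb_diff: "Lqb f A \<Longrightarrow> 0 < A \<Longrightarrow> Lqb g B \<Longrightarrow> 0 < B \<Longrightarrow> Lqb (\<lambda>x. f x - g x) (A + B)"
  using Lqb_add[of f A "\<lambda>x. (-1) * g x" B] Lqb_scale[of g B "-1" 1] by simp

lemma Lqb_sum:
  assumes "finite I" "I \<noteq> {}" "\<And>i. i \<in> I \<Longrightarrow> Lqb (f i) (A i)" "\<And>i. i \<in> I \<Longrightarrow> 0 < A i"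
  shows "Lqb (\<lambda>x. \<Sum>i\<in>I. f i x) (\<Sum>i\<in>I. A i)"
  using assms
proof (induction I rule: finite_ne_induct)
  case (insert i I)
  have "Lqb (\<lambda>x. f i x + (\<Sum>i\<in>I. f i x)) (A i + (\<Sum>i\<in>I. A i))"
    using insert by (intro Lqb_add insert.IH sum_pos) auto
  then show ?case using insert by simp
qed simp

lemma pow_measurable [measurable]: "(T ^^ n) \<in> measurable M M"
proof (induction n)
  case (Suc n)
  then show ?case using measurable_comp[OF Suc T_measurable] by simp
qed (simp add: id_def)

lemma pow_distr: "distr M M (T ^^ n) = M"
proof (induction n)
  case (Suc n)
  have "distr M M (T \<circ> T ^^ n) = distr (distr M M (T ^^ n)) M T"
    by (rule distr_distr[symmetric]) auto
  then show ?case by (simp only: funpow.simps Suc T_distr)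
qed (simp add: id_def distr_id)

lemma integral_pow:
  fixes f :: "'a \<Rightarrow> real"
  assumes [measurable]: "f \<in> borel_measurable M"
  shows "(\<integral>x. f ((T ^^ n) x) \<partial>M) = (\<integral>x. f x \<partial>M)"
  by (subst (2) pow_distr[of n, symmetric], subst integral_distr) auto

lemma Lqb_pow:
  assumes f: "Lqb f A" shows "Lqb (\<lambda>x. f ((T ^^ n) x)) A"
proof -
  have [measurable]: "f \<in> borel_measurable M" using f by (simp add: Lqb_def)
  have "integrable (distr M M (T ^^ n)) (\<lambda>x. \<bar>f x\<bar> powr q)"
    unfolding pow_distr using f by (simp add: Lqb_def)
  then have "integrable M (\<lambda>x. \<bar>f ((T ^^ n) x)\<bar> powr q)"
    by (subst (asm) integrable_distr_eq) auto
  then show ?thesis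
    using f integral_pow[of "\<lambda>x. \<bar>f x\<bar> powr q" n] by (auto simp: Lqb_def)
qed

text \<open>Two-smoothness of \<open>L\<^sup>q\<close>: norms of martingale differences add up in square.\<close>
definition smooth_const :: "real \<Rightarrow> bool" where
  "smooth_const K \<longleftrightarrow> 1 \<le> K \<and> (\<forall>X D A B. bdd X \<longrightarrow> bdd D \<longrightarrow> 0 < A \<longrightarrow> 0 < B \<longrightarrow> Lqb X A \<longrightarrow> Lqb D B \<longrightarrow>
     (\<integral>x. (sgn (X x) * \<bar>X x\<bar> powr (q - 1)) * D x \<partial>M) = 0 \<longrightarrow>
     Lqb (\<lambda>x. X x + D x) (sqrt (A\<^sup>2 + K * B\<^sup>2)))"

text \<open>Integrate the expansion of \<open>powr_two_smooth\<close>; the linear term vanishes by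
  hypothesis. The mixed term is controlled by u^(q-2) v^2 \<le> u^q + v^q with u = |X|/A and v =
  |D|/B. This leaves A^q + C (2 A^(q-2) B^2 + B^q) to be compared with (A^2 + K B^2)^(q/2).\<close>

lemma smooth_const_exists: "\<exists>K. smooth_const K"
proof -
  obtain C where C: "1 \<le> C" "\<And>x d. \<bar>x + d\<bar> powr q \<le>
    \<bar>x\<bar> powr q + q * (sgn x * \<bar>x\<bar> powr (q - 1)) * d + C * (\<bar>x\<bar> powr (q - 2) * d\<^sup>2 + \<bar>d\<bar> powr q)"
    using powr_two_smooth[OF q2] by blast
  define K where "K = 1 + 3 * C"
  have "Lqb (\<lambda>x. X x + D x) (sqrt (A\<^sup>2 + K * B\<^sup>2))"
    if bd: "bdd X" "bdd D" and AB: "0 < A" "0 < B" and L: "Lqb X A" "Lqb D B"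
      and orth: "(\<integral>x. (sgn (X x) * \<bar>X x\<bar> powr (q - 1)) * D x \<partial>M) = 0" for X D A B
  proof (rule Lqb_bdd[OF bdd_add[OF bd]])
    have i1: "integrable M (\<lambda>x. \<bar>X x\<bar> powr q)" "integrable M (\<lambda>x. \<bar>D x\<bar> powr q)"
      using L by (auto simp: Lqb_def)
    have i2: "integrable M (\<lambda>x. (sgn (X x) * \<bar>X x\<bar> powr (q - 1)) * D x)"
      using q2 by (intro bdd_integrable bdd_mult bdd_sgn bdd_powr bd) auto
    have i3: "integrable M (\<lambda>x. \<bar>X x\<bar> powr (q - 2) * (D x)\<^sup>2)"
      unfolding power2_eq_square using q2 by (intro bdd_integrable bdd_mult bdd_powr bd) auto
    have i4: "integrable M (\<lambda>x. \<bar>X x + D x\<bar> powr q)"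
      using q2 by (intro bdd_integrable bdd_powr bdd_add bd) auto
    have sqrp: "(Z\<^sup>2) powr (q / 2) = Z powr q" if "0 < Z" for Z :: real
      using that powr_powr[of Z 2 "q / 2"] by simp
    have holder: "(\<integral>x. \<bar>X x\<bar> powr (q - 2) * (D x)\<^sup>2 \<partial>M) \<le> 2 * (A powr (q - 2) * B\<^sup>2)"
    proof -
      have pw: "\<bar>X x\<bar> powr (q - 2) * (D x)\<^sup>2 \<le>
        A powr (q - 2) * B\<^sup>2 / A powr q * \<bar>X x\<bar> powr q + A powr (q - 2) * B\<^sup>2 / B powr q * \<bar>D x\<bar> powr q" for x
      proof -
        define u v where "u = \<bar>X x\<bar> / A" and "v = \<bar>D x\<bar> / B"
        have uv: "0 \<le> u" "0 \<le> v" using AB by (auto simp: u_def v_def)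
        have "u powr (q - 2) * v\<^sup>2 \<le> u powr q + v powr q"
        proof (cases "u \<le> v")
          case True
          show ?thesis
          proof (cases "v = 0")
            case False
            have "u powr (q - 2) * v\<^sup>2 \<le> v powr (q - 2) * v\<^sup>2"
              using True uv q2 by (intro mult_right_mono powr_mono2) auto
            also have "\<dots> = v powr q" using uv False by (simp add: powr_diff)
            finally show ?thesis by (simp add: add_increasing)
          qed simp
        next
          case False
          have "u powr (q - 2) * v\<^sup>2 \<le> u powr (q - 2) * u\<^sup>2"
            using False uv by (intro mult_left_mono power_mono) auto
          also have "\<dots> = u powr q" using uv False by (simp add: powr_diff)
          finally show ?thesis by (simp add: add_increasing2)
        qed
        then have "A powr (q - 2) * B\<^sup>2 * (u powr (q - 2) * v\<^sup>2) \<le> A powr (q - 2) * B\<^sup>2 * (u powr q + v powr q)"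
          by (intro mult_left_mono) auto
        moreover have "A powr (q - 2) * B\<^sup>2 * (u powr (q - 2) * v\<^sup>2) = \<bar>X x\<bar> powr (q - 2) * (D x)\<^sup>2"
          using AB by (simp add: u_def v_def powr_divide power_divide)
        moreover have "A powr (q - 2) * B\<^sup>2 * (u powr q + v powr q) =
          A powr (q - 2) * B\<^sup>2 / A powr q * \<bar>X x\<bar> powr q + A powr (q - 2) * B\<^sup>2 / B powr q * \<bar>D x\<bar> powr q"
          using AB by (simp add: u_def v_def powr_divide distrib_left)
        ultimately show ?thesis by simp
      qed
      have "(\<integral>x. \<bar>X x\<bar> powr (q - 2) * (D x)\<^sup>2 \<partial>M) \<le>
         (\<integral>x. A powr (q - 2) * B\<^sup>2 / A powr q * \<bar>X x\<bar> powr q + A powr (q - 2) * B\<^sup>2 / B powr q * \<bar>D x\<bar> powr q \<partial>M)"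
        using i1 by (intro integral_mono i3 pw) auto
      also have "\<dots> = A powr (q - 2) * B\<^sup>2 / A powr q * (\<integral>x. \<bar>X x\<bar> powr q \<partial>M) +
          A powr (q - 2) * B\<^sup>2 / B powr q * (\<integral>x. \<bar>D x\<bar> powr q \<partial>M)"
        using i1 by simp
      also have "\<dots> \<le> A powr (q - 2) * B\<^sup>2 / A powr q * A powr q + A powr (q - 2) * B\<^sup>2 / B powr q * B powr q"
        using L by (intro add_mono mult_left_mono) (auto simp: Lqb_def)
      also have "\<dots> = 2 * (A powr (q - 2) * B\<^sup>2)" using AB by simp
      finally show ?thesis .
    qed
    have "(\<integral>x. \<bar>X x + D x\<bar> powr q \<partial>M) \<le>
      (\<integral>x. \<bar>X x\<bar> powr q + q * ((sgn (X x) * \<bar>X x\<bar> powr (q - 1)) * D x) + C * (\<bar>X x\<bar> powr (q - 2) * (D x)\<^sup>2 + \<bar>D x\<bar> powr q) \<partial>M)"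
      using C(2) by (intro integral_mono i4 Bochner_Integration.integrable_add integrable_mult_right i1 i2 i3) (simp add: mult.assoc)
    also have "\<dots> = (\<integral>x. \<bar>X x\<bar> powr q \<partial>M) + C * ((\<integral>x. \<bar>X x\<bar> powr (q - 2) * (D x)\<^sup>2 \<partial>M) + (\<integral>x. \<bar>D x\<bar> powr q \<partial>M))"
      using i1 i2 i3 orth by simp
    also have "\<dots> \<le> A powr q + C * (2 * (A powr (q - 2) * B\<^sup>2) + B powr q)"
      using L holder C by (intro add_mono mult_left_mono) (auto simp: Lqb_def)
    also have "\<dots> \<le> (A\<^sup>2 + K * B\<^sup>2) powr (q / 2)"
    \<comment> \<open>For B \<le> A one factors out A^q and uses 1 + z \<le> (1 + z)^(q/2), which
      needs q \<ge> 2. Otherwise everything is at most K B^q.\<close>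
    proof (cases "B \<le> A")
      case True
      define r where "r = B / A"
      have r: "0 < r" "r \<le> 1" "B = A * r" using True AB by (auto simp: r_def)
      have "A powr (q - 2) * B\<^sup>2 = A powr q * r\<^sup>2"
        using AB r by (simp add: powr_diff power_mult_distrib)
      moreover have "B powr q \<le> A powr q * r\<^sup>2"
      proof -
        have "B powr q = A powr q * r powr q" using AB r by (simp add: powr_mult)
        also have "\<dots> \<le> A powr q * r powr 2" using r q2 by (intro mult_left_mono powr_mono') auto
        finally show ?thesis using r AB by simp
      qed
      ultimately have "C * (2 * (A powr (q - 2) * B\<^sup>2) + B powr q) \<le> C * (2 * (A powr q * r\<^sup>2) + A powr q * r\<^sup>2)"
        using C by (intro mult_left_mono add_mono) auto
      then have "A powr q + C * (2 * (A powr (q - 2) * B\<^sup>2) + B powr q) \<le> A powr q * (1 + 3 * C * r\<^sup>2)"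
        by (simp add: algebra_simps)
      also have "\<dots> \<le> A powr q * (1 + K * r\<^sup>2)"
        using C by (intro mult_left_mono) (auto simp: K_def algebra_simps)
      also have "\<dots> \<le> A powr q * (1 + K * r\<^sup>2) powr (q / 2)"
        using C q2 powr_mono[of 1 "q / 2" "1 + K * r\<^sup>2"] by (intro mult_left_mono) (simp_all add: K_def)
      also have "\<dots> = (A\<^sup>2) powr (q / 2) * (1 + K * r\<^sup>2) powr (q / 2)"
        by (simp only: sqrp[OF AB(1)])
      also have "\<dots> = (A\<^sup>2 * (1 + K * r\<^sup>2)) powr (q / 2)"
        using C by (subst powr_mult) (auto simp: K_def)
      also have "A\<^sup>2 * (1 + K * r\<^sup>2) = A\<^sup>2 + K * B\<^sup>2" using r by (simp add: algebra_simps)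
      finally show ?thesis .
    next
      case False
      have "A powr (q - 2) * B\<^sup>2 \<le> B powr (q - 2) * B\<^sup>2"
        using False AB q2 by (intro mult_right_mono powr_mono2) auto
      also have "\<dots> = B powr q" using AB by (simp add: powr_diff)
      finally have "C * (2 * (A powr (q - 2) * B\<^sup>2) + B powr q) \<le> C * (2 * B powr q + B powr q)"
        using C by (intro mult_left_mono add_mono) auto
      moreover have "A powr q \<le> B powr q" using False AB q2 by (intro powr_mono2) auto
      ultimately have "A powr q + C * (2 * (A powr (q - 2) * B\<^sup>2) + B powr q) \<le> B powr q * K"
        by (simp add: K_def algebra_simps)
      also have "\<dots> \<le> B powr q * K powr (q / 2)"
        using C q2 powr_mono[of 1 "q / 2" K] by (intro mult_left_mono) (auto simp: K_def)
      also have "\<dots> = (B\<^sup>2) powr (q / 2) * K powr (q / 2)" by (simp only: sqrp[OF AB(2)])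
      also have "\<dots> = (B\<^sup>2 * K) powr (q / 2)"
        using C by (subst powr_mult) (auto simp: K_def)
      also have "\<dots> \<le> (A\<^sup>2 + K * B\<^sup>2) powr (q / 2)"
        using q2 C by (intro powr_mono2) (auto simp: K_def)
      finally show ?thesis .
    qed
    also have "\<dots> = sqrt (A\<^sup>2 + K * B\<^sup>2) powr q"
      using C AB by (simp add: powr_half_sqrt[symmetric] powr_powr K_def add_nonneg_nonneg)
    finally show "(\<integral>x. \<bar>X x + D x\<bar> powr q \<partial>M) \<le> sqrt (A\<^sup>2 + K * B\<^sup>2) powr q" .
  qed
  moreover have "1 \<le> K" using C by (simp add: K_def)
  ultimately show ?thesis unfolding smooth_const_def by blast
qed

text \<open>That is, k composed with \<open>T\<^sup>n\<close> is the conditional expectation of f given \<open>T\<^sup>n\<close>.\<close>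
definition is_dual :: "nat \<Rightarrow> ('a \<Rightarrow> real) \<Rightarrow> ('a \<Rightarrow> real) \<Rightarrow> bool" where
  "is_dual n f k \<longleftrightarrow> bdd k \<and>
     (\<forall>g. bdd g \<longrightarrow> (\<integral>x. k x * g x \<partial>M) = (\<integral>x. f x * g ((T ^^ n) x) \<partial>M))"

text \<open>f + 1 is the density of a measure; let r be the Radon-Nikodym density of its image under
  T^n, which exists because T^n preserves null sets. Then k is r - 1, and f + 1 \<le> 2 gives r
  \<le> 2 almost everywhere. Cutting at 2 makes |k| \<le> 1 hold everywhere.\<close>

lemma dual_exists:
  assumes f[measurable]: "f \<in> borel_measurable M" and f1: "\<And>x. \<bar>f x\<bar> \<le> 1"
  shows "\<exists>k. is_dual n f k \<and> (\<forall>x. \<bar>k x\<bar> \<le> 1)"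
proof -
  have bf: "bdd f" by (rule bddI[OF f f1])
  define N where "N = distr (density M (\<lambda>x. ennreal (f x + 1))) M (T ^^ n)"
  have sN [measurable_cong, simp]: "sets N = sets M" by (simp add: N_def)
  have f0: "0 \<le> f x + 1" for x using f1[of x] by linarith
  have intN: "(\<integral>x. g x \<partial>N) = (\<integral>x. (f x + 1) * g ((T ^^ n) x) \<partial>M)" if [measurable]: "g \<in> borel_measurable M" for g :: "'a \<Rightarrow> real"
    unfolding N_def
    by (subst integral_distr, simp, simp, subst integral_density) (auto simp: f0)
  have ac: "absolutely_continuous M N"
  proof -
    have "emeasure N A = 0" if A: "A \<in> null_sets M" for A
    proof -
      have [measurable]: "A \<in> sets M" using A by auto
      have "emeasure M ((T ^^ n) -` A \<inter> space M) = emeasure (distr M M (T ^^ n)) A"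
        by (subst emeasure_distr) auto
      then have "(T ^^ n) -` A \<inter> space M \<in> null_sets M"
        using A by (auto simp: pow_distr null_sets_def)
      then have "(T ^^ n) -` A \<inter> space M \<in> null_sets (density M (\<lambda>x. ennreal (f x + 1)))"
        using absolutely_continuousI_density[of "\<lambda>x. ennreal (f x + 1)" M] f
        by (auto simp: absolutely_continuous_def)
      then show ?thesis unfolding N_def by (subst emeasure_distr) auto
    qed
    then show ?thesis by (auto simp: absolutely_continuous_def null_sets_def)
  qed
  have finN: "finite_measure N"
  proof
    have "emeasure N (space N) = emeasure (density M (\<lambda>x. ennreal (f x + 1))) ((T ^^ n) -` space M \<inter> space M)"
      unfolding N_def by (subst emeasure_distr) auto
    also have "\<dots> = (\<integral>\<^sup>+x. ennreal (f x + 1) * indicator ((T ^^ n) -` space M \<inter> space M) x \<partial>M)"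
      by (intro emeasure_density) auto
    also have "\<dots> \<le> (\<integral>\<^sup>+x. 2 \<partial>M)"
    proof (intro nn_integral_mono)
      fix x
      have "ennreal (f x + 1) \<le> 2" using f1[of x] ennreal_leI[of "f x + 1" 2] by simp
      then show "ennreal (f x + 1) * indicator ((T ^^ n) -` space M \<inter> space M) x \<le> 2"
        by (auto simp: indicator_def)
    qed
    also have "\<dots> < \<infinity>" by (simp add: emeasure_space_1)
    finally show "emeasure N (space N) \<noteq> \<infinity>" by simp
  qed
  define h where "h = RN_deriv M N"
  have [measurable]: "h \<in> borel_measurable M" unfolding h_def by simp
  have dh: "density M h = N" unfolding h_def by (rule density_RN_deriv[OF ac]) simp
  have fin: "AE x in M. h x \<noteq> \<infinity>"
    unfolding h_def by (rule RN_deriv_finite[OF _ ac]) (auto intro: finite_measure.axioms(1) finN)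
  define r where "r x = enn2real (h x)" for x
  have [measurable]: "r \<in> borel_measurable M" unfolding r_def by measurable
  have r0: "0 \<le> r x" for x by (simp add: r_def)
  have dr: "density M (\<lambda>x. ennreal (r x)) = N"
  proof -
    have "AE x in M. ennreal (r x) = h x"
      using fin by eventually_elim (simp add: r_def less_top)
    then have "density M (\<lambda>x. ennreal (r x)) = density M h" by (intro density_cong) auto
    then show ?thesis by (simp add: dh)
  qed
  have rN: "(\<integral>x. g x \<partial>N) = (\<integral>x. r x * g x \<partial>M)" if [measurable]: "g \<in> borel_measurable M" for g :: "'a \<Rightarrow> real"
    unfolding dr[symmetric] by (subst integral_density) (auto simp: r0)
  have ir: "integrable M r"
  proof -
    interpret N: finite_measure N by fact
    have "integrable N (\<lambda>x. 1::real)" by simp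
    then show ?thesis unfolding dr[symmetric] by (subst (asm) integrable_density) (auto simp: r0)
  qed
  have r2: "AE x in M. r x \<le> 2"
  proof -
    \<comment> \<open>Tested against the indicator of {r > 2}, the function r - 2 has integral at
      most 0 by duality, while the product is pointwise non-negative.\<close>
    define g where "g = (\<lambda>x. indicator {x. 2 < r x} x :: real)"
    have gm [measurable]: "g \<in> borel_measurable M" unfolding g_def by measurable
    have bg: "bdd g" by (rule bddI[of _ 1]) (auto simp: g_def indicator_def)
    have irg: "integrable M (\<lambda>x. r x * g x)"
      by (rule Bochner_Integration.integrable_bound[OF ir]) (auto simp: g_def indicator_def)
    have "(\<integral>x. r x * g x \<partial>M) = (\<integral>x. (f x + 1) * g ((T ^^ n) x) \<partial>M)"
      using rN[OF gm] intN[OF gm] by simp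
    also have "\<dots> \<le> (\<integral>x. 2 * g ((T ^^ n) x) \<partial>M)"
    proof (rule integral_mono)
      show "integrable M (\<lambda>x. (f x + 1) * g ((T ^^ n) x))"
        by (intro bdd_integrable bdd_mult bdd_add bdd_const bf bdd_comp[OF pow_measurable bg])
      show "integrable M (\<lambda>x. 2 * g ((T ^^ n) x))"
        by (intro bdd_integrable bdd_mult bdd_const bdd_comp[OF pow_measurable bg])
      show "(f x + 1) * g ((T ^^ n) x) \<le> 2 * g ((T ^^ n) x)" for x
        using f1[of x] by (intro mult_right_mono) (auto simp: g_def)
    qed
    also have "\<dots> = (\<integral>x. 2 * g x \<partial>M)" using integral_pow[of "\<lambda>x. 2 * g x" n] by simp
    finally have "(\<integral>x. (r x - 2) * g x \<partial>M) \<le> 0"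
      using irg bdd_integrable[OF bg] by (simp add: left_diff_distrib)
    moreover have nn: "0 \<le> (r x - 2) * g x" for x by (auto simp: g_def indicator_def)
    then have "0 \<le> (\<integral>x. (r x - 2) * g x \<partial>M)" by (intro integral_nonneg_AE AE_I2)
    ultimately have "(\<integral>x. (r x - 2) * g x \<partial>M) = 0" by linarith
    moreover have "integrable M (\<lambda>x. (r x - 2) * g x)"
      using irg bdd_integrable[OF bg] by (simp add: left_diff_distrib)
    ultimately have "AE x in M. (r x - 2) * g x = 0"
      using nn by (subst (asm) integral_nonneg_eq_0_iff_AE) auto
    then show ?thesis by eventually_elim (auto simp: g_def indicator_def split: if_splits)
  qed
  define k where "k x = min (r x) 2 - 1" for x
  have [measurable]: "k \<in> borel_measurable M" unfolding k_def[abs_def] by measurable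
  have k1: "\<bar>k x\<bar> \<le> 1" for x using r0[of x] by (auto simp: k_def min_def)
  have "(\<integral>x. k x * g x \<partial>M) = (\<integral>x. f x * g ((T ^^ n) x) \<partial>M)" if g: "bdd g" for g
  proof -
    have [measurable]: "g \<in> borel_measurable M" using g by (rule bdd_measurable)
    have bk: "bdd k" by (rule bddI[OF _ k1]) simp
    have gT: "bdd (\<lambda>x. g ((T ^^ n) x))" by (rule bdd_comp[OF pow_measurable g])
    have i: "integrable M (\<lambda>x. k x * g x)" "integrable M g"  "integrable M (\<lambda>x. f x * g ((T ^^ n) x))" "integrable M (\<lambda>x. g ((T ^^ n) x))"
      by (intro bdd_integrable bdd_mult bf bk g gT)+
    have "(\<integral>x. k x * g x \<partial>M) + (\<integral>x. g x \<partial>M) = (\<integral>x. (k x + 1) * g x \<partial>M)"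
      using i by (simp add: distrib_right)
    also have "\<dots> = (\<integral>x. r x * g x \<partial>M)"
    proof (rule integral_cong_AE)
      show "AE x in M. (k x + 1) * g x = r x * g x" using r2 by eventually_elim (simp add: k_def)
    qed auto
    also have "\<dots> = (\<integral>x. (f x + 1) * g ((T ^^ n) x) \<partial>M)" by (simp flip: rN add: intN)
    also have "\<dots> = (\<integral>x. f x * g ((T ^^ n) x) \<partial>M) + (\<integral>x. g ((T ^^ n) x) \<partial>M)"
      using i by (simp add: distrib_right)
    finally show ?thesis using integral_pow[of g n] by simp
  qed
  moreover have "bdd k" by (rule bddI[OF _ k1]) simp
  ultimately show ?thesis using k1 by (auto simp: is_dual_def)
qed

text \<open>As |k| \<le> 1, |k|^q \<le> k sgn k, and duality turns the integral of the latter into a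
  correlation of f with the bounded function sgn k.\<close>

lemma dual_Lqb:
  assumes f: "bdd f" and k: "is_dual n f k" "\<And>x. \<bar>k x\<bar> \<le> 1"
    and cor: "\<And>g. g \<in> borel_measurable M \<Longrightarrow> (\<And>x. \<bar>g x\<bar> \<le> 1) \<Longrightarrow> \<bar>\<integral>x. f x * g ((T ^^ n) x) \<partial>M\<bar> \<le> A powr q"
  shows "Lqb k A"
proof (rule Lqb_bdd)
  show bk: "bdd k" using k by (simp add: is_dual_def)
  have "(\<integral>x. \<bar>k x\<bar> powr q \<partial>M) \<le> (\<integral>x. k x * sgn (k x) \<partial>M)"
  proof (rule integral_mono)
    have "\<bar>k x\<bar> powr q \<le> \<bar>k x\<bar>" for x
      using k(2)[of x] q2 powr_mono'[of 1 q "\<bar>k x\<bar>"] by simp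
    then show "\<bar>k x\<bar> powr q \<le> k x * sgn (k x)" for x by (simp only: abs_sgn[symmetric])
  qed (use q2 in \<open>intro bdd_integrable bdd_powr bdd_mult bdd_sgn bk; simp\<close>)+
  also have "\<dots> = (\<integral>x. f x * sgn (k ((T ^^ n) x)) \<partial>M)"
    using k(1) bdd_sgn[OF bk] by (simp add: is_dual_def)
  also have "\<dots> \<le> A powr q"
    using cor[of "\<lambda>x. sgn (k x)"] bdd_measurable[OF bdd_sgn[OF bk]] by (auto simp: abs_sgn_eq)
  finally show "(\<integral>x. \<bar>k x\<bar> powr q \<partial>M) \<le> A powr q" .
qed

section \<open>Birkhoff sums and the dyadic martingale approximation\<close>

definition birk :: "nat \<Rightarrow> nat \<Rightarrow> ('a \<Rightarrow> real) \<Rightarrow> 'a \<Rightarrow> real" where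
  "birk m n f x = (\<Sum>j<n. f ((T ^^ (m * j)) x))"

lemma bdd_birk: "bdd f \<Longrightarrow> bdd (birk m n f)"
  unfolding birk_def[abs_def] by (intro bdd_sum bdd_comp[OF pow_measurable])

lemma birk_add: "birk m n (\<lambda>x. f x + g x) x = birk m n f x + birk m n g x"
  by (simp add: birk_def sum.distrib)

lemma birk_Suc: "birk m (Suc n) f x = f x + birk m n f ((T ^^ m) x)"
  unfolding birk_def sum.lessThan_Suc_shift by (simp add: funpow_add add.commute[of m])

lemma birk_append: "birk 1 (a + b) f x = birk 1 a f x + birk 1 b f ((T ^^ a) x)"
  by (induction a arbitrary: x) (simp_all add: birk_Suc funpow_swap1, simp add: birk_def)

lemma birk_double:
  "birk m (2 * n) f x = birk (2 * m) n (\<lambda>x. f x + f ((T ^^ m) x)) x"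
proof (induction n arbitrary: x)
  case (Suc n)
  have "birk m (2 * Suc n) f x = f x + (f ((T ^^ m) x) + birk m (2 * n) f ((T ^^ m) ((T ^^ m) x)))"
    by (simp add: birk_Suc)
  also have "(T ^^ m) ((T ^^ m) x) = (T ^^ (2 * m)) x" by (simp add: mult_2 funpow_add)
  finally show ?case unfolding Suc by (simp add: birk_Suc)
qed (simp add: birk_def)

text \<open>Induction puts one term in front. The rest X is a function of T^m, hence so is sgn X
  |X|^(q-1), and d is orthogonal to it. By two-smoothness each step adds K B^2 to the squared
  bound.\<close>

lemma birk_martingale:
  assumes K: "smooth_const K"
    and d: "bdd d" "Lqb d B" "0 < B" and orth: "\<And>g. bdd g \<Longrightarrow> (\<integral>x. d x * g ((T ^^ m) x) \<partial>M) = 0"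
    and n: "0 < n"
  shows "Lqb (birk m n d) (sqrt (K * real n) * B)"
proof -
  have K1: "1 \<le> K" using K by (simp add: smooth_const_def)
  show ?thesis using n
  proof (induction n rule: nat_induct_non_zero)
    case 1
    have "1 * B \<le> sqrt (K * real 1) * B" using K1 d by (intro mult_right_mono) auto
    then have "Lqb d (sqrt (K * real 1) * B)" using d by (intro Lqb_mono[OF d(2)]) auto
    moreover have "birk m 1 d = d" by (rule ext) (simp add: birk_def)
    ultimately show ?case by simp
  next
    case (Suc n)
    define X where "X x = birk m n d ((T ^^ m) x)" for x
    have bb: "bdd (birk m n d)" by (rule bdd_birk[OF d(1)])
    have X: "bdd X" unfolding X_def[abs_def] by (rule bdd_comp[OF pow_measurable bb])
    have "(\<integral>x. (sgn (X x) * \<bar>X x\<bar> powr (q - 1)) * d x \<partial>M) = 0"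
      using orth[OF bdd_mult[OF bdd_sgn[OF bb] bdd_powr[OF bb, of "q - 1"]]] q2 by (simp add: X_def mult.commute)
    moreover have "Lqb X (sqrt (K * real n) * B)"
      unfolding X_def[abs_def] by (rule Lqb_pow[OF Suc.IH])
    ultimately have "Lqb (\<lambda>x. X x + d x) (sqrt ((sqrt (K * real n) * B)\<^sup>2 + K * B\<^sup>2))"
      using Suc.hyps K1 d X K unfolding smooth_const_def by auto
    also have "(\<lambda>x. X x + d x) = birk m (Suc n) d"
      by (rule ext) (simp add: X_def birk_Suc)
    also have "sqrt ((sqrt (K * real n) * B)\<^sup>2 + K * B\<^sup>2) = sqrt (K * real (Suc n)) * B"
    proof -
      have "(sqrt (K * real n) * B)\<^sup>2 + K * B\<^sup>2 = (K * real (Suc n)) * B\<^sup>2"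
        using K1 by (simp add: power_mult_distrib algebra_simps)
      then show ?thesis using d(3) by (simp add: real_sqrt_mult)
    qed
    finally show ?case .
  qed
qed

definition chi :: "(nat \<Rightarrow> 'a \<Rightarrow> real) \<Rightarrow> nat \<Rightarrow> 'a \<Rightarrow> real" where
  "chi k r x = (\<Sum>i\<in>{2 ^ r..<2 ^ Suc r}. k i x)"

text \<open>Block variables at scale 2^r. Let P be the dual of composition with T, so that
  \<open>k i\<close> plays the role of P^i f. The recursion is designed so that P^(2^r) maps
  \<open>psi f k r\<close> to \<open>chi k r\<close>.\<close>

fun psi :: "('a \<Rightarrow> real) \<Rightarrow> (nat \<Rightarrow> 'a \<Rightarrow> real) \<Rightarrow> nat \<Rightarrow> 'a \<Rightarrow> real" where
  "psi f k 0 x = f x"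
| "psi f k (Suc r) x = chi k r x + chi k r ((T ^^ (2 ^ r)) x)"

lemma dual_shift:
  assumes k: "\<And>i. 0 < i \<Longrightarrow> is_dual i f (k i)" and i: "0 < i" and g: "bdd g"
  shows "(\<integral>x. k i x * g ((T ^^ m) x) \<partial>M) = (\<integral>x. k (i + m) x * g x \<partial>M)"
proof -
  have "(\<integral>x. k i x * g ((T ^^ m) x) \<partial>M) = (\<integral>x. f x * g ((T ^^ m) ((T ^^ i) x)) \<partial>M)"
    using k[OF i] bdd_comp[OF pow_measurable[of m] g] by (auto simp: is_dual_def)
  also have "\<dots> = (\<integral>x. f x * g ((T ^^ (i + m)) x) \<partial>M)"
    by (simp add: add.commute[of i] funpow_add)
  also have "\<dots> = (\<integral>x. k (i + m) x * g x \<partial>M)"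
    using k[of "i + m"] i g by (auto simp: is_dual_def)
  finally show ?thesis .
qed

text \<open>For r = s + 1, applying P^(2^r) shifts the indices [2^s, 2^(s+1)) of the first summand
  by 2^(s+1) and those of the second by only 2^s, because composition with T^(2^s) undoes half of
  the power. The two shifted ranges are adjacent and together form [2^r, 2^(r+1)).\<close>

lemma dual_psi_chi:
  assumes f: "bdd f" and k: "\<And>i. 0 < i \<Longrightarrow> is_dual i f (k i)" and g: "bdd g"
  shows "(\<integral>x. psi f k r x * g ((T ^^ (2 ^ r)) x) \<partial>M) = (\<integral>x. chi k r x * g x \<partial>M)"
proof (cases r)
  case 0
  have "{2 ^ 0..<2 ^ Suc 0} = {1::nat}" by auto
  then show ?thesis using 0 k[of 1] g by (simp add: chi_def is_dual_def)
next
  case (Suc s)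
  have bk: "bdd (k i)" if "0 < i" for i using k[OF that] by (simp add: is_dual_def)
  have bc: "bdd (chi k s)" unfolding chi_def[abs_def]
    by (intro bdd_sum bk) (auto intro: order_less_le_trans[of 0 "2 ^ s"])
  have gT: "bdd (\<lambda>x. g ((T ^^ n) x))" for n by (rule bdd_comp[OF pow_measurable g])
  have chi_g: "(\<integral>x. chi k s x * g ((T ^^ m) x) \<partial>M) = (\<Sum>i\<in>{2 ^ s..<2 ^ Suc s}. \<integral>x. k (i + m) x * g x \<partial>M)" for m
  proof -
    have "(\<integral>x. chi k s x * g ((T ^^ m) x) \<partial>M) = (\<Sum>i\<in>{2 ^ s..<2 ^ Suc s}. \<integral>x. k i x * g ((T ^^ m) x) \<partial>M)"
      unfolding chi_def sum_distrib_right
      by (intro Bochner_Integration.integral_sum bdd_integrable bdd_mult bk gT)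
        (auto intro: order_less_le_trans[of 0 "2 ^ s"])
    also have "\<dots> = (\<Sum>i\<in>{2 ^ s..<2 ^ Suc s}. \<integral>x. k (i + m) x * g x \<partial>M)"
      by (intro sum.cong refl dual_shift[OF k _ g]) (auto intro: order_less_le_trans[of 0 "2 ^ s"])
    finally show ?thesis .
  qed
  have two: "(2::nat) ^ Suc s = 2 ^ s + 2 ^ s" by simp
  have "(\<integral>x. psi f k r x * g ((T ^^ (2 ^ r)) x) \<partial>M) =
      (\<integral>x. chi k s x * g ((T ^^ (2 ^ Suc s)) x) \<partial>M) + (\<integral>x. chi k s ((T ^^ (2 ^ s)) x) * g ((T ^^ (2 ^ Suc s)) x) \<partial>M)"
    unfolding Suc psi.simps distrib_right
    by (intro Bochner_Integration.integral_add bdd_integrable bdd_mult bc gT bdd_comp[OF pow_measurable bc])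
  also have "(\<integral>x. chi k s ((T ^^ (2 ^ s)) x) * g ((T ^^ (2 ^ Suc s)) x) \<partial>M) = (\<integral>x. chi k s x * g ((T ^^ (2 ^ s)) x) \<partial>M)"
    using integral_pow[of "\<lambda>x. chi k s x * g ((T ^^ (2 ^ s)) x)" "2 ^ s"] bdd_measurable[OF bdd_mult[OF bc gT]]
    by (simp only: two funpow_add comp_apply)
  also have "(\<integral>x. chi k s x * g ((T ^^ (2 ^ Suc s)) x) \<partial>M) + (\<integral>x. chi k s x * g ((T ^^ (2 ^ s)) x) \<partial>M) =
     (\<Sum>i\<in>{2 ^ s + 2 ^ Suc s..<2 ^ Suc s + 2 ^ Suc s}. \<integral>x. k i x * g x \<partial>M) +
     (\<Sum>i\<in>{2 ^ s + 2 ^ s..<2 ^ Suc s + 2 ^ s}. \<integral>x. k i x * g x \<partial>M)"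
    unfolding chi_g sum.shift_bounds_nat_ivl ..
  also have "\<dots> = (\<Sum>i\<in>{2 ^ s + 2 ^ s..<2 ^ Suc s + 2 ^ s}. \<integral>x. k i x * g x \<partial>M) +
     (\<Sum>i\<in>{2 ^ Suc s + 2 ^ s..<2 ^ Suc s + 2 ^ Suc s}. \<integral>x. k i x * g x \<partial>M)"
    by (simp only: add.commute)
  also have "\<dots> = (\<Sum>i\<in>{2 ^ s + 2 ^ s..<2 ^ Suc s + 2 ^ Suc s}. \<integral>x. k i x * g x \<partial>M)"
    by (rule sum.atLeastLessThan_concat) auto
  also have "\<dots> = (\<Sum>i\<in>{2 ^ r..<2 ^ Suc r}. \<integral>x. k i x * g x \<partial>M)"
  proof -
    have "(2::nat) ^ s + 2 ^ s = 2 ^ r" "(2::nat) ^ Suc s + 2 ^ Suc s = 2 ^ Suc r" by (simp_all add: Suc)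
    then show ?thesis by (simp only:)
  qed
  also have "\<dots> = (\<integral>x. chi k r x * g x \<partial>M)"
    unfolding chi_def sum_distrib_right
    by (intro Bochner_Integration.integral_sum[symmetric] bdd_integrable bdd_mult bk g)
      (auto intro: order_less_le_trans[of 0 "2 ^ r"])
  finally show ?thesis .
qed

lemma birk_comp: "birk m n (\<lambda>x. f ((T ^^ a) x)) x = birk m n f ((T ^^ a) x)"
proof -
  have "(T ^^ a) ((T ^^ b) x) = (T ^^ b) ((T ^^ a) x)" for b
    by (metis add.commute comp_apply funpow_add)
  then show ?thesis by (simp add: birk_def)
qed

text \<open>\<open>psi\<close> at scale r is d plus \<open>chi\<close> composed with T^(2^r), where
  d is orthogonal to all bounded functions of T^(2^r) by \<open>dual_psi_chi\<close>. The sum of d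
  falls to \<open>birk_martingale\<close>. Pairing neighbours in the other sum gives
  \<open>psi\<close> at the next scale with half as many terms. The bounds at scale r are c w for
  \<open>chi\<close>, 2 c w for \<open>psi\<close> and 3 c w for d.\<close>

lemma dyadic_bound:
  assumes K: "smooth_const K"
    and \<beta>: "0 \<le> \<beta>" "\<beta> \<le> 1" and f: "bdd f" "Lqb f c" and c: "0 < c"
    and k: "\<And>i. 0 < i \<Longrightarrow> is_dual i f (k i)" "\<And>i. 0 < i \<Longrightarrow> Lqb (k i) (c * real i powr (- \<beta>))"
  shows "Lqb (birk (2 ^ r) (2 ^ m) (psi f k r))
    (3 * sqrt K * c * (\<Sum>i\<le>m. sqrt (2 ^ (m - i)) * (2 ^ (r + i)) powr (1 - \<beta>)))"
proof -
  have K1: "1 \<le> K" using K by (simp add: smooth_const_def)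
  define w :: "nat \<Rightarrow> real" where "w r = (2 ^ r) powr (1 - \<beta>)" for r
  have w0: "0 < w r" for r by (simp add: w_def)
  have wS: "w r \<le> w (Suc r)" for r unfolding w_def using \<beta> by (intro powr_mono2) auto
  have w00: "w 0 = 1" by (simp add: w_def)
  have pos: "0 < i" if "i \<in> {2 ^ r..<2 ^ Suc r}" for i r :: nat
    using that by (auto intro: order_less_le_trans[of 0 "2 ^ r"])
  have bk: "bdd (k i)" if "0 < i" for i using k(1)[OF that] by (simp add: is_dual_def)
  have bchi: "bdd (chi k r)" for r unfolding chi_def[abs_def] by (intro bdd_sum bk pos)
  have bpsi: "bdd (psi f k r)" for r
  proof (cases r)
    case 0
    have "psi f k 0 = f" by (rule ext) simp
    then show ?thesis using 0 f by simp
  next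
    case (Suc s)
    have "psi f k (Suc s) = (\<lambda>x. chi k s x + chi k s ((T ^^ (2 ^ s)) x))" by (rule ext) simp
    then show ?thesis using Suc bdd_add[OF bchi[of s] bdd_comp[OF pow_measurable bchi[of s], of "2 ^ s"]] by simp
  qed
  have Lchi: "Lqb (chi k r) (c * w r)" for r
  proof (rule Lqb_mono)
    show "Lqb (chi k r) (\<Sum>i\<in>{2 ^ r..<2 ^ Suc r}. c * real i powr (- \<beta>))"
      unfolding chi_def[abs_def] using c
      by (intro Lqb_sum k(2) pos mult_pos_pos) (auto dest: pos)
    show "0 \<le> (\<Sum>i\<in>{2 ^ r..<2 ^ Suc r}. c * real i powr (- \<beta>))" using c by (intro sum_nonneg) auto
    have "(\<Sum>i\<in>{2 ^ r..<2 ^ Suc r}. c * real i powr (- \<beta>)) \<le> (\<Sum>i\<in>{2 ^ r..<2 ^ Suc r::nat}. c * (2 ^ r) powr (- \<beta>))"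
    proof (intro sum_mono mult_left_mono powr_mono2')
      fix i :: nat assume i: "i \<in> {2 ^ r..<2 ^ Suc r}"
      then have "real (2 ^ r) \<le> real i" by (simp only: of_nat_le_iff atLeastLessThan_iff)
      then show "2 ^ r \<le> real i" by simp
    qed (use \<beta> c in auto)
    also have "\<dots> = c * (2 ^ r * (2 ^ r) powr (- \<beta>))" by simp
    also have "(2::real) ^ r * (2 ^ r) powr (- \<beta>) = w r" unfolding w_def by (subst powr_mult_base) auto
    finally show "(\<Sum>i\<in>{2 ^ r..<2 ^ Suc r}. c * real i powr (- \<beta>)) \<le> c * w r" .
  qed
  have Lpsi: "Lqb (psi f k r) (2 * c * w r)" for r
  proof (cases r)
    case 0
    have "psi f k 0 = f" by (rule ext) simp
    then show ?thesis using 0 f c w00 by (auto intro: Lqb_mono)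
  next
    case (Suc s)
    have "psi f k (Suc s) = (\<lambda>x. chi k s x + chi k s ((T ^^ (2 ^ s)) x))" by (rule ext) simp
    moreover have "Lqb (\<lambda>x. chi k s x + chi k s ((T ^^ (2 ^ s)) x)) (c * w s + c * w s)"
      using c w0 by (intro Lqb_add Lqb_pow Lchi mult_pos_pos)
    ultimately have "Lqb (psi f k (Suc s)) (c * w s + c * w s)" by simp
    then show ?thesis unfolding Suc
      by (rule Lqb_mono) (use c w0[of s] wS[of s] in auto)
  qed
  define d where "d r x = psi f k r x - chi k r ((T ^^ (2 ^ r)) x)" for r x
  have bd: "bdd (d r)" for r unfolding d_def[abs_def] by (intro bdd_diff bpsi bdd_comp[OF pow_measurable bchi])
  have Ld: "Lqb (d r) (3 * c * w r)" for r
  proof -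
    have "Lqb (d r) (2 * c * w r + c * w r)"
      unfolding d_def[abs_def] using c w0 by (intro Lqb_diff Lqb_pow Lchi Lpsi mult_pos_pos) auto
    then show ?thesis by (simp add: algebra_simps)
  qed
  have orth: "(\<integral>x. d r x * g ((T ^^ (2 ^ r)) x) \<partial>M) = 0" if g: "bdd g" for g r
  proof -
    have gT: "bdd (\<lambda>x. g ((T ^^ (2 ^ r)) x))" by (rule bdd_comp[OF pow_measurable g])
    have "(\<integral>x. d r x * g ((T ^^ (2 ^ r)) x) \<partial>M) =
      (\<integral>x. psi f k r x * g ((T ^^ (2 ^ r)) x) \<partial>M) - (\<integral>x. chi k r ((T ^^ (2 ^ r)) x) * g ((T ^^ (2 ^ r)) x) \<partial>M)"
      unfolding d_def left_diff_distrib
      by (intro Bochner_Integration.integral_diff bdd_integrable bdd_mult bpsi gT bdd_comp[OF pow_measurable bchi])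
    also have "(\<integral>x. chi k r ((T ^^ (2 ^ r)) x) * g ((T ^^ (2 ^ r)) x) \<partial>M) = (\<integral>x. chi k r x * g x \<partial>M)"
      using integral_pow[of "\<lambda>x. chi k r x * g x" "2 ^ r"] bdd_measurable[OF bdd_mult[OF bchi g]] by simp
    finally show ?thesis using dual_psi_chi[OF f(1) k(1) g, of r] by simp
  qed
  have sK: "1 \<le> sqrt K" using K1 by simp
  have "Lqb (birk (2 ^ r) (2 ^ m) (psi f k r)) (3 * sqrt K * c * (\<Sum>i\<le>m. sqrt (2 ^ (m - i)) * w (r + i)))"
  proof (induction m arbitrary: r)
    case 0
    have "birk (2 ^ r) (2 ^ 0) (psi f k r) = psi f k r" by (rule ext) (simp add: birk_def)
    moreover have "2 \<le> 3 * sqrt K" using sK by linarith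
    then have "2 * c * w r \<le> 3 * sqrt K * c * w r"
      using c w0[of r] by (intro mult_right_mono) auto
    ultimately show ?case using Lpsi[of r] c w0[of r] by (auto intro: Lqb_mono)
  next
    case (Suc m)
    have eq: "birk (2 ^ r) (2 ^ Suc m) (psi f k r) x =
       birk (2 ^ r) (2 ^ Suc m) (d r) x + birk (2 ^ Suc r) (2 ^ m) (psi f k (Suc r)) ((T ^^ (2 ^ r)) x)" for x
    proof -
      have "psi f k r = (\<lambda>x. d r x + chi k r ((T ^^ (2 ^ r)) x))" by (rule ext) (simp add: d_def)
      then have "birk (2 ^ r) (2 ^ Suc m) (psi f k r) x = birk (2 ^ r) (2 ^ Suc m) (\<lambda>x. d r x + chi k r ((T ^^ (2 ^ r)) x)) x"
        by simp
      also have "\<dots> = birk (2 ^ r) (2 ^ Suc m) (d r) x + birk (2 ^ r) (2 * 2 ^ m) (chi k r) ((T ^^ (2 ^ r)) x)"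
        unfolding birk_add birk_comp by simp
      also have "birk (2 ^ r) (2 * 2 ^ m) (chi k r) ((T ^^ (2 ^ r)) x) =
          birk (2 * 2 ^ r) (2 ^ m) (\<lambda>x. chi k r x + chi k r ((T ^^ (2 ^ r)) x)) ((T ^^ (2 ^ r)) x)"
        by (rule birk_double)
      also have "\<dots> = birk (2 ^ Suc r) (2 ^ m) (psi f k (Suc r)) ((T ^^ (2 ^ r)) x)"
      proof -
        have "(\<lambda>x. chi k r x + chi k r ((T ^^ (2 ^ r)) x)) = psi f k (Suc r)" by (rule ext) simp
        then show ?thesis by (simp only: power_Suc)
      qed
      finally show ?thesis .
    qed
    have "Lqb (birk (2 ^ r) (2 ^ Suc m) (d r)) (sqrt (K * real (2 ^ Suc m)) * (3 * c * w r))"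
      using c w0 by (intro birk_martingale[OF K bd Ld _ orth]) auto
    moreover have "Lqb (\<lambda>x. birk (2 ^ Suc r) (2 ^ m) (psi f k (Suc r)) ((T ^^ (2 ^ r)) x))
       (3 * sqrt K * c * (\<Sum>i\<le>m. sqrt (2 ^ (m - i)) * w (Suc r + i)))"
      by (rule Lqb_pow[OF Suc.IH])
    moreover have "0 < sqrt (K * real (2 ^ Suc m)) * (3 * c * w r)"
      "0 < 3 * sqrt K * c * (\<Sum>i\<le>m. sqrt (2 ^ (m - i)) * w (Suc r + i))"
      using K1 c w0 by (auto intro!: mult_pos_pos sum_pos)
    ultimately have "Lqb (birk (2 ^ r) (2 ^ Suc m) (psi f k r)) (sqrt (K * real (2 ^ Suc m)) * (3 * c * w r) +
       3 * sqrt K * c * (\<Sum>i\<le>m. sqrt (2 ^ (m - i)) * w (Suc r + i)))"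
      unfolding eq[abs_def] by (intro Lqb_add)
    also have "sqrt (K * real (2 ^ Suc m)) * (3 * c * w r) +
       3 * sqrt K * c * (\<Sum>i\<le>m. sqrt (2 ^ (m - i)) * w (Suc r + i)) =
       3 * sqrt K * c * (\<Sum>i\<le>Suc m. sqrt (2 ^ (Suc m - i)) * w (r + i))"
      unfolding sum.atMost_Suc_shift by (simp add: real_sqrt_mult distrib_left mult_ac)
    finally show ?case .
  qed
  then show ?thesis by (simp add: w_def)
qed

text \<open>The summands are geometric in i with ratio 2^(1/2 - \<beta>), so the larger end term
  dominates. At \<beta> = 1/2 all summands are equal and a factor m + 1 would remain.\<close>

lemma dyadic_sum_bound:
  fixes \<beta> :: real
  assumes \<beta>: "\<beta> \<noteq> 1/2"
  shows "\<exists>E>0. \<forall>m. (\<Sum>i\<le>m. sqrt (2 ^ (m - i)) * (2 ^ i) powr (1 - \<beta>)) \<le> E * (2 ^ m) powr (max (1/2) (1 - \<beta>))"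
proof -
  define \<rho> :: real where "\<rho> = 2 powr (- \<bar>1/2 - \<beta>\<bar>)"
  have \<rho>: "0 < \<rho>" "\<rho> < 1" using \<beta> by (auto simp: \<rho>_def powr_less_one)
  have geo: "(\<Sum>i\<le>m. \<rho> ^ i) \<le> 1 / (1 - \<rho>)" for m
  proof -
    have "(\<Sum>i\<le>m. \<rho> ^ i) = (1 - \<rho> ^ Suc m) / (1 - \<rho>)" using \<rho> by (simp only: sum_gp0) auto
    also have "\<dots> \<le> 1 / (1 - \<rho>)" using \<rho> by (intro divide_right_mono) auto
    finally show ?thesis .
  qed
  have pow2: "(2 ^ m) powr a = (2::real) powr (real m * a)" for m :: nat and a :: real
    by (simp add: powr_realpow[symmetric] powr_powr)
  have pow\<rho>: "\<rho> ^ i = 2 powr (real i * (- \<bar>1/2 - \<beta>\<bar>))" for i :: nat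
    by (simp add: \<rho>_def powr_realpow[symmetric] powr_powr mult.commute)
  have summand: "sqrt (2 ^ (m - i)) * (2 ^ i) powr (1 - \<beta>) = 2 powr (real (m - i) / 2 + real i * (1 - \<beta>))" for m i :: nat
    by (simp add: powr_half_sqrt[symmetric] powr_realpow[symmetric] powr_powr powr_add)
  have "(\<Sum>i\<le>m. sqrt (2 ^ (m - i)) * (2 ^ i) powr (1 - \<beta>)) \<le> 1 / (1 - \<rho>) * (2 ^ m) powr (max (1/2) (1 - \<beta>))" for m
  proof (cases "1/2 < \<beta>")
    case True
    have "(\<Sum>i\<le>m. sqrt (2 ^ (m - i)) * (2 ^ i) powr (1 - \<beta>)) = (\<Sum>i\<le>m. (2 ^ m) powr (1/2) * \<rho> ^ i)"
    proof (rule sum.cong[OF refl])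
      fix i assume "i \<in> {..m}"
      then have "real (m - i) / 2 + real i * (1 - \<beta>) = real m * (1/2) + real i * (- \<bar>1/2 - \<beta>\<bar>)"
        using True by (simp add: of_nat_diff field_simps)
      moreover have "2 powr (real m * (1/2) + real i * (- \<bar>1/2 - \<beta>\<bar>)) = (2 ^ m) powr (1/2) * \<rho> ^ i"
        by (simp only: pow2 pow\<rho> powr_add)
      ultimately show "sqrt (2 ^ (m - i)) * (2 ^ i) powr (1 - \<beta>) = (2 ^ m) powr (1/2) * \<rho> ^ i"
        unfolding summand by simp
    qed
    also have "\<dots> = (2 ^ m) powr (1/2) * (\<Sum>i\<le>m. \<rho> ^ i)" by (simp only: sum_distrib_left)
    also have "\<dots> \<le> (2 ^ m) powr (1/2) * (1 / (1 - \<rho>))" by (intro mult_left_mono geo) auto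
    finally show ?thesis using True by (simp add: max_def)
  next
    case False
    have "(\<Sum>i\<le>m. sqrt (2 ^ (m - i)) * (2 ^ i) powr (1 - \<beta>)) = (\<Sum>i\<le>m. (2 ^ m) powr (1 - \<beta>) * \<rho> ^ (m - i))"
    proof (rule sum.cong[OF refl])
      fix i assume "i \<in> {..m}"
      then have "real (m - i) / 2 + real i * (1 - \<beta>) = real m * (1 - \<beta>) + real (m - i) * (- \<bar>1/2 - \<beta>\<bar>)"
        using False by (simp add: of_nat_diff field_simps)
      moreover have "2 powr (real m * (1 - \<beta>) + real (m - i) * (- \<bar>1/2 - \<beta>\<bar>)) = (2 ^ m) powr (1 - \<beta>) * \<rho> ^ (m - i)"
        by (simp only: pow2 pow\<rho> powr_add)
      ultimately show "sqrt (2 ^ (m - i)) * (2 ^ i) powr (1 - \<beta>) = (2 ^ m) powr (1 - \<beta>) * \<rho> ^ (m - i)"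
        unfolding summand by simp
    qed
    also have "\<dots> = (2 ^ m) powr (1 - \<beta>) * (\<Sum>i\<le>m. \<rho> ^ (m - i))" by (simp only: sum_distrib_left)
    also have "(\<Sum>i\<le>m. \<rho> ^ (m - i)) = (\<Sum>i\<le>m. \<rho> ^ i)"
      using sum.nat_diff_reindex[of "\<lambda>i. \<rho> ^ i" "Suc m"] by (simp only: lessThan_Suc_atMost diff_Suc_Suc)
    also have "(2 ^ m) powr (1 - \<beta>) * (\<Sum>i\<le>m. \<rho> ^ i) \<le> (2 ^ m) powr (1 - \<beta>) * (1 / (1 - \<rho>))"
      by (intro mult_left_mono geo) auto
    finally show ?thesis using False by (simp add: max_def)
  qed
  then show ?thesis using \<rho> by (intro exI[of _ "1 / (1 - \<rho>)"]) auto
qed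

text \<open>The binary expansion of n cuts the sum into shifted blocks of distinct dyadic lengths.
  Shifts preserve norms, and the bounds form a geometric series.\<close>

lemma dyadic_to_all:
  assumes H: "\<And>m. Lqb (birk 1 (2 ^ m) f) (D * (2 ^ m) powr \<eta>)" and D: "0 < D" and \<eta>: "0 < \<eta>" and n: "0 < n"
  shows "Lqb (birk 1 n f) (2 powr \<eta> / (2 powr \<eta> - 1) * D * real n powr \<eta>)"
proof -
  define \<zeta> :: real where "\<zeta> = 2 powr \<eta>"
  have \<zeta>: "1 < \<zeta>" using \<eta> by (simp add: \<zeta>_def)
  have z: "(2 ^ i) powr \<eta> = \<zeta> ^ i" for i :: nat
    by (simp add: \<zeta>_def powr_realpow[symmetric] powr_powr mult.commute)
  have *: "0 < n \<Longrightarrow> n < 2 ^ m \<Longrightarrow> Lqb (birk 1 n f) (D * (\<Sum>i<m. \<zeta> ^ i))" for m n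
  proof (induction m arbitrary: n)
    case (Suc m)
    have s0: "0 \<le> (\<Sum>i<m. \<zeta> ^ i)" using \<zeta> by (intro sum_nonneg) auto
    consider "n < 2 ^ m" | "n = 2 ^ m" | "2 ^ m < n" by linarith
    then show ?case
    proof cases
      case 1
      show ?thesis
        by (rule Lqb_mono[OF Suc.IH[OF Suc.prems(1) 1]]) (use D \<zeta> s0 in auto)
    next
      case 2
      show ?thesis unfolding 2
        by (rule Lqb_mono[OF H]) (use D \<zeta> s0 in \<open>auto simp: z\<close>)
    next
      case 3
      define b where "b = n - 2 ^ m"
      have b: "0 < b" "b < 2 ^ m" "n = 2 ^ m + b" using 3 Suc.prems by (auto simp: b_def)
      have "m \<noteq> 0" using b by (cases m) auto
      then have "0 < (\<Sum>i<m. \<zeta> ^ i)" using \<zeta> by (intro sum_pos) auto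
      then have "Lqb (\<lambda>x. birk 1 (2 ^ m) f x + birk 1 b f ((T ^^ (2 ^ m)) x)) (D * (2 ^ m) powr \<eta> + D * (\<Sum>i<m. \<zeta> ^ i))"
        using D by (intro Lqb_add H Lqb_pow[OF Suc.IH[OF b(1,2)]] mult_pos_pos) auto
      moreover have "birk 1 n f = (\<lambda>x. birk 1 (2 ^ m) f x + birk 1 b f ((T ^^ (2 ^ m)) x))"
        unfolding b(3) by (rule ext) (rule birk_append)
      ultimately show ?thesis by (simp add: z algebra_simps)
    qed
  qed simp
  obtain m where m: "2 ^ m \<le> n" "n < 2 ^ Suc m" using ex_power_ivl1[of 2 n] n by auto
  show ?thesis
  proof (rule Lqb_mono[OF *[OF n m(2)]])
    have "(\<Sum>i<Suc m. \<zeta> ^ i) = (\<zeta> ^ Suc m - 1) / (\<zeta> - 1)" using \<zeta> geometric_sum[of \<zeta> "Suc m"] by simp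
    also have "\<dots> \<le> \<zeta> ^ Suc m / (\<zeta> - 1)" using \<zeta> by (intro divide_right_mono) auto
    also have "\<dots> = \<zeta> / (\<zeta> - 1) * (2 ^ m) powr \<eta>" by (simp add: z)
    also have "\<dots> \<le> \<zeta> / (\<zeta> - 1) * real n powr \<eta>"
    proof (intro mult_left_mono powr_mono2)
      have "real (2 ^ m) \<le> real n" using m by (simp only: of_nat_le_iff)
      then show "2 ^ m \<le> real n" by simp
    qed (use \<zeta> \<eta> in auto)
    finally have "D * (\<Sum>i<Suc m. \<zeta> ^ i) \<le> D * (\<zeta> / (\<zeta> - 1) * real n powr \<eta>)" using D by (intro mult_left_mono) auto
    then show "D * (\<Sum>i<Suc m. \<zeta> ^ i) \<le> 2 powr \<eta> / (2 powr \<eta> - 1) * D * real n powr \<eta>"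
      by (simp add: \<zeta>_def mult_ac)
    have "0 \<le> (\<Sum>i<Suc m. \<zeta> ^ i)" using \<zeta> by (intro sum_nonneg) auto
    then show "0 \<le> D * (\<Sum>i<Suc m. \<zeta> ^ i)" using D by (intro mult_nonneg_nonneg) auto
  qed
qed

text \<open>D is the same for all f and c. This uniformity is what later permits summing the bounds
  over all level sets of a monotone function.\<close>

lemma moment_bound:
  assumes \<beta>: "0 \<le> \<beta>" "\<beta> \<le> 1" "\<beta> \<noteq> 1/2"
  shows "\<exists>D>0. \<forall>f c. f \<in> borel_measurable M \<longrightarrow> (\<forall>x. \<bar>f x\<bar> \<le> 1) \<longrightarrow> 0 < c \<longrightarrow> Lqb f c \<longrightarrow>
    (\<forall>i g. 0 < i \<longrightarrow> g \<in> borel_measurable M \<longrightarrow> (\<forall>x. \<bar>g x\<bar> \<le> 1) \<longrightarrow>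
       \<bar>\<integral>x. f x * g ((T ^^ i) x) \<partial>M\<bar> \<le> (c * real i powr (- \<beta>)) powr q) \<longrightarrow>
    (\<forall>n>0. Lqb (birk 1 n f) (D * c * real n powr (max (1/2) (1 - \<beta>))))"
proof -
  obtain K where K: "smooth_const K" "1 \<le> K"
    using smooth_const_exists by (auto simp: smooth_const_def)
  obtain E where E: "0 < E" "\<And>m. (\<Sum>i\<le>m. sqrt (2 ^ (m - i)) * (2 ^ i) powr (1 - \<beta>)) \<le> E * (2 ^ m) powr (max (1/2) (1 - \<beta>))"
    using dyadic_sum_bound[OF \<beta>(3)] by blast
  define \<eta> where "\<eta> = max (1/2) (1 - \<beta>)"
  have \<eta>: "0 < \<eta>" by (simp add: \<eta>_def)
  define D where "D = 2 powr \<eta> / (2 powr \<eta> - 1) * (3 * sqrt K * E)"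
  have D: "0 < D" using K E \<eta> by (simp add: D_def)
  have "Lqb (birk 1 n f) (D * c * real n powr \<eta>)"
    if f: "f \<in> borel_measurable M" "\<And>x. \<bar>f x\<bar> \<le> 1" and c: "0 < c" and L: "Lqb f c"
      and cor: "\<And>i g. 0 < i \<Longrightarrow> g \<in> borel_measurable M \<Longrightarrow> (\<And>x. \<bar>g x\<bar> \<le> 1) \<Longrightarrow>
       \<bar>\<integral>x. f x * g ((T ^^ i) x) \<partial>M\<bar> \<le> (c * real i powr (- \<beta>)) powr q" and n: "0 < n" for f c n
  proof -
    have bf: "bdd f" by (rule bddI[OF f])
    define k where "k i = (SOME k. is_dual i f k \<and> (\<forall>x. \<bar>k x\<bar> \<le> 1))" for i
    have k: "is_dual i f (k i)" "\<bar>k i x\<bar> \<le> 1" for i x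
      using someI_ex[OF dual_exists[OF f, of i]] unfolding k_def by auto
    have Lk: "Lqb (k i) (c * real i powr (- \<beta>))" if "0 < i" for i
      by (rule dual_Lqb[OF bf k cor[OF that]])
    have psi0: "psi f k 0 = f" by (rule ext) simp
    have "Lqb (birk 1 (2 ^ m) f) (3 * sqrt K * E * c * (2 ^ m) powr \<eta>)" for m
    proof -
      have "Lqb (birk 1 (2 ^ m) f) (3 * sqrt K * c * (\<Sum>i\<le>m. sqrt (2 ^ (m - i)) * (2 ^ i) powr (1 - \<beta>)))"
        using dyadic_bound[OF K(1) \<beta>(1,2) bf L c k(1) Lk, of 0 m] by (simp add: psi0)
      moreover have "3 * sqrt K * c * (\<Sum>i\<le>m. sqrt (2 ^ (m - i)) * (2 ^ i) powr (1 - \<beta>)) \<le>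
         3 * sqrt K * c * (E * (2 ^ m) powr \<eta>)"
        unfolding \<eta>_def using K c by (intro mult_left_mono E(2)) auto
      moreover have "0 \<le> 3 * sqrt K * c * (\<Sum>i\<le>m. sqrt (2 ^ (m - i)) * (2 ^ i) powr (1 - \<beta>))"
        using K c by (intro mult_nonneg_nonneg sum_nonneg) auto
      ultimately have "Lqb (birk 1 (2 ^ m) f) (3 * sqrt K * c * (E * (2 ^ m) powr \<eta>))"
        by (blast intro: Lqb_mono)
      then show ?thesis by (simp add: mult_ac)
    qed
    from dyadic_to_all[OF this _ \<eta> n] show ?thesis
      using K E c by (simp add: D_def mult_ac)
  qed
  then show ?thesis using D unfolding \<eta>_def by blast
qed

end

section \<open>From intervals to monotone functions\<close>

lemma powr_telescope:
  fixes x y \<tau> :: real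
  assumes "0 < x" "x < y" "0 < \<tau>"
  shows "(y - x) * y powr (- 1 - \<tau>) \<le> (x powr (- \<tau>) - y powr (- \<tau>)) / \<tau>"
proof -
  have "\<exists>z>x. z < y \<and> - (y powr (- \<tau>) / \<tau>) - - (x powr (- \<tau>) / \<tau>) = (y - x) * z powr (- \<tau> - 1)"
    using assms by (intro MVT2) (auto intro!: derivative_eq_intros)
  then obtain z where z: "x < z" "z < y"
      "- (y powr (- \<tau>) / \<tau>) - - (x powr (- \<tau>) / \<tau>) = (y - x) * z powr (- \<tau> - 1)" by blast
  have "y powr (- 1 - \<tau>) \<le> z powr (- 1 - \<tau>)" using z assms by (intro powr_mono2') auto
  then have "(y - x) * y powr (- 1 - \<tau>) \<le> (y - x) * z powr (- 1 - \<tau>)" using assms by (intro mult_left_mono) auto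
  moreover have e: "- \<tau> - 1 = - 1 - \<tau>" by simp
  moreover have "(x powr (- \<tau>) - y powr (- \<tau>)) / \<tau> = - (y powr (- \<tau>) / \<tau>) - - (x powr (- \<tau>) / \<tau>)"
    by (simp add: diff_divide_distrib)
  ultimately show ?thesis using z(3) unfolding e by linarith
qed

text \<open>A lower Riemann sum for the integral of y^(-1-\<tau>) over [1, \<infinity>), which is
  1/\<tau>; neither the mesh nor the number of terms enters the bound.\<close>

lemma riemann_sum_bound:
  fixes h \<tau> :: real
  assumes h: "0 < h" and \<tau>: "0 < \<tau>"
  shows "(\<Sum>j<n. h * (1 + real (Suc j) * h) powr (- 1 - \<tau>)) \<le> 1 / \<tau>"
proof -
  have "(\<Sum>j<n. h * (1 + real (Suc j) * h) powr (- 1 - \<tau>)) \<le> (1 - (1 + real n * h) powr (- \<tau>)) / \<tau>"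
  proof (induction n)
    case (Suc n)
    have "h * (1 + real (Suc n) * h) powr (- 1 - \<tau>) \<le>
      ((1 + real n * h) powr (- \<tau>) - (1 + real (Suc n) * h) powr (- \<tau>)) / \<tau>"
      using powr_telescope[of "1 + real n * h" "1 + real (Suc n) * h" \<tau>] h \<tau>
      by (simp add: algebra_simps add_pos_nonneg)
    then have "(\<Sum>j<Suc n. h * (1 + real (Suc j) * h) powr (- 1 - \<tau>)) \<le>
       (1 - (1 + real n * h) powr (- \<tau>)) / \<tau> + ((1 + real n * h) powr (- \<tau>) - (1 + real (Suc n) * h) powr (- \<tau>)) / \<tau>"
      using Suc unfolding sum.lessThan_Suc by (rule add_mono[rotated])
    also have "\<dots> = (1 - (1 + real (Suc n) * h) powr (- \<tau>)) / \<tau>"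
      by (simp only: add_divide_distrib[symmetric]) simp
    finally show ?case .
  qed simp
  also have "\<dots> \<le> 1 / \<tau>" using \<tau> by (intro divide_right_mono) auto
  finally show ?thesis .
qed

text \<open>Layer cake sum for the positive part of g, with mesh 2^(-m) and height m. All levels are
  strictly positive, which matters because only the positive level sets of functions in
  \<open>Mon\<close> are intervals.\<close>

definition step_approx :: "('a \<Rightarrow> real) \<Rightarrow> nat \<Rightarrow> 'a \<Rightarrow> real" where
  "step_approx g m x = (\<Sum>j<m * 2 ^ m. 1 / 2 ^ m * indicator {x. real (Suc j) * (1 / 2 ^ m) < g x} x)"

lemma card_below:
  fixes y :: real assumes "0 < y"
  shows "\<exists>c::nat. real c < y \<and> y \<le> real c + 1 \<and> (\<forall>j. real (Suc j) < y \<longleftrightarrow> j < c)"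
proof -
  \<comment> \<open>The largest integer strictly below y, matching the strict inequality in the
    level sets.\<close>
  define c where "c = nat (\<lceil>y\<rceil> - 1)"
  have 1: "1 \<le> \<lceil>y\<rceil>" using assms by simp
  have rc: "real c = of_int \<lceil>y\<rceil> - 1" unfolding c_def using 1 by simp
  have "real c < y" "y \<le> real c + 1" unfolding rc by linarith+
  moreover have "real (Suc j) < y \<longleftrightarrow> j < c" for j
  proof
    assume "real (Suc j) < y"
    then have "real j < real c" using \<open>y \<le> real c + 1\<close> by simp
    then show "j < c" by simp
  next
    assume "j < c"
    then have "real (Suc j) \<le> real c" by simp
    then show "real (Suc j) < y" using \<open>real c < y\<close> by linarith
  qed
  ultimately show ?thesis by blast
qed

lemma step_approx_bounds:
  shows "0 \<le> step_approx g m x" "step_approx g m x \<le> max (g x) 0"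
    and "g x \<le> real m \<Longrightarrow> max (g x) 0 \<le> step_approx g m x + 1 / 2 ^ m"
proof -
  show "0 \<le> step_approx g m x" unfolding step_approx_def by (intro sum_nonneg) auto
  have "step_approx g m x \<le> max (g x) 0 \<and> (g x \<le> real m \<longrightarrow> max (g x) 0 \<le> step_approx g m x + 1 / 2 ^ m)"
  proof (cases "0 < g x")
    case False
    have "\<not> (real (Suc j) * (1 / 2 ^ m) < g x)" for j
    proof -
      have "0 \<le> real (Suc j) * (1 / 2 ^ m)" by simp
      then show ?thesis using False by linarith
    qed
    then have "step_approx g m x = 0" unfolding step_approx_def by (intro sum.neutral) auto
    then show ?thesis using False by simp
  next
    case True
    obtain c :: nat where c: "real c < g x * 2 ^ m" "g x * 2 ^ m \<le> real c + 1"
      "\<And>j. real (Suc j) < g x * 2 ^ m \<longleftrightarrow> j < c"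
      using card_below[of "g x * 2 ^ m"] True by auto
    have "indicator {x. real (Suc j) * (1 / 2 ^ m) < g x} x = (if j < c then 1 else 0 :: real)" for j
      using c(3)[of j] by (auto simp: indicator_def field_simps)
    then have "step_approx g m x = (\<Sum>j<m * 2 ^ m. if j < c then 1 / 2 ^ m else 0)"
      unfolding step_approx_def by (intro sum.cong) auto
    also have "\<dots> = (\<Sum>j\<in>{..<m * 2 ^ m} \<inter> {..<c}. 1 / 2 ^ m)"
      by (simp add: sum.If_cases Int_def lessThan_def)
    also have "\<dots> = real (min (m * 2 ^ m) c) / 2 ^ m"
    proof -
      have "{..<m * 2 ^ m} \<inter> {..<c} = {..<min (m * 2 ^ m) c}" by auto
      then show ?thesis by simp
    qed
    finally have s: "step_approx g m x = real (min (m * 2 ^ m) c) / 2 ^ m" .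
    have "real (min (m * 2 ^ m) c) \<le> g x * 2 ^ m" using c(1) by linarith
    then have 1: "step_approx g m x \<le> g x" unfolding s by (simp add: field_simps)
    have "g x \<le> step_approx g m x + 1 / 2 ^ m" if "g x \<le> real m"
    proof -
      have "g x * 2 ^ m \<le> real m * 2 ^ m" using that by (intro mult_right_mono) auto
      then have "real c \<le> real m * 2 ^ m" using c(1) by linarith
      then have "real c \<le> real (m * 2 ^ m)" by simp
      then have "c \<le> m * 2 ^ m" by (simp only: of_nat_le_iff)
      then have "min (m * 2 ^ m) c = c" by simp
      then show ?thesis using c(2) unfolding s by (simp add: field_simps)
    qed
    then show ?thesis using 1 True by simp
  qed
  then show "step_approx g m x \<le> max (g x) 0"
    and "g x \<le> real m \<Longrightarrow> max (g x) 0 \<le> step_approx g m x + 1 / 2 ^ m" by auto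
qed

text \<open>The shift to \<open>Suc m\<close> avoids \<open>step_approx g 0\<close>, an empty sum,
  to which \<open>Lqb_sum\<close> does not apply.\<close>

lemma step_approx_tendsto: "(\<lambda>m. step_approx g (Suc m) x) \<longlonglongrightarrow> max (g x) 0"
proof (rule LIMSEQ_Suc, rule tendsto_sandwich)
  obtain m0 :: nat where m0: "g x \<le> real m0" using real_arch_simple by blast
  show "\<forall>\<^sub>F m in sequentially. max (g x) 0 - (1 / 2) ^ m \<le> step_approx g m x"
    using eventually_ge_at_top[of m0]
  proof eventually_elim
    case (elim m)
    then have "g x \<le> real m" using m0 by simp
    from step_approx_bounds(3)[of g x m, OF this] show ?case by (simp only: power_one_over diff_le_eq)
  qed
  show "\<forall>\<^sub>F m in sequentially. step_approx g m x \<le> max (g x) 0"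
    by (intro always_eventually allI step_approx_bounds(2))
  have "(\<lambda>m. max (g x) 0 - (1 / 2) ^ m) \<longlonglongrightarrow> max (g x) 0 - 0"
    by (intro tendsto_diff tendsto_const LIMSEQ_power_zero) simp
  then show "(\<lambda>m. max (g x) 0 - (1 / 2) ^ m) \<longlonglongrightarrow> max (g x) 0" by simp
qed simp

context mpt
begin

lemma Lqb_Fatou:
  assumes u: "\<And>m. Lqb (u m) A" and [measurable]: "v \<in> borel_measurable M"
    and lim: "AE x in M. (\<lambda>m. u m x) \<longlonglongrightarrow> v x"
  shows "Lqb v A"
proof -
  have [measurable]: "u m \<in> borel_measurable M" for m using u[of m] by (simp add: Lqb_def)
  have "(\<integral>\<^sup>+x. ennreal (\<bar>v x\<bar> powr q) \<partial>M) \<le> (\<integral>\<^sup>+x. liminf (\<lambda>m. ennreal (\<bar>u m x\<bar> powr q)) \<partial>M)"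
  proof (rule nn_integral_mono_AE)
    show "AE x in M. ennreal (\<bar>v x\<bar> powr q) \<le> liminf (\<lambda>m. ennreal (\<bar>u m x\<bar> powr q))"
      using lim
    proof eventually_elim
      case (elim x)
      have "(\<lambda>m. \<bar>u m x\<bar> powr q) \<longlonglongrightarrow> \<bar>v x\<bar> powr q"
        using elim q2 by (intro tendsto_powr' tendsto_rabs tendsto_const) auto
      then have "(\<lambda>m. ennreal (\<bar>u m x\<bar> powr q)) \<longlonglongrightarrow> ennreal (\<bar>v x\<bar> powr q)" by (rule tendsto_ennrealI)
      from lim_imp_Liminf[OF trivial_limit_sequentially this] show ?case by simp
    qed
  qed
  also have "\<dots> \<le> liminf (\<lambda>m. \<integral>\<^sup>+x. ennreal (\<bar>u m x\<bar> powr q) \<partial>M)"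
    by (rule nn_integral_liminf) measurable
  also have "\<dots> \<le> liminf (\<lambda>m. ennreal (A powr q))"
  proof (rule Liminf_mono, rule always_eventually, rule allI)
    fix m
    have "(\<integral>\<^sup>+x. ennreal (\<bar>u m x\<bar> powr q) \<partial>M) = ennreal (\<integral>x. \<bar>u m x\<bar> powr q \<partial>M)"
      using u[of m] by (intro nn_integral_eq_integral) (auto simp: Lqb_def)
    then show "(\<integral>\<^sup>+x. ennreal (\<bar>u m x\<bar> powr q) \<partial>M) \<le> ennreal (A powr q)"
      using u[of m] by (auto simp: Lqb_def intro: ennreal_leI)
  qed
  also have "\<dots> = ennreal (A powr q)" by (simp add: Liminf_const)
  finally have le: "(\<integral>\<^sup>+x. ennreal (\<bar>v x\<bar> powr q) \<partial>M) \<le> ennreal (A powr q)" .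
  have i: "integrable M (\<lambda>x. \<bar>v x\<bar> powr q)"
    using le by (intro integrableI_bounded) (auto simp: order_le_less_trans[OF le])
  moreover have "(\<integral>x. \<bar>v x\<bar> powr q \<partial>M) \<le> A powr q"
    using le nn_integral_eq_integral[OF i] by (simp add: ennreal_le_iff)
  ultimately show ?thesis by (simp add: Lqb_def)
qed

lemma Lqb_integrable: "Lqb f A \<Longrightarrow> integrable M f"
proof -
  assume f: "Lqb f A"
  have "\<bar>f x\<bar> \<le> 1 + \<bar>f x\<bar> powr q" for x
  proof (cases "\<bar>f x\<bar> \<le> 1")
    case False
    then have "\<bar>f x\<bar> powr 1 \<le> \<bar>f x\<bar> powr q" using q2 by (intro powr_mono) auto
    then show ?thesis by simp
  qed (simp add: add_increasing2)
  then show ?thesis using f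
    by (intro Bochner_Integration.integrable_bound[of M "\<lambda>x. 1 + \<bar>f x\<bar> powr q" f]) (auto simp: Lqb_def intro!: AE_I2)
qed

abbreviation birkc :: "nat \<Rightarrow> ('a \<Rightarrow> real) \<Rightarrow> 'a \<Rightarrow> real" where
  "birkc n f \<equiv> birk 1 n (\<lambda>x. f x - (\<integral>y. f y \<partial>M))"

lemma birk_measurable: "f \<in> borel_measurable M \<Longrightarrow> birk m n f \<in> borel_measurable M"
  unfolding birk_def[abs_def] by (intro borel_measurable_sum measurable_compose[OF pow_measurable])

lemma birkc_sum:
  assumes "\<And>j. j \<in> I \<Longrightarrow> integrable M (f j)"
  shows "birkc n (\<lambda>x. \<Sum>j\<in>I. a j * f j x) x = (\<Sum>j\<in>I. a j * birkc n (f j) x)"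
proof -
  have "(\<integral>y. (\<Sum>j\<in>I. a j * f j y) \<partial>M) = (\<Sum>j\<in>I. a j * (\<integral>y. f j y \<partial>M))"
    using assms by (subst Bochner_Integration.integral_sum) auto
  then have "birkc n (\<lambda>x. \<Sum>j\<in>I. a j * f j x) x = (\<Sum>i<n. \<Sum>j\<in>I. a j * (f j ((T ^^ i) x) - (\<integral>y. f j y \<partial>M)))"
    by (simp add: birk_def sum_subtractf right_diff_distrib)
  also have "\<dots> = (\<Sum>j\<in>I. a j * birkc n (f j) x)"
    by (subst sum.swap) (simp add: birk_def sum_distrib_left)
  finally show ?thesis .
qed

text \<open>Minkowski's inequality for the finite sums \<open>step_approx\<close>, then Fatou. The
  exponent -1 - \<tau> makes the level bounds summable uniformly in the mesh. \<open>H0\<close>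
  serves to bound the positive part of g itself, so that it is integrable and the means used for
  centring converge.\<close>

lemma layer_cake:
  assumes J: "\<And>t. 0 < t \<Longrightarrow> {x. t < g x} \<in> sets M" and \<tau>: "0 < \<tau>" and D: "0 < D" "0 < D0"
    and H0: "\<And>t. 0 < t \<Longrightarrow> Lqb (indicator {x. t < g x}) (D0 * (1 + t) powr (- 1 - \<tau>))"
    and H: "\<And>t n. 0 < t \<Longrightarrow> 0 < n \<Longrightarrow> Lqb (birkc n (indicator {x. t < g x})) (D * (1 + t) powr (- 1 - \<tau>) * real n powr \<eta>)"
  shows "(\<lambda>x. max (g x) 0) \<in> borel_measurable M" "integrable M (\<lambda>x. max (g x) 0)"
    "0 < n \<Longrightarrow> Lqb (birkc n (\<lambda>x. max (g x) 0)) (D / \<tau> * real n powr \<eta>)"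
proof -
  define t where "t m j = real (Suc j) * (1 / 2 ^ m)" for m j
  have t: "0 < t m j" for m j unfolding t_def by simp
  have ss: "step_approx g m = (\<lambda>x. \<Sum>j<m * 2 ^ m. 1 / 2 ^ m * indicator {x. t m j < g x} x)" for m
    unfolding step_approx_def[abs_def] t_def ..
  have sm [measurable]: "step_approx g m \<in> borel_measurable M" for m
    unfolding ss using J[OF t] by (intro borel_measurable_sum borel_measurable_times borel_measurable_indicator) auto
  have lim: "(\<lambda>m. step_approx g (Suc m) x) \<longlonglongrightarrow> max (g x) 0" for x by (rule step_approx_tendsto)
  show gm [measurable]: "(\<lambda>x. max (g x) 0) \<in> borel_measurable M"
    by (rule borel_measurable_LIMSEQ_real[OF lim]) simp
  have ne: "{..<Suc m * 2 ^ Suc m} \<noteq> {}" for m :: nat by (simp add: lessThan_empty_iff)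
  have sumle: "(\<Sum>j<Suc m * 2 ^ Suc m. 1 / 2 ^ Suc m * (C * (1 + t (Suc m) j) powr (- 1 - \<tau>))) \<le> C / \<tau>" if "0 < C" for C m
  proof -
    have "(\<Sum>j<Suc m * 2 ^ Suc m. 1 / 2 ^ Suc m * (C * (1 + t (Suc m) j) powr (- 1 - \<tau>))) =
      C * (\<Sum>j<Suc m * 2 ^ Suc m. 1 / 2 ^ Suc m * (1 + t (Suc m) j) powr (- 1 - \<tau>))"
      unfolding sum_distrib_left by (intro sum.cong) auto
    also have "\<dots> \<le> C * (1 / \<tau>)"
      unfolding t_def using that \<tau> by (intro mult_left_mono riemann_sum_bound) auto
    finally show ?thesis by simp
  qed
  have posb: "0 < (1 + t m j) powr (- 1 - \<tau>)" for m j using t[of m j] by simp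
  have "Lqb (step_approx g (Suc m)) (D0 / \<tau>)" for m
  proof (rule Lqb_mono[OF _ _ sumle[OF D(2), of m]])
    have "Lqb (\<lambda>x. 1 / 2 ^ Suc m * indicator {x. t (Suc m) j < g x} x) (1 / 2 ^ Suc m * (D0 * (1 + t (Suc m) j) powr (- 1 - \<tau>)))" for j
      using posb D by (intro Lqb_scale H0 t mult_pos_pos) auto
    then show "Lqb (step_approx g (Suc m)) (\<Sum>j<Suc m * 2 ^ Suc m. 1 / 2 ^ Suc m * (D0 * (1 + t (Suc m) j) powr (- 1 - \<tau>)))"
      unfolding ss using posb D by (intro Lqb_sum ne) auto
    show "0 \<le> (\<Sum>j<Suc m * 2 ^ Suc m. 1 / 2 ^ Suc m * (D0 * (1 + t (Suc m) j) powr (- 1 - \<tau>)))"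
      using D by (intro sum_nonneg) auto
  qed
  then have "Lqb (\<lambda>x. max (g x) 0) (D0 / \<tau>)"
    by (rule Lqb_Fatou) (auto intro: lim)
  then show gi: "integrable M (\<lambda>x. max (g x) 0)" by (rule Lqb_integrable)
  have mean: "(\<lambda>m. \<integral>y. step_approx g (Suc m) y \<partial>M) \<longlonglongrightarrow> (\<integral>y. max (g y) 0 \<partial>M)"
  proof (rule integral_dominated_convergence[OF gm sm gi])
    show "AE x in M. (\<lambda>m. step_approx g (Suc m) x) \<longlonglongrightarrow> max (g x) 0" by (simp add: lim)
    show "AE x in M. norm (step_approx g (Suc m) x) \<le> max (g x) 0" for m
    proof (rule AE_I2)
      fix x show "norm (step_approx g (Suc m) x) \<le> max (g x) 0"
        using step_approx_bounds(1,2)[of g "Suc m" x] by (simp only: real_norm_def abs_of_nonneg)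
    qed
  qed
  assume n: "0 < n"
  have ij: "integrable M (indicator {x. t m j < g x} :: 'a \<Rightarrow> real)" for m j
    by (rule Lqb_integrable[OF H0[OF t]])
  have "Lqb (birkc n (step_approx g (Suc m))) (D / \<tau> * real n powr \<eta>)" for m
  proof -
    have np: "0 < real n powr \<eta>" using n by simp
    have "Lqb (\<lambda>x. \<Sum>j<Suc m * 2 ^ Suc m. 1 / 2 ^ Suc m * birkc n (indicator {x. t (Suc m) j < g x}) x)
      (\<Sum>j<Suc m * 2 ^ Suc m. 1 / 2 ^ Suc m * (D * (1 + t (Suc m) j) powr (- 1 - \<tau>) * real n powr \<eta>))"
      using posb D np n by (intro Lqb_sum ne Lqb_scale H t mult_pos_pos) auto
    moreover have "birkc n (step_approx g (Suc m)) = (\<lambda>x. \<Sum>j<Suc m * 2 ^ Suc m. 1 / 2 ^ Suc m * birkc n (indicator {x. t (Suc m) j < g x}) x)"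
      unfolding ss by (rule ext, rule birkc_sum, rule ij)
    moreover have "(\<Sum>j<Suc m * 2 ^ Suc m. 1 / 2 ^ Suc m * (D * (1 + t (Suc m) j) powr (- 1 - \<tau>) * real n powr \<eta>)) =
       (\<Sum>j<Suc m * 2 ^ Suc m. 1 / 2 ^ Suc m * (D * (1 + t (Suc m) j) powr (- 1 - \<tau>))) * real n powr \<eta>"
      unfolding sum_distrib_right by (intro sum.cong) auto
    moreover have "\<dots> \<le> D / \<tau> * real n powr \<eta>"
      using np by (intro mult_right_mono sumle D) auto
    moreover have "0 \<le> (\<Sum>j<Suc m * 2 ^ Suc m. 1 / 2 ^ Suc m * (D * (1 + t (Suc m) j) powr (- 1 - \<tau>))) * real n powr \<eta>"
      using D by (intro mult_nonneg_nonneg sum_nonneg) auto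
    ultimately show ?thesis by (auto intro: Lqb_mono)
  qed
  then show "Lqb (birkc n (\<lambda>x. max (g x) 0)) (D / \<tau> * real n powr \<eta>)"
  proof (rule Lqb_Fatou)
    show "birkc n (\<lambda>x. max (g x) 0) \<in> borel_measurable M"
      by (intro birk_measurable) simp
    show "AE x in M. (\<lambda>m. birkc n (step_approx g (Suc m)) x) \<longlonglongrightarrow> birkc n (\<lambda>x. max (g x) 0) x"
      unfolding birk_def by (intro AE_I2 tendsto_sum tendsto_diff lim mean)
  qed
qed

text \<open>Centred sums over n terms differ in L1 by at most 2n times the L1 distance of the
  functions, so a subsequence of them converges almost everywhere and Fatou applies.\<close>

lemma L1_limit_Lqb:
  assumes f: "integrable M f" and n: "0 < n"
    and h: "\<And>\<epsilon>. 0 < \<epsilon> \<Longrightarrow> \<exists>h. integrable M h \<and> (\<integral>x. \<bar>f x - h x\<bar> \<partial>M) < \<epsilon> \<and> Lqb (birkc n h) A"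
  shows "Lqb (birkc n f) A"
proof -
  have "\<forall>k. \<exists>h. integrable M h \<and> (\<integral>x. \<bar>f x - h x\<bar> \<partial>M) < (1/2) ^ k \<and> Lqb (birkc n h) A"
    using h by simp
  then obtain h where h: "\<And>k::nat. integrable M (h k)" "\<And>k. (\<integral>x. \<bar>f x - h k x\<bar> \<partial>M) < (1/2) ^ k" "\<And>k. Lqb (birkc n (h k)) A"
    by metis
  define u where "u k x = birkc n f x - birkc n (h k) x" for k x
  have int_pow: "integrable M (\<lambda>x. w ((T ^^ i) x))" if "integrable M w" for w :: "'a \<Rightarrow> real" and i
  proof -
    have "integrable (distr M M (T ^^ i)) w" unfolding pow_distr by fact
    then show ?thesis by (subst (asm) integrable_distr_eq) (use that in auto)
  qed
  have ib: "integrable M (birkc n w)" if "integrable M w" for w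
    unfolding birk_def[abs_def] using that int_pow[OF that] by auto
  have iu: "integrable M (u k)" for k unfolding u_def[abs_def] using ib f h by auto
  have bound: "(\<integral>x. \<bar>u k x\<bar> \<partial>M) \<le> 2 * real n * (1/2) ^ k" for k
  proof -
    define w where "w x = f x - h k x" for x
    have w: "integrable M w" unfolding w_def[abs_def] using f h by auto
    define c where "c = (\<integral>x. w x \<partial>M)"
    have ueq: "u k x = (\<Sum>i<n. w ((T ^^ i) x) - c)" for x
    proof -
      have "c = (\<integral>x. f x \<partial>M) - (\<integral>x. h k x \<partial>M)" unfolding c_def w_def using f h by simp
      then show ?thesis
        unfolding u_def birk_def w_def sum_subtractf[symmetric] by (intro sum.cong) auto
    qed
    have cw: "\<bar>c\<bar> \<le> (\<integral>x. \<bar>w x\<bar> \<partial>M)" unfolding c_def by (rule integral_abs_bound)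
    have "(\<integral>x. \<bar>u k x\<bar> \<partial>M) \<le> (\<integral>x. (\<Sum>i<n. \<bar>w ((T ^^ i) x)\<bar> + \<bar>c\<bar>) \<partial>M)"
    proof (rule integral_mono)
      show "\<bar>u k x\<bar> \<le> (\<Sum>i<n. \<bar>w ((T ^^ i) x)\<bar> + \<bar>c\<bar>)" for x
        unfolding ueq by (rule order_trans[OF sum_abs sum_mono[OF abs_triangle_ineq4]])
    qed (use iu int_pow[OF w] in auto)
    also have "\<dots> = (\<Sum>i<n. (\<integral>x. \<bar>w ((T ^^ i) x)\<bar> \<partial>M) + \<bar>c\<bar>)"
      using int_pow[OF w] by (subst Bochner_Integration.integral_sum) (auto simp: prob_space)
    also have "\<dots> = (\<Sum>i<n. (\<integral>x. \<bar>w x\<bar> \<partial>M) + \<bar>c\<bar>)"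
      using integral_pow[of "\<lambda>x. \<bar>w x\<bar>"] w by simp
    also have "\<dots> \<le> (\<Sum>i<n. (1/2) ^ k + (1/2) ^ k)"
      using cw h(2)[of k] by (intro sum_mono) (simp add: w_def)
    finally show ?thesis by simp
  qed
  have lim0: "(\<lambda>k. \<integral>x. norm (u k x) \<partial>M) \<longlonglongrightarrow> 0"
  proof (rule tendsto_sandwich[OF _ _ tendsto_const])
    have "(\<lambda>k. 2 * real n * (1/2) ^ k) \<longlonglongrightarrow> 2 * real n * 0"
      by (intro tendsto_mult tendsto_const LIMSEQ_power_zero) simp
    then show "(\<lambda>k. 2 * real n * (1/2) ^ k) \<longlonglongrightarrow> 0" by simp
  qed (use bound in auto)
  obtain r where r: "strict_mono r" "AE x in M. (\<lambda>k. u (r k) x) \<longlonglongrightarrow> 0"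
    using tendsto_L1_AE_subseq[OF iu lim0] by blast
  show ?thesis
  proof (rule Lqb_Fatou[of "\<lambda>k. birkc n (h (r k))"])
    show "Lqb (birkc n (h (r k))) A" for k by (rule h(3))
    show "birkc n f \<in> borel_measurable M" using f by (intro birk_measurable) auto
    show "AE x in M. (\<lambda>k. birkc n (h (r k)) x) \<longlonglongrightarrow> birkc n f x"
      using r(2)
    proof eventually_elim
      case (elim x)
      have "(\<lambda>k. birkc n f x - u (r k) x) \<longlonglongrightarrow> birkc n f x - 0"
        by (intro tendsto_diff tendsto_const elim)
      then show ?case by (simp add: u_def)
    qed
  qed
qed

end

section \<open>Proof of the moment bounds\<close>

lemma acip_mpt:
  assumes "acip \<gamma> \<nu>" "T_map \<gamma> \<in> borel_measurable borel" "2 \<le> q" shows "mpt \<nu> (T_map \<gamma>) q"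
proof -
  have s: "sets \<nu> = sets borel" using assms by (simp add: acip_def)
  have "distr \<nu> \<nu> (T_map \<gamma>) = distr \<nu> borel (T_map \<gamma>)" by (rule distr_cong) (simp_all add: s)
  then have d: "distr \<nu> \<nu> (T_map \<gamma>) = \<nu>" using assms by (simp add: acip_def)
  have m: "T_map \<gamma> \<in> measurable \<nu> \<nu>" using assms(2) measurable_cong_sets[OF s s] by simp
  show ?thesis
    using assms d m unfolding mpt_def mpt_axioms_def by (simp add: acip_def)
qed

text \<open>The correlation X at time i is at most 2 \<nu>(J) and at most C i^(-\<delta>), hence at
  most a weighted geometric mean of the two, with weight \<theta> on the decay. The bound a replaces
  \<nu>(J) so as to stay positive for null intervals.\<close>

lemma (in lsv) interval_moment:
  assumes acip: "acip \<gamma> \<nu>" and q: "2 \<le> q" and \<kappa>: "0 < \<kappa>" "\<kappa> < 1" and \<theta>: "0 < \<theta>" "\<theta> < 1"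
    and \<beta>: "0 \<le> \<beta>" "\<beta> \<le> 1" "\<beta> \<noteq> 1/2" "\<beta> * q \<le> \<kappa> * ((1 - \<gamma>) / \<gamma>) * \<theta>"
  shows "\<exists>D>0. \<forall>J a n. is_interval J \<longrightarrow> 0 < a \<longrightarrow> measure \<nu> J \<le> a \<longrightarrow> 0 < n \<longrightarrow>
    mpt.Lqb \<nu> q (mpt.birk (T_map \<gamma>) 1 n (\<lambda>x. indicator J x - (\<integral>y. indicator J y \<partial>\<nu>)))
      (D * a powr ((1 - \<theta>) / q) * real n powr (max (1/2) (1 - \<beta>)))"
proof -
  interpret N: mpt \<nu> "T_map \<gamma>" q by (rule acip_mpt[OF acip T_map_measurable q])
  obtain C where C: "0 < C" "\<And>J n \<Psi>. is_interval J \<Longrightarrow> 0 < n \<Longrightarrow> \<Psi> \<in> borel_measurable borel \<Longrightarrow> (\<And>x. \<bar>\<Psi> x\<bar> \<le> 1) \<Longrightarrow>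
    \<bar>\<integral>x. (indicator J x - measure \<nu> J) * \<Psi> ((T_map \<gamma> ^^ n) x) \<partial>\<nu>\<bar> \<le>
      C * real n powr (- (\<kappa> * ((1 - \<gamma>) / \<gamma>)))"
    using nu_correlation_decay[OF acip \<kappa>] by blast
  define \<delta> where "\<delta> = \<kappa> * ((1 - \<gamma>) / \<gamma>)"
  obtain D where D: "0 < D" "\<And>f c n. f \<in> borel_measurable \<nu> \<Longrightarrow> (\<And>x. \<bar>f x\<bar> \<le> 1) \<Longrightarrow> 0 < c \<Longrightarrow> N.Lqb f c \<Longrightarrow>
    (\<And>i g. 0 < i \<Longrightarrow> g \<in> borel_measurable \<nu> \<Longrightarrow> (\<And>x. \<bar>g x\<bar> \<le> 1) \<Longrightarrow>
       \<bar>\<integral>x. f x * g ((T_map \<gamma> ^^ i) x) \<partial>\<nu>\<bar> \<le> (c * real i powr (- \<beta>)) powr q) \<Longrightarrow>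
    0 < n \<Longrightarrow> N.Lqb (N.birk 1 n f) (D * c * real n powr (max (1/2) (1 - \<beta>)))"
    using N.moment_bound[OF \<beta>(1-3)] by blast
  have "N.Lqb (N.birk 1 n (\<lambda>x. indicator J x - (\<integral>y. indicator J y \<partial>\<nu>)))
      (D * (2 + C) powr (1 / q) * a powr ((1 - \<theta>) / q) * real n powr (max (1/2) (1 - \<beta>)))"
    if J: "is_interval J" and a: "0 < a" "measure \<nu> J \<le> a" and n: "0 < n" for J a n
  proof -
    define m where "m = measure \<nu> J"
    have [measurable]: "J \<in> sets \<nu>"
      unfolding sets_nu[OF acip] using J by (rule real_interval_borel_measurable)
    have mi: "(\<integral>y. indicator J y \<partial>\<nu>) = m"
      unfolding m_def by (simp add: space_nu[OF acip])
    have m: "0 \<le> m" "m \<le> 1" by (auto simp: m_def)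
    have ma: "m \<le> a powr (1 - \<theta>)"
    proof (cases "m = 0")
      case False
      have "m powr 1 \<le> m powr (1 - \<theta>)" using False m \<theta> by (intro powr_mono') auto
      also have "\<dots> \<le> a powr (1 - \<theta>)" using m a \<theta> by (intro powr_mono2) (auto simp: m_def)
      finally show ?thesis using m by simp
    qed simp
    \<comment> \<open>Chosen so that c^q = (2 + C) a^(1-\<theta>); the constant 2 + C dominates
      those of both bounds that are interpolated.\<close>
    define c where "c = (2 + C) powr (1 / q) * a powr ((1 - \<theta>) / q)"
    have c: "0 < c" using C a by (simp add: c_def)
    have cq: "c powr q = (2 + C) * a powr (1 - \<theta>)"
      using C a q by (simp add: c_def powr_mult powr_powr)
    define f where "f x = indicator J x - m" for x
    have [measurable]: "f \<in> borel_measurable \<nu>" unfolding f_def[abs_def] by measurable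
    have f1: "\<bar>f x\<bar> \<le> 1" for x using m by (auto simp: f_def indicator_def)
    have ij: "integrable \<nu> (indicator J :: real \<Rightarrow> real)"
      by (intro N.bdd_integrable N.bddI[of _ 1]) (auto simp: indicator_def)
    have fabs: "(\<integral>x. \<bar>f x\<bar> \<partial>\<nu>) \<le> 2 * m"
    proof -
      have "(\<integral>x. \<bar>f x\<bar> \<partial>\<nu>) \<le> (\<integral>x. indicator J x + m \<partial>\<nu>)"
      proof (rule integral_mono)
        show "integrable \<nu> (\<lambda>x. \<bar>f x\<bar>)"
          by (intro integrable_abs N.bdd_integrable N.bddI[of _ 1] f1) simp
        show "\<bar>f x\<bar> \<le> indicator J x + m" for x using m by (auto simp: f_def indicator_def)
      qed (use ij in auto)
      also have "\<dots> = 2 * m" using ij mi by (simp add: N.prob_space)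
      finally show ?thesis .
    qed
    have bf: "N.bdd f" by (rule N.bddI[of _ 1]) (auto simp: f1)
    have Lf: "N.Lqb f c"
    proof (rule N.Lqb_bdd[OF bf])
      have "(\<integral>x. \<bar>f x\<bar> powr q \<partial>\<nu>) \<le> (\<integral>x. \<bar>f x\<bar> \<partial>\<nu>)"
      proof (rule integral_mono)
        show "\<bar>f x\<bar> powr q \<le> \<bar>f x\<bar>" for x
          using f1[of x] q powr_mono'[of 1 q "\<bar>f x\<bar>"] by simp
        show "integrable \<nu> (\<lambda>x. \<bar>f x\<bar> powr q)" using q by (intro N.bdd_integrable N.bdd_powr bf) auto
        show "integrable \<nu> (\<lambda>x. \<bar>f x\<bar>)" by (intro integrable_abs N.bdd_integrable bf)
      qed
      also have "\<dots> \<le> 2 * a powr (1 - \<theta>)" using fabs ma by linarith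
      also have "\<dots> \<le> c powr q" unfolding cq using C by (intro mult_right_mono) auto
      finally show "(\<integral>x. \<bar>f x\<bar> powr q \<partial>\<nu>) \<le> c powr q" .
    qed
    have cor: "\<bar>\<integral>x. f x * g ((T_map \<gamma> ^^ i) x) \<partial>\<nu>\<bar> \<le> (c * real i powr (- \<beta>)) powr q"
      if i: "0 < i" and g: "g \<in> borel_measurable \<nu>" "\<And>x. \<bar>g x\<bar> \<le> 1" for i g
    proof -
      have gb: "g \<in> borel_measurable borel"
        using g(1) measurable_cong_sets[OF sets_nu[OF acip] refl] by blast
      define X where "X = \<bar>\<integral>x. f x * g ((T_map \<gamma> ^^ i) x) \<partial>\<nu>\<bar>"
      have X0: "0 \<le> X" by (simp add: X_def)
      have X1: "X \<le> C * real i powr (- \<delta>)"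
        unfolding X_def f_def m_def \<delta>_def using C(2)[OF J i gb g(2)] .
      have X2: "X \<le> 2 * m"
      proof -
        have bg: "N.bdd (\<lambda>x. g ((T_map \<gamma> ^^ i) x))" by (rule N.bdd_comp[OF N.pow_measurable N.bddI[OF g]])
        have "X \<le> (\<integral>x. \<bar>f x * g ((T_map \<gamma> ^^ i) x)\<bar> \<partial>\<nu>)" unfolding X_def by (rule integral_abs_bound)
        also have "\<dots> \<le> (\<integral>x. \<bar>f x\<bar> \<partial>\<nu>)"
        proof (rule integral_mono)
          show "\<bar>f x * g ((T_map \<gamma> ^^ i) x)\<bar> \<le> \<bar>f x\<bar>" for x
            using g(2)[of "(T_map \<gamma> ^^ i) x"] mult_left_mono[of "\<bar>g ((T_map \<gamma> ^^ i) x)\<bar>" 1 "\<bar>f x\<bar>"]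
            by (simp add: abs_mult)
        qed (intro integrable_abs N.bdd_integrable N.bdd_mult bf bg)+
        finally show ?thesis using fabs by linarith
      qed
      have "X \<le> (2 + C) * a powr (1 - \<theta>) * real i powr (- \<delta> * \<theta>)"
      proof (cases "X = 0")
        case True
        then show ?thesis using C a by simp
      next
        case False
        then have Xp: "0 < X" using X0 by simp
        have "X = X powr (1 - \<theta>) * X powr \<theta>" using Xp by (simp add: powr_add[symmetric])
        also have "\<dots> \<le> ((2 + C) * a) powr (1 - \<theta>) * ((2 + C) * real i powr (- \<delta>)) powr \<theta>"
        proof (intro mult_mono powr_mono2)
          have "2 * m \<le> (2 + C) * a" using m a C unfolding m_def by (intro mult_mono) auto
          then show "X \<le> (2 + C) * a" using X2 by linarith
          have "C * real i powr (- \<delta>) \<le> (2 + C) * real i powr (- \<delta>)" by (intro mult_right_mono) auto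
          then show "X \<le> (2 + C) * real i powr (- \<delta>)" using X1 by linarith
        qed (use \<theta> Xp in auto)
        also have "\<dots> = (2 + C) powr (1 - \<theta>) * a powr (1 - \<theta>) * ((2 + C) powr \<theta> * (real i powr (- \<delta>)) powr \<theta>)"
          using C a by (simp add: powr_mult)
        also have "\<dots> = ((2 + C) powr (1 - \<theta>) * (2 + C) powr \<theta>) * a powr (1 - \<theta>) * real i powr (- \<delta> * \<theta>)"
          by (simp add: powr_powr)
        also have "(2 + C) powr (1 - \<theta>) * (2 + C) powr \<theta> = 2 + C" using C by (simp add: powr_add[symmetric])
        finally show ?thesis .
      qed
      also have "\<dots> \<le> (2 + C) * a powr (1 - \<theta>) * real i powr (- \<beta> * q)"
        using C i \<beta>(4) by (intro mult_left_mono powr_mono) (auto simp: \<delta>_def)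
      also have "\<dots> = (c * real i powr (- \<beta>)) powr q"
        using c by (simp add: powr_mult powr_powr cq)
      finally show ?thesis unfolding X_def .
    qed
    have "N.Lqb (N.birk 1 n f) (D * c * real n powr (max (1/2) (1 - \<beta>)))"
      by (rule D(2)[OF _ f1 c Lf cor n]) simp
    then show ?thesis unfolding f_def[abs_def] mi c_def by (simp add: mult.assoc)
  qed
  then show ?thesis using D(1) C(1) by (intro exI[of _ "D * (2 + C) powr (1 / q)"]) auto
qed

section \<open>Monotone functions with weak tails\<close>

lemma Mon_uminus:
  assumes "g \<in> Mon M p \<mu>" shows "(\<lambda>x. - g x) \<in> Mon M p \<mu>"
  using assms unfolding Mon_def mono_on_def monotone_on_def by auto

text \<open>g vanishes off I, so a level set at positive height lies inside I, where g is
  monotone.\<close>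

lemma Mon_level_interval:
  assumes g: "g \<in> Mon M p \<mu>" and t: "0 < t" shows "is_interval {x. t < g x}"
proof -
  obtain I where I: "is_interval I" "mono_on I g \<or> antimono_on I g" "\<And>x. x \<notin> I \<Longrightarrow> g x = 0"
    using g by (auto simp: Mon_def)
  show ?thesis
    unfolding is_interval_1
  proof (intro ballI allI impI)
    fix a b x assume a: "a \<in> {x. t < g x}" and b: "b \<in> {x. t < g x}" and x: "a \<le> x \<and> x \<le> b"
    have ab: "a \<in> I" "b \<in> I" using a b t I(3)[of a] I(3)[of b] by fastforce+
    then have xI: "x \<in> I" using I(1) x unfolding is_interval_1 by blast
    have "g a \<le> g x \<or> g b \<le> g x"
      using I(2) monotone_onD[OF _ ab(1) xI] monotone_onD[OF _ xI ab(2)] x by blast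
    then show "x \<in> {x. t < g x}" using a b by auto
  qed
qed

text \<open>Treats finite and infinite p alike through a tail of order (1 + t)^(-P). With \<theta> =
  \<kappa> q \<open>pq_ratio p q\<close>, the strict inequality says P (1 - \<theta>) / q > 1, which
  is the summability needed in \<open>layer_cake\<close>. For finite p one has P = p, and \<kappa> =
  1 would give equality.\<close>

lemma Mon_tail:
  assumes \<mu>: "prob_space \<mu>" "sets \<mu> = sets borel" and M: "0 < M" and q: "2 \<le> q" "ereal q < p" and \<kappa>: "0 < \<kappa>" "\<kappa> < 1"
  shows "\<exists>c P. 0 < c \<and> 0 < P \<and> q < P * (1 - \<kappa> * (q * pq_ratio p q)) \<and>
    (\<forall>g\<in>Mon M p \<mu>. \<forall>t>0. measure \<mu> {x. t < g x} \<le> c * (1 + t) powr (- P))"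
    and "0 < pq_ratio p q" "q * pq_ratio p q \<le> 1"
proof -
  interpret prob_space \<mu> by fact
  have sp: "space \<mu> = UNIV" using sets_eq_imp_space_eq[OF \<mu>(2)] by simp
  have meas: "{x. t < g x} \<in> sets \<mu>" if "g \<in> Mon M p \<mu>" "0 < t" for g t
    unfolding \<mu>(2) by (rule real_interval_borel_measurable[OF Mon_level_interval[OF that]])
  have absm: "{x. t < \<bar>g x\<bar>} \<in> sets \<mu>" if "g \<in> Mon M p \<mu>" "0 < t" for g t
  proof -
    have "{x. t < \<bar>g x\<bar>} = {x. t < g x} \<union> {x. t < - g x}" by auto
    then show ?thesis using meas[OF that] meas[OF Mon_uminus[OF that(1)] that(2)] by auto
  qed
  have le_abs: "measure \<mu> {x. t < g x} \<le> measure \<mu> {x. s < \<bar>g x\<bar>}" if "g \<in> Mon M p \<mu>" "0 < s" "s \<le> t" for g s t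
    using that absm[OF that(1,2)] by (intro finite_measure_mono) auto
  have small: "1 \<le> (1 + M) powr P * (1 + t) powr (- P)" if "t \<le> M" "0 < t" "0 < P" for t P
  proof -
    have "(1 + t) powr P \<le> (1 + M) powr P" using that by (intro powr_mono2) auto
    then show ?thesis using that by (simp add: powr_minus field_simps)
  qed
  show "\<exists>c P. 0 < c \<and> 0 < P \<and> q < P * (1 - \<kappa> * (q * pq_ratio p q)) \<and>
    (\<forall>g\<in>Mon M p \<mu>. \<forall>t>0. measure \<mu> {x. t < g x} \<le> c * (1 + t) powr (- P))"
  proof (cases "p = \<infinity>")
    case True
    \<comment> \<open>The tail vanishes beyond M, so any P is allowed. As q
      \<open>pq_ratio p q\<close> is 1 here, this choice makes P (1 - \<kappa>) equal to 2q.\<close>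
    define P where "P = 2 * q / (1 - \<kappa>)"
    have P: "0 < P" using q \<kappa> by (simp add: P_def)
    have "measure \<mu> {x. t < g x} \<le> (1 + M) powr P * (1 + t) powr (- P)" if g: "g \<in> Mon M p \<mu>" and t: "0 < t" for g t
    proof (cases "t \<le> M")
      case tM: True
      show ?thesis using small[OF tM t P] prob_le_1[of "{x. t < g x}"] by linarith
    next
      case False
      have "measure \<mu> {x. t < g x} \<le> measure \<mu> {x. M < \<bar>g x\<bar>}" using False g M by (intro le_abs) auto
      also have "\<dots> = 0" using g True by (simp add: Mon_def sp)
      finally show ?thesis using M by (simp add: order_trans)
    qed
    moreover have "q < P * (1 - \<kappa> * (q * pq_ratio p q))"
      using True q \<kappa> by (simp add: pq_ratio_def P_def)
    ultimately show ?thesis using P M by (intro exI[of _ "(1 + M) powr P"] exI[of _ P]) auto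
  next
    case False
    then obtain P where P: "p = ereal P" using q by (cases p) auto
    have Pq: "q < P" using q P by simp
    have "measure \<mu> {x. t < g x} \<le> (1 + M) powr P * (1 + t) powr (- P)" if g: "g \<in> Mon M p \<mu>" and t: "0 < t" for g t
    proof (cases "t \<le> M")
      case tM: True
      have "0 < P" using Pq q by linarith
      from small[OF tM t this] show ?thesis using prob_le_1[of "{x. t < g x}"] by linarith
    next
      case False
      have "measure \<mu> {x. t < g x} \<le> measure \<mu> {x. t < \<bar>g x\<bar>}" using g t by (intro le_abs) auto
      also have "\<dots> \<le> M powr P * t powr (- P)"
        using g t P by (simp add: Mon_def sp)
      also have "\<dots> \<le> (1 + M) powr P * (1 + t) powr (- P)"
      proof -
        have "M * (1 + t) \<le> (1 + M) * t" using False M by (simp add: algebra_simps)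
        then have "(M * (1 + t)) powr P \<le> ((1 + M) * t) powr P" using M t Pq q by (intro powr_mono2) auto
        then have "M powr P * (1 + t) powr P \<le> (1 + M) powr P * t powr P" using M t by (simp add: powr_mult)
        then show ?thesis using t by (simp add: powr_minus divide_simps mult.commute)
      qed
      finally show ?thesis .
    qed
    moreover have "q < P * (1 - \<kappa> * (q * pq_ratio p q))"
    proof -
      have "P * (1 - \<kappa> * (q * pq_ratio p q)) = P - \<kappa> * (P - q)"
        using P Pq q by (simp add: pq_ratio_def field_simps)
      moreover have "\<kappa> * (P - q) < 1 * (P - q)" using Pq \<kappa> by (intro mult_strict_right_mono) auto
      ultimately show ?thesis by simp
    qed
    ultimately show ?thesis using Pq q M by (intro exI[of _ "(1 + M) powr P"] exI[of _ P]) auto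
  qed
  show "0 < pq_ratio p q" "q * pq_ratio p q \<le> 1"
    using q by (cases p; auto simp: pq_ratio_def Let_def field_simps)+
qed

lemma (in mpt) birkc_diff:
  assumes "integrable M f" "integrable M g"
  shows "birkc n (\<lambda>x. f x - g x) x = birkc n f x - birkc n g x"
  using assms by (simp add: birk_def sum_subtractf[symmetric] algebra_simps)

text \<open>\<kappa> is spent twice, on the decay rate and on \<theta> = \<kappa> q r, whence its
  square in the condition on \<beta>. \<open>layer_cake\<close> is applied to g and to -g, and the
  two positive parts are subtracted.\<close>

lemma (in lsv) Mon_moment:
  assumes acip: "acip \<gamma> \<nu>" and M: "0 < M" and q: "2 \<le> q" "ereal q < p" and \<kappa>: "0 < \<kappa>" "\<kappa> < 1"
    and \<beta>: "0 \<le> \<beta>" "\<beta> \<le> 1" "\<beta> \<noteq> 1/2" "\<beta> \<le> \<kappa>\<^sup>2 * ((1 - \<gamma>) / \<gamma> * pq_ratio p q)"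
  shows "\<exists>A>0. \<forall>g\<in>Mon M p \<nu>. integrable \<nu> g \<and>
    (\<forall>n>0. mpt.Lqb \<nu> q (mpt.birk (T_map \<gamma>) 1 n (\<lambda>x. g x - (\<integral>y. g y \<partial>\<nu>))) (A * real n powr (max (1/2) (1 - \<beta>))))"
proof -
  interpret N: mpt \<nu> "T_map \<gamma>" q by (rule acip_mpt[OF acip T_map_measurable q(1)])
  define r where "r = pq_ratio p q"
  have ps: "prob_space \<nu>" by (rule N.prob_space_axioms)
  note sn = sets_nu[OF acip]
  note tail = Mon_tail[OF ps sn M q \<kappa>, folded r_def]
  obtain c P where cP: "0 < c" "0 < P" "q < P * (1 - \<kappa> * (q * r))"
    "\<And>g t. g \<in> Mon M p \<nu> \<Longrightarrow> 0 < t \<Longrightarrow> measure \<nu> {x. t < g x} \<le> c * (1 + t) powr (- P)"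
    using tail(1) by blast
  define \<theta> where "\<theta> = \<kappa> * (q * r)"
  have qr: "0 < q * r" "q * r \<le> 1" using tail q by auto
  have \<theta>: "0 < \<theta>" "\<theta> < 1"
  proof -
    show "0 < \<theta>" unfolding \<theta>_def using \<kappa> qr by simp
    have "\<theta> \<le> \<kappa> * 1" unfolding \<theta>_def using \<kappa> qr by (intro mult_left_mono) auto
    then show "\<theta> < 1" using \<kappa> by simp
  qed
  have "\<beta> * q \<le> (\<kappa>\<^sup>2 * ((1 - \<gamma>) / \<gamma> * r)) * q"
    using \<beta>(4) q unfolding r_def by (intro mult_right_mono) auto
  also have "\<dots> = \<kappa> * ((1 - \<gamma>) / \<gamma>) * \<theta>" by (simp add: \<theta>_def power2_eq_square)
  finally have \<beta>q: "\<beta> * q \<le> \<kappa> * ((1 - \<gamma>) / \<gamma>) * \<theta>" .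
  define \<eta> where "\<eta> = max (1/2) (1 - \<beta>)"
  obtain D where D: "0 < D" "\<And>J a n. is_interval J \<Longrightarrow> 0 < a \<Longrightarrow> measure \<nu> J \<le> a \<Longrightarrow> 0 < n \<Longrightarrow>
    N.Lqb (N.birkc n (indicator J)) (D * a powr ((1 - \<theta>) / q) * real n powr \<eta>)"
    using interval_moment[OF acip q(1) \<kappa> \<theta> \<beta>(1-3) \<beta>q] unfolding \<eta>_def by blast
  define \<tau> where "\<tau> = P * (1 - \<theta>) / q - 1"
  have \<tau>: "0 < \<tau>" using cP q by (simp add: \<tau>_def \<theta>_def field_simps)
  define D1 where "D1 = D * c powr ((1 - \<theta>) / q)"
  have D1: "0 < D1" "0 < c powr (1 / q)" using D cP by (auto simp: D1_def)
  have expo: "- P * ((1 - \<theta>) / q) = - 1 - \<tau>" by (simp add: \<tau>_def)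
  have lev: "{x. t < g x} \<in> sets \<nu>" if "g \<in> Mon M p \<nu>" "0 < t" for g t
    unfolding sn by (rule real_interval_borel_measurable[OF Mon_level_interval[OF that]])
  have H: "N.Lqb (N.birkc n (indicator {x. t < g x})) (D1 * (1 + t) powr (- 1 - \<tau>) * real n powr \<eta>)"
    if g: "g \<in> Mon M p \<nu>" and t: "0 < t" and n: "0 < n" for g t n
  proof -
    have "N.Lqb (N.birkc n (indicator {x. t < g x})) (D * (c * (1 + t) powr (- P)) powr ((1 - \<theta>) / q) * real n powr \<eta>)"
      using t cP by (intro D(2) Mon_level_interval[OF g t] cP(4)[OF g t] n) auto
    moreover have "(c * (1 + t) powr (- P)) powr ((1 - \<theta>) / q) = c powr ((1 - \<theta>) / q) * (1 + t) powr (- 1 - \<tau>)"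
      using cP(1) t by (simp only: powr_mult powr_powr expo)
    ultimately show ?thesis by (simp only: D1_def mult.assoc)
  qed
  have H0: "N.Lqb (indicator {x. t < g x}) (c powr (1 / q) * (1 + t) powr (- 1 - \<tau>))"
    if g: "g \<in> Mon M p \<nu>" and t: "0 < t" for g t
  proof (rule N.Lqb_bdd)
    show "N.bdd (indicator {x. t < g x})" using lev[OF g t] by (intro N.bddI[of _ 1]) (auto simp: indicator_def)
    have "(\<integral>x. \<bar>indicator {x. t < g x} x\<bar> powr q \<partial>\<nu>) = (\<integral>x. indicator {x. t < g x} x \<partial>\<nu>)"
      using q by (intro Bochner_Integration.integral_cong) (auto simp: indicator_def)
    also have "\<dots> = measure \<nu> {x. t < g x}" using lev[OF g t] by (simp add: space_nu[OF acip])
    also have "\<dots> \<le> c * (1 + t) powr (- P)" by (rule cP(4)[OF g t])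
    also have "\<dots> \<le> c * (1 + t) powr (- P * (1 - \<theta>))"
      using cP t \<theta> by (intro mult_left_mono powr_mono) (auto simp: algebra_simps)
    also have "- P * (1 - \<theta>) = (- 1 - \<tau>) * q" using q by (simp add: \<tau>_def field_simps)
    also have "c * (1 + t) powr ((- 1 - \<tau>) * q) = (c powr (1 / q) * (1 + t) powr (- 1 - \<tau>)) powr q"
      using cP q by (simp add: powr_mult powr_powr)
    finally show "(\<integral>x. \<bar>indicator {x. t < g x} x\<bar> powr q \<partial>\<nu>) \<le> (c powr (1 / q) * (1 + t) powr (- 1 - \<tau>)) powr q" .
  qed
  define A where "A = D1 / \<tau> + D1 / \<tau>"
  have A: "0 < A" using D1 \<tau> by (simp add: A_def)
  have "integrable \<nu> g \<and> (\<forall>n>0. N.Lqb (N.birkc n g) (A * real n powr \<eta>))" if g: "g \<in> Mon M p \<nu>" for g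
  proof (intro conjI allI impI)
    note g' = Mon_uminus[OF g]
    note pos = N.layer_cake[of g, OF lev[OF g] \<tau> D1(1,2) H0[OF g] H[OF g]]
    note neg = N.layer_cake[of "\<lambda>x. - g x", OF lev[OF g'] \<tau> D1(1,2) H0[OF g'] H[OF g']]
    have geq: "max (g x) 0 - max (- g x) 0 = g x" for x by (auto simp: max_def)
    have "integrable \<nu> (\<lambda>x. max (g x) 0 - max (- g x) 0)"
      by (intro Bochner_Integration.integrable_diff pos(2) neg(2)) auto
    then show "integrable \<nu> g" by (simp only: geq)
    fix n :: nat assume n: "0 < n"
    have np: "0 < D1 / \<tau> * real n powr \<eta>" using n D1 \<tau> by simp
    have "N.Lqb (\<lambda>x. N.birkc n (\<lambda>x. max (g x) 0) x - N.birkc n (\<lambda>x. max (- g x) 0) x)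
      (D1 / \<tau> * real n powr \<eta> + D1 / \<tau> * real n powr \<eta>)"
      by (intro N.Lqb_diff pos(3) neg(3) np n) auto
    moreover have "(\<lambda>x. N.birkc n (\<lambda>x. max (g x) 0) x - N.birkc n (\<lambda>x. max (- g x) 0) x) =
      N.birkc n (\<lambda>x. max (g x) 0 - max (- g x) 0)"
      by (rule ext, rule N.birkc_diff[symmetric]) (auto intro: pos(2) neg(2))
    moreover have "N.birkc n (\<lambda>x. max (g x) 0 - max (- g x) 0) = N.birkc n g" by (simp only: geq)
    ultimately show "N.Lqb (N.birkc n g) (A * real n powr \<eta>)" by (simp only: A_def distrib_right)
  qed
  then show ?thesis using A unfolding \<eta>_def by blast
qed

lemma (in lsv) C_class_moment:
  assumes acip: "acip \<gamma> \<nu>" and M: "0 < M" and q: "2 \<le> q" "ereal q < p" and \<kappa>: "0 < \<kappa>" "\<kappa> < 1"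
    and \<beta>: "0 \<le> \<beta>" "\<beta> \<le> 1" "\<beta> \<noteq> 1/2" "\<beta> \<le> \<kappa>\<^sup>2 * ((1 - \<gamma>) / \<gamma> * pq_ratio p q)"
    and f: "f \<in> C_class M p \<nu>"
  shows "\<exists>A>0. \<forall>n. in_Lq \<nu> q (centred_sum \<gamma> \<nu> f n) \<and>
     (0 < n \<longrightarrow> Lq_norm \<nu> q (centred_sum \<gamma> \<nu> f n) \<le> A * real n powr (max (1/2) (1 - \<beta>)))"
proof -
  interpret N: mpt \<nu> "T_map \<gamma>" q by (rule acip_mpt[OF acip T_map_measurable q(1)])
  define \<eta> where "\<eta> = max (1/2) (1 - \<beta>)"
  obtain A where A: "0 < A" "\<And>g. g \<in> Mon M p \<nu> \<Longrightarrow> integrable \<nu> g"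
    "\<And>g n. g \<in> Mon M p \<nu> \<Longrightarrow> 0 < n \<Longrightarrow> N.Lqb (N.birkc n g) (A * real n powr \<eta>)"
    using Mon_moment[OF acip M q \<kappa> \<beta>] unfolding \<eta>_def by blast
  have comb: "N.Lqb (N.birkc n h) (2 * A * real n powr \<eta>)" if h: "h \<in> Mon_combinations M p \<nu>" and n: "0 < n" for h n
  proof -
    obtain m :: nat and a g where mag: "(\<Sum>i=1..m. \<bar>a i\<bar>) \<le> (1::real)" "\<And>i. i \<in> {1..m} \<Longrightarrow> g i \<in> Mon M p \<nu>"
      "h = (\<lambda>x. \<Sum>i=1..m. a i * g i x)"
      using h unfolding Mon_combinations_def by blast
    have np: "0 < A * real n powr \<eta>" using A n by simp
    show ?thesis
    proof (cases "m = 0")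
      case True
      then have "N.birkc n h = (\<lambda>x. 0)" unfolding mag(3) by (intro ext) (simp add: N.birk_def)
      then show ?thesis using q by (simp add: N.Lqb_def)
    next
      case False
      \<comment> \<open>\<open>Lqb_sum\<close> wants positive bounds while some a i may be 0, so 1/m
        is added to each weight; the total is then at most 2.\<close>
      have "N.Lqb (\<lambda>x. \<Sum>i=1..m. a i * N.birkc n (g i) x) (\<Sum>i=1..m. (\<bar>a i\<bar> + 1 / real m) * (A * real n powr \<eta>))"
        using False np n A(1) by (intro N.Lqb_sum N.Lqb_scale A(3) mag(2) mult_pos_pos add_nonneg_pos) auto
      moreover have "N.birkc n h = (\<lambda>x. \<Sum>i=1..m. a i * N.birkc n (g i) x)"
        unfolding mag(3) by (rule ext, rule N.birkc_sum) (intro A(2) mag(2))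
      moreover have "(\<Sum>i=1..m. (\<bar>a i\<bar> + 1 / real m) * (A * real n powr \<eta>)) =
        ((\<Sum>i=1..m. \<bar>a i\<bar>) + 1) * (A * real n powr \<eta>)"
        using False by (simp add: sum_distrib_right[symmetric] sum.distrib)
      moreover have "\<dots> \<le> 2 * (A * real n powr \<eta>)" using mag(1) np by (intro mult_right_mono) linarith+
      moreover have "0 \<le> ((\<Sum>i=1..m. \<bar>a i\<bar>) + 1) * (A * real n powr \<eta>)"
        using A(1) by (intro mult_nonneg_nonneg add_nonneg_nonneg sum_nonneg) auto
      ultimately have "N.Lqb (N.birkc n h) (2 * (A * real n powr \<eta>))" by (auto intro: N.Lqb_mono)
      then show ?thesis by (simp add: mult.assoc)
    qed
  qed
  have fi: "integrable \<nu> f" using f by (simp add: C_class_def)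
  have Lf: "N.Lqb (N.birkc n f) (2 * A * real n powr \<eta>)" if n: "0 < n" for n
  proof (rule N.L1_limit_Lqb[OF fi n])
    fix \<epsilon> :: real assume "0 < \<epsilon>"
    then obtain h where "h \<in> Mon_combinations M p \<nu>" "integrable \<nu> h" "(\<integral>x. \<bar>f x - h x\<bar> \<partial>\<nu>) < \<epsilon>"
      using f unfolding C_class_def by blast
    then show "\<exists>h. integrable \<nu> h \<and> (\<integral>x. \<bar>f x - h x\<bar> \<partial>\<nu>) < \<epsilon> \<and> N.Lqb (N.birkc n h) (2 * A * real n powr \<eta>)"
      using comb[OF _ n] by blast
  qed
  \<comment> \<open>The sum in question starts at i = 1 and \<open>birk\<close> at 0; the additional
    composition with T preserves the norm.\<close>
  have cs: "centred_sum \<gamma> \<nu> f n = (\<lambda>x. N.birkc n f ((T_map \<gamma> ^^ 1) x))" for n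
  proof
    fix x
    have "(\<Sum>i=1..n. f ((T_map \<gamma> ^^ i) x) - (\<integral>y. f y \<partial>\<nu>)) = (\<Sum>i<n. f ((T_map \<gamma> ^^ Suc i) x) - (\<integral>y. f y \<partial>\<nu>))"
      by (rule sum.reindex_bij_witness[of _ Suc "\<lambda>i. i - 1"]) auto
    then show "centred_sum \<gamma> \<nu> f n x = N.birkc n f ((T_map \<gamma> ^^ 1) x)"
      unfolding centred_sum_def N.birk_def by (simp only: funpow_Suc_right comp_apply funpow_0 One_nat_def mult_1 funpow.simps id_apply) simp
  qed
  have Lc: "N.Lqb (centred_sum \<gamma> \<nu> f n) (2 * A * real n powr \<eta>)" if "0 < n" for n
    unfolding cs by (rule N.Lqb_pow[OF Lf[OF that]])
  have "in_Lq \<nu> q (centred_sum \<gamma> \<nu> f n)" for n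
  proof (cases "n = 0")
    case True
    then show ?thesis by (simp add: in_Lq_def centred_sum_def[abs_def])
  next
    case False
    then show ?thesis using Lc[of n] by (simp add: in_Lq_def N.Lqb_def)
  qed
  moreover have "Lq_norm \<nu> q (centred_sum \<gamma> \<nu> f n) \<le> 2 * A * real n powr \<eta>" if n: "0 < n" for n
  proof -
    have "Lq_norm \<nu> q (centred_sum \<gamma> \<nu> f n) \<le> ((2 * A * real n powr \<eta>) powr q) powr (1 / q)"
      unfolding Lq_norm_def using Lc[OF n] q by (intro powr_mono2) (auto simp: N.Lqb_def)
    also have "\<dots> = 2 * A * real n powr \<eta>" using q A by (simp add: powr_powr)
    finally show ?thesis .
  qed
  ultimately show ?thesis using A(1) unfolding \<eta>_def by (intro exI[of _ "2 * A"]) auto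
qed

text \<open>With r = \<open>pq_ratio p q\<close> the threshold is 2r / (2r + 1), for finite and for
  infinite p.\<close>

lemma threshold_iff:
  assumes q: "2 \<le> q" "ereal q < p" and \<gamma>: "0 < \<gamma>" "\<gamma> < 1"
  shows "\<gamma> < threshold p q \<longleftrightarrow> 1/2 < (1 - \<gamma>) / \<gamma> * pq_ratio p q"
proof -
  define r where "r = pq_ratio p q"
  have thr: "0 < r \<and> threshold p q = 2 * r / (2 * r + 1)"
  proof (cases p)
    case (real P)
    then have P: "q < P" using q by simp
    have "2 * (P - q) / (2 * (P - q) + P * q) = 2 * ((P - q) / (P * q)) / (2 * ((P - q) / (P * q)) + 1)"
    proof -
      have nz: "P \<noteq> 0" "q \<noteq> 0" using P q by auto
      have "2 * ((P - q) / (P * q)) + 1 = (2 * (P - q) + P * q) / (P * q)" using nz by (simp add: add_divide_distrib)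
      then show ?thesis using nz by simp
    qed
    then show ?thesis using real P q by (simp add: r_def pq_ratio_def threshold_def)
  next
    case PInf
    have "2 / (2 + q) = 2 * (1 / q) / (2 * (1 / q) + 1)"
    proof -
      have "2 * (1 / q) + 1 = (2 + q) / q" using q by (simp add: add_divide_distrib)
      then show ?thesis using q by simp
    qed
    then show ?thesis using PInf q by (simp add: r_def pq_ratio_def threshold_def)
  qed (use q in auto)
  then have "\<gamma> < threshold p q \<longleftrightarrow> \<gamma> * (2 * r + 1) < 2 * r" by (simp add: pos_less_divide_eq)
  also have "\<dots> \<longleftrightarrow> \<gamma> < 2 * ((1 - \<gamma>) * r)" by (simp add: algebra_simps)
  also have "\<dots> \<longleftrightarrow> 1/2 < (1 - \<gamma>) / \<gamma> * r" using \<gamma> by (simp add: field_simps)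
  finally show ?thesis by (simp add: r_def)
qed

theorem corollary6p1:
  fixes \<gamma> M q :: real and p :: ereal and \<nu> :: "real measure" and f :: "real \<Rightarrow> real"
  assumes "0 < \<gamma>" and "\<gamma> < 1"
    and "acip \<gamma> \<nu>"
    and "M > 0" and "p > 2"
    and "f \<in> C_class M p \<nu>"
    and "2 \<le> q" and "ereal q < p"
  shows "(\<gamma> < threshold p q \<longrightarrow>
            (\<forall>n. in_Lq \<nu> q (centred_sum \<gamma> \<nu> f n)) \<and>
            (\<lambda>n. Lq_norm \<nu> q (centred_sum \<gamma> \<nu> f n)) \<in> O(\<lambda>n. sqrt (real n))) \<and>
         (threshold p q \<le> \<gamma> \<longrightarrow>
            (\<forall>n. in_Lq \<nu> q (centred_sum \<gamma> \<nu> f n)) \<and>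
            (\<forall>\<epsilon>>0. (\<lambda>n. Lq_norm \<nu> q (centred_sum \<gamma> \<nu> f n))
               \<in> O(\<lambda>n. real n powr (1 + \<epsilon> - (1 - \<gamma>) / \<gamma> * pq_ratio p q))))"
proof -
  interpret lsv \<gamma> by standard fact+
  note acip = assms(3) and M = assms(4) and f = assms(6) and q = assms(7,8)
  have ps: "prob_space \<nu>" "sets \<nu> = sets borel" using acip by (auto simp: acip_def)
  define s where "s = (1 - \<gamma>) / \<gamma> * pq_ratio p q"
  have r: "0 < pq_ratio p q" using Mon_tail(2)[OF ps M q, of "1/2"] by simp
  then have s: "0 < s" using assms(1,2) by (simp add: s_def)
  have iff: "\<gamma> < threshold p q \<longleftrightarrow> 1/2 < s"
    unfolding s_def by (rule threshold_iff[OF q assms(1,2)])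
  have norm0: "0 \<le> Lq_norm \<nu> q g" for g by (simp add: Lq_norm_def)
  have bigO: "(\<lambda>n. Lq_norm \<nu> q (centred_sum \<gamma> \<nu> f n)) \<in> O(\<lambda>n. real n powr e)"
    if "\<And>n. 0 < n \<Longrightarrow> Lq_norm \<nu> q (centred_sum \<gamma> \<nu> f n) \<le> A * real n powr e'" "0 < A" "e' \<le> e" for A e e'
  proof (rule bigoI[of _ A])
    show "\<forall>\<^sub>F n in sequentially. norm (Lq_norm \<nu> q (centred_sum \<gamma> \<nu> f n)) \<le> A * norm (real n powr e)"
      using eventually_gt_at_top[of 0]
    proof eventually_elim
      case (elim n)
      have "real n powr e' \<le> real n powr e" using that(3) elim by (intro powr_mono) auto
      then have "A * real n powr e' \<le> A * real n powr e" using that(2) by (intro mult_left_mono) auto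
      then show ?case using that(1)[OF elim] norm0 by simp
    qed
  qed
  have part1: "(\<forall>n. in_Lq \<nu> q (centred_sum \<gamma> \<nu> f n)) \<and>
      (\<lambda>n. Lq_norm \<nu> q (centred_sum \<gamma> \<nu> f n)) \<in> O(\<lambda>n. sqrt (real n))" if "\<gamma> < threshold p q"
  proof -
    have s2: "1/2 < s" using that iff by simp
    \<comment> \<open>The midpoint of 1/(2s) and 1, which keeps both k2 < 1 and k2 s > 1/2.\<close>
    define k2 where "k2 = (1 / (2 * s) + 1) / 2"
    have k2: "0 < k2" "k2 < 1" "1/2 < k2 * s" using s2 by (auto simp: k2_def field_simps)
    define \<kappa> where "\<kappa> = sqrt k2"
    have \<kappa>: "0 < \<kappa>" "\<kappa> < 1" "\<kappa>\<^sup>2 = k2" using k2 by (auto simp: \<kappa>_def)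
    define \<beta> where "\<beta> = min 1 (k2 * s)"
    have \<beta>: "0 \<le> \<beta>" "\<beta> \<le> 1" "\<beta> \<noteq> 1/2" "\<beta> \<le> \<kappa>\<^sup>2 * ((1 - \<gamma>) / \<gamma> * pq_ratio p q)" "1/2 < \<beta>"
      unfolding s_def[symmetric] \<kappa>(3) using k2 s by (auto simp: \<beta>_def)
    obtain A where A: "0 < A" "\<And>n. in_Lq \<nu> q (centred_sum \<gamma> \<nu> f n)"
      "\<And>n. 0 < n \<Longrightarrow> Lq_norm \<nu> q (centred_sum \<gamma> \<nu> f n) \<le> A * real n powr (max (1/2) (1 - \<beta>))"
      using C_class_moment[OF acip M q \<kappa>(1,2) \<beta>(1-4) f] by blast
    have "max (1/2) (1 - \<beta>) \<le> 1/2" using \<beta> by simp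
    from bigO[OF A(3,1) this] show ?thesis using A(2) by (simp add: powr_half_sqrt)
  qed
  have part2: "(\<forall>n. in_Lq \<nu> q (centred_sum \<gamma> \<nu> f n)) \<and>
      (\<lambda>n. Lq_norm \<nu> q (centred_sum \<gamma> \<nu> f n)) \<in> O(\<lambda>n. real n powr (1 + \<epsilon> - s))"
    if "threshold p q \<le> \<gamma>" and \<epsilon>: "0 < \<epsilon>" for \<epsilon>
  proof -
    have s2: "s \<le> 1/2" using that iff by simp
    \<comment> \<open>Makes the loss s - \<kappa>^2 s = (1 - \<kappa>) (1 + \<kappa>) s at most
      \<epsilon>; the lower bound 1/2 keeps \<kappa> positive when \<epsilon> is large.\<close>
    define \<kappa> where "\<kappa> = max (1/2) (1 - \<epsilon> / 2)"
    have \<kappa>: "0 < \<kappa>" "\<kappa> < 1" using \<epsilon> by (auto simp: \<kappa>_def)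
    have "1 - \<epsilon> / 2 \<le> \<kappa>" unfolding \<kappa>_def by (rule max.cobounded2)
    then have \<kappa>3: "1 - \<kappa> \<le> \<epsilon> / 2" by linarith
    have k2: "\<kappa>\<^sup>2 < 1" using \<kappa> by (simp add: abs_square_less_1)
    \<comment> \<open>Here \<beta> < s \<le> 1/2, which rules out the exceptional value 1/2 and
      makes 1 - \<beta> the larger exponent.\<close>
    define \<beta> where "\<beta> = \<kappa>\<^sup>2 * s"
    have lt: "\<beta> < s" unfolding \<beta>_def using k2 s by simp
    have b0: "0 \<le> \<beta>" using s by (simp add: \<beta>_def)
    have \<beta>: "0 \<le> \<beta>" "\<beta> \<le> 1" "\<beta> \<noteq> 1/2" "\<beta> \<le> \<kappa>\<^sup>2 * ((1 - \<gamma>) / \<gamma> * pq_ratio p q)"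
      unfolding s_def[symmetric] \<beta>_def[symmetric] using lt s2 b0 by auto
    obtain A where A: "0 < A" "\<And>n. in_Lq \<nu> q (centred_sum \<gamma> \<nu> f n)"
      "\<And>n. 0 < n \<Longrightarrow> Lq_norm \<nu> q (centred_sum \<gamma> \<nu> f n) \<le> A * real n powr (max (1/2) (1 - \<beta>))"
      using C_class_moment[OF acip M q \<kappa>(1,2) \<beta> f] by blast
    have "s - \<beta> \<le> \<epsilon>"
    proof -
      have "s - \<beta> = (1 - \<kappa>) * ((1 + \<kappa>) * s)" by (simp add: \<beta>_def power2_eq_square algebra_simps)
      also have "\<dots> \<le> \<epsilon> / 2 * (2 * (1/2))"
        using \<kappa> \<kappa>3 s s2 by (intro mult_mono) auto
      finally show ?thesis using \<epsilon> by simp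
    qed
    then have "max (1/2) (1 - \<beta>) \<le> 1 + \<epsilon> - s" using lt s2 \<epsilon> by auto
    from bigO[OF A(3,1) this] show ?thesis using A(2) by simp
  qed
  \<comment> \<open>Integrability in the second case is claimed without reference to an \<epsilon>,
    so it is read off from the instance \<epsilon> = 1.\<close>
  show ?thesis
    using part1 part2 part2[of 1] unfolding s_def by auto
qed

end
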